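(* Let $p\ne q$ be fixed in $(0,1)$. Then the distributions of the four random permutons $\boldsymbol{\mu}^{\mathrm{rec}}_p$, $\boldsymbol{\mu}^{\mathrm{rec}}_q$, $\boldsymbol{\mu}^{\mathrm{Br}}_p$ and $\boldsymbol{\mu}^{\mathrm{Br}}_q$ (recursive and Brownian separable permutons of parameters $p$ and $q$) are pairwise mutually singular.
   Context: $\mathrm{Leb}$ is Lebesgue measure on $[0,1]$. A permuton is a Borel probability measure on $[0,1]^2$ with both marginals equal to $\mathrm{Leb}$; the space of permutons carries the weak topology and its Borel $\sigma$-algebra. Two measures $\mu,\nu$ are singular if there is a measurable set $A$ with $\mu(A)=1$ and $\nu(A)=0$. Recursive separable permuton $\boldsymbol{\mu}^{\mathrm{rec}}_p$: let $(U_j)_{j\ge1}$ be i.i.d. uniform in $[0,1]$ and $(S_j)_{j\ge1}$ be i.i.d. signs in $\{\oplus,\ominus\}$ with $\mathbb P(S_j=\oplus)=p$, the two sequences being independent. For $x<y$ in $[0,1]$ let $j$ be the minimal index $j\ge 1$ such that $U_j\in(x,y]$; set $x\prec y$ if $S_j=\oplus$ and $y\prec x$ if $S_j=\ominus$ (no comparison if there is no such $j$). Let $\phi(x)=\mathrm{Leb}(\{y\in[0,1]: y\prec x\})$ and let $\boldsymbol{\mu}^{\mathrm{rec}}_p$ be the push-forward of $\mathrm{Leb}$ by the map $x\mapsto(x,\phi(x))$; this is almost surely a permuton. Brownian separable permuton $\boldsymbol{\mu}^{\mathrm{Br}}_p$: let $\mathfrak e$ be a normalized Brownian excursion on $[0,1]$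 and, conditionally on $\mathfrak e$, let $(S_m)$ be i.i.d. signs indexed by the (positions of) local minima $m$ of $\mathfrak e$, with $\mathbb P(S_m=\oplus)=p=1-\mathbb P(S_m=\ominus)$. For $x<y$ in $[0,1]$ let $m$ be the position of the minimum of $\mathfrak e$ on $[x,y]$; set $x\prec_{\mathrm{Br}}y$ if $S_m=\oplus$ and $y\prec_{\mathrm{Br}}x$ if $S_m=\ominus$ (if $m\in\{x,y\}$ is not a local minimum, $x$ and $y$ are incomparable; this concerns a Lebesgue-null set of pairs). Let $\phi_{\mathrm{Br}}(x)=\mathrm{Leb}(\{y\in[0,1]:y\prec_{\mathrm{Br}}x\})$ and let $\boldsymbol{\mu}^{\mathrm{Br}}_p$ be the push-forward of $\mathrm{Leb}$ by $x\mapsto(x,\phi_{\mathrm{Br}}(x))$; this is almost surely a permuton. *)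

theory Defs
  imports "HOL-Probability.Probability"
begin

section \<open>Permutons\<close>

abbreviation unit_square :: "(real \<times> real) set" where
  "unit_square \<equiv> {0..1} \<times> {0..1}"

definition Leb :: "real measure" where
  "Leb = restrict_space lborel {0..1}"

definition permuton :: "(real \<times> real) measure \<Rightarrow> bool" where
  "permuton \<mu> \<longleftrightarrow>
     prob_space \<mu> \<and>
     space \<mu> = unit_square \<and>
     sets \<mu> = sets (restrict_space borel unit_square) \<and>
     distr \<mu> Leb fst = Leb \<and>
     distr \<mu> Leb snd = Leb"

definition weak_topology :: "(real \<times> real) measure topology" where
  "weak_topology = topology_generated_by
     {{\<mu>. permuton \<mu> \<and> (\<integral>z. f z \<partial>\<mu>) \<in> V} | (f :: real \<times> real \<Rightarrow> real) V.
        continuous_on unit_square f \<and> open V}"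

text \<open>The space of permutons with the Borel \<open>\<sigma>\<close>-algebra of its weak topology.\<close>

definition permuton_space :: "(real \<times> real) measure measure" where
  "permuton_space = sigma (Collect permuton) {W. openin weak_topology W}"

definition singular :: "'a measure \<Rightarrow> 'a measure \<Rightarrow> bool" where
  "singular \<mu> \<nu> \<longleftrightarrow>
     (\<exists>A \<in> sets \<mu> \<inter> sets \<nu>. emeasure \<mu> A = 1 \<and> emeasure \<nu> A = 0)"

text \<open>
  The push-forward of \<open>Leb\<close> by \<open>x \<mapsto> (x, \<phi> x)\<close>, where \<open>\<phi> x = Leb {y. y \<prec> x}\<close> and
  \<open>prec y x\<close> stands for \<open>y \<prec> x\<close>.
\<close>

definition order_measure :: "(real \<Rightarrow> real \<Rightarrow> bool) \<Rightarrow> (real \<times> real) measure" where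
  "order_measure prec =
     distr Leb (restrict_space borel unit_square)
       (\<lambda>x. (x, measure Leb {y \<in> {0..1}. prec y x}))"

text \<open>Unlike in the library's \<open>indep_var\<close>, \<open>X\<close> and \<open>Y\<close> may take values in different types.\<close>

definition independent_vars ::
    "'a measure \<Rightarrow> 'b measure \<Rightarrow> ('a \<Rightarrow> 'b) \<Rightarrow> 'c measure \<Rightarrow> ('a \<Rightarrow> 'c) \<Rightarrow> bool" where
  "independent_vars M A X B Y \<longleftrightarrow>
     X \<in> M \<rightarrow>\<^sub>M A \<and> Y \<in> M \<rightarrow>\<^sub>M B \<and>
     prob_space.indep_set M
       (sets (vimage_algebra (space M) X A)) (sets (vimage_algebra (space M) Y B))"

text \<open>A sign is a Boolean, with \<open>True\<close> for \<open>\<oplus>\<close> and \<open>False\<close> for \<open>\<ominus>\<close>.\<close>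

definition iid_signs :: "'a measure \<Rightarrow> real \<Rightarrow> (nat \<Rightarrow> 'a \<Rightarrow> bool) \<Rightarrow> bool" where
  "iid_signs M p S \<longleftrightarrow>
     prob_space.indep_vars M (\<lambda>_. count_space UNIV) S UNIV \<and>
     (\<forall>j. distr M (count_space UNIV) (S j) = measure_pmf (bernoulli_pmf p))"


section \<open>The recursive separable permuton\<close>

definition first_hit :: "(nat \<Rightarrow> real) \<Rightarrow> real \<Rightarrow> real \<Rightarrow> nat \<Rightarrow> bool" where
  "first_hit u x y j \<longleftrightarrow> u j \<in> {x<..y} \<and> (\<forall>i<j. u i \<notin> {x<..y})"

definition rec_prec :: "(nat \<Rightarrow> real) \<Rightarrow> (nat \<Rightarrow> bool) \<Rightarrow> real \<Rightarrow> real \<Rightarrow> bool" where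
  "rec_prec u s x y \<longleftrightarrow>
     (x < y \<and> (\<exists>j. first_hit u x y j \<and> s j)) \<or>
     (y < x \<and> (\<exists>j. first_hit u y x j \<and> \<not> s j))"

text \<open>
  \<open>X\<close> is a random permuton on the probability space \<open>M\<close> that is almost surely equal to the
  recursive separable permuton built from some i.i.d. sequences on \<open>M\<close>; these are indexed
  from \<open>0\<close>.
\<close>

definition recursive_separable_permuton ::
    "'a measure \<Rightarrow> real \<Rightarrow> ('a \<Rightarrow> (real \<times> real) measure) \<Rightarrow> bool" where
  "recursive_separable_permuton M p X \<longleftrightarrow>
     prob_space M \<and>
     X \<in> M \<rightarrow>\<^sub>M permuton_space \<and>
     (\<exists>U S.
        prob_space.indep_vars M (\<lambda>_. borel) U UNIV \<and>
        (\<forall>j. distr M borel (U j) = uniform_measure lborel {0..1}) \<and>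
        iid_signs M p S \<and>
        independent_vars M
          (PiM UNIV (\<lambda>_. borel)) (\<lambda>\<omega> j. U j \<omega>)
          (PiM UNIV (\<lambda>_. count_space UNIV)) (\<lambda>\<omega> j. S j \<omega>) \<and>
        (AE \<omega> in M. X \<omega> = order_measure (rec_prec (\<lambda>j. U j \<omega>) (\<lambda>j. S j \<omega>))))"


section \<open>The normalized Brownian excursion\<close>

text \<open>Density of the hitting time of \<open>0\<close>, at time \<open>t\<close>, for Brownian motion started at \<open>x > 0\<close>.\<close>

definition hitting_density :: "real \<Rightarrow> real \<Rightarrow> real" where
  "hitting_density t x = x / t * normal_density 0 (sqrt t) x"

text \<open>Transition density of Brownian motion killed at \<open>0\<close>.\<close>

definition killed_density :: "real \<Rightarrow> real \<Rightarrow> real \<Rightarrow> real" where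
  "killed_density t x y = normal_density x (sqrt t) y - normal_density (- x) (sqrt t) y"

text \<open>
  Joint density of the excursion at the times \<open>t 0 < \<dots> < t (n - 1)\<close> in \<open>(0,1)\<close>, for \<open>n \<ge> 1\<close>.
\<close>

definition excursion_density :: "nat \<Rightarrow> (nat \<Rightarrow> real) \<Rightarrow> (nat \<Rightarrow> real) \<Rightarrow> real" where
  "excursion_density n t x =
     (if \<forall>i<n. 0 < x i
      then 2 * sqrt (2 * pi) * hitting_density (t 0) (x 0) *
           (\<Prod>i<n - 1. killed_density (t (Suc i) - t i) (x i) (x (Suc i))) *
           hitting_density (1 - t (n - 1)) (x (n - 1))
      else 0)"

definition brownian_excursion :: "'a measure \<Rightarrow> (real \<Rightarrow> 'a \<Rightarrow> real) \<Rightarrow> bool" where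
  "brownian_excursion M e \<longleftrightarrow>
     prob_space M \<and>
     (\<forall>t\<in>{0..1}. e t \<in> borel_measurable M) \<and>
     (\<forall>\<omega>\<in>space M. continuous_on {0..1} (\<lambda>t. e t \<omega>) \<and> e 0 \<omega> = 0 \<and> e 1 \<omega> = 0 \<and>
        (\<forall>t\<in>{0..1}. 0 \<le> e t \<omega>)) \<and>
     (\<forall>n t. 1 \<le> n \<longrightarrow> strict_mono_on {..<n} t \<longrightarrow> t ` {..<n} \<subseteq> {0<..<1} \<longrightarrow>
        distributed M (PiM {..<n} (\<lambda>_. lborel)) (\<lambda>\<omega>. \<lambda>i\<in>{..<n}. e (t i) \<omega>)
          (\<lambda>x. ennreal (excursion_density n t x)))"


section \<open>The Brownian separable permuton\<close>

definition local_minima :: "(real \<Rightarrow> real) \<Rightarrow> real set" where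
  "local_minima f =
     {m \<in> {0<..<1}. \<exists>\<epsilon>>0. \<forall>t\<in>{0..1}. \<bar>t - m\<bar> < \<epsilon> \<longrightarrow> f m \<le> f t}"

definition min_position :: "(real \<Rightarrow> real) \<Rightarrow> real \<Rightarrow> real \<Rightarrow> real \<Rightarrow> bool" where
  "min_position f x y m \<longleftrightarrow> m \<in> {x..y} \<and> (\<forall>t\<in>{x..y}. t \<noteq> m \<longrightarrow> f m < f t)"

text \<open>
  Points for which the minimum is attained at several positions are incomparable here. Almost
  surely, this only concerns a null set of pairs.
\<close>

definition br_prec :: "(real \<Rightarrow> real) \<Rightarrow> (real \<Rightarrow> bool) \<Rightarrow> real \<Rightarrow> real \<Rightarrow> bool" where
  "br_prec f s x y \<longleftrightarrow>
     (\<exists>m\<in>local_minima f.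
        (x < y \<and> min_position f x y m \<and> s m) \<or>
        (y < x \<and> min_position f y x m \<and> \<not> s m))"

definition unit_path :: "(real \<Rightarrow> 'a \<Rightarrow> real) \<Rightarrow> 'a \<Rightarrow> real \<Rightarrow> real" where
  "unit_path e \<omega> = (\<lambda>t\<in>{0..1}. e t \<omega>)"

definition path_algebra :: "'a measure \<Rightarrow> (real \<Rightarrow> 'a \<Rightarrow> real) \<Rightarrow> 'a measure" where
  "path_algebra M e = vimage_algebra (space M) (unit_path e) (PiM {0..1} (\<lambda>_. borel))"

text \<open>
  Conditionally on \<open>e\<close>, the signs \<open>S m\<close> indexed by the local minima \<open>m\<close> of \<open>e\<close> are i.i.d.: along
  an enumeration of the local minima that is a measurable function of \<open>e\<close>, they form an i.i.d.
  sequence independent of \<open>e\<close>. Values of \<open>S\<close> away from the local minima are irrelevant.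
\<close>

definition iid_signs_at_local_minima ::
    "'a measure \<Rightarrow> real \<Rightarrow> (real \<Rightarrow> 'a \<Rightarrow> real) \<Rightarrow> (real \<Rightarrow> 'a \<Rightarrow> bool) \<Rightarrow> bool" where
  "iid_signs_at_local_minima M p e S \<longleftrightarrow>
     (\<exists>N :: nat \<Rightarrow> 'a \<Rightarrow> real.
        (\<forall>k. N k \<in> borel_measurable (path_algebra M e)) \<and>
        (AE \<omega> in M. bij_betw (\<lambda>k. N k \<omega>) UNIV (local_minima (\<lambda>t. e t \<omega>))) \<and>
        iid_signs M p (\<lambda>k \<omega>. S (N k \<omega>) \<omega>) \<and>
        independent_vars M
          (PiM {0..1} (\<lambda>_. borel)) (unit_path e)
          (PiM UNIV (\<lambda>_. count_space UNIV)) (\<lambda>\<omega> k. S (N k \<omega>) \<omega>))"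

definition brownian_separable_permuton ::
    "'a measure \<Rightarrow> real \<Rightarrow> ('a \<Rightarrow> (real \<times> real) measure) \<Rightarrow> bool" where
  "brownian_separable_permuton M p X \<longleftrightarrow>
     prob_space M \<and>
     X \<in> M \<rightarrow>\<^sub>M permuton_space \<and>
     (\<exists>e S.
        brownian_excursion M e \<and>
        iid_signs_at_local_minima M p e S \<and>
        (AE \<omega> in M. X \<omega> = order_measure (br_prec (\<lambda>t. e t \<omega>) (\<lambda>m. S m \<omega>))))"

end

theory Submission imports Defs
begin

text \<open>
  In both models two points \<open>x < y\<close> are compared by the sign of a branch point in \<open>[x, y]\<close>, and the signs
  are i.i.d. Bernoulli(\<open>p\<close>) given the branch points. Since the second marginal of the permuton is uniform,
  almost every pair is comparable and its sign can be read off the permuton. Average such readings over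
  boxes in disjoint intervals \<open>[a\<^sub>n / 2, b\<^sub>n]\<close> shrinking to \<open>0\<close>: the signs used at different scales are
  independent, so the fraction of pairs with sign \<open>\<oplus>\<close> converges to \<open>p\<close>, which separates \<open>p\<close> from \<open>q\<close>.

  To separate the models for equal \<open>p\<close>, take triples \<open>x\<^sub>1 < x\<^sub>2 < x\<^sub>3\<close> at very different distances from \<open>0\<close>
  and ask whether the signs of \<open>(x\<^sub>1, x\<^sub>2)\<close> and \<open>(x\<^sub>1, x\<^sub>3)\<close> differ. In the recursive model the first point
  \<open>U\<^sub>j\<close> in \<open>(x\<^sub>1, x\<^sub>3]\<close> rarely falls in \<open>(x\<^sub>1, x\<^sub>2]\<close>, so they differ with probability close to \<open>2p(1 - p)\<close>. The
  excursion has at most one zero in \<open>(0, 1)\<close>, since points separated by two zeros are incomparable. Hence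
  it has no zero near \<open>0\<close>, the minimum over both intervals is attained near \<open>x\<^sub>1\<close>, and the signs agree
  with high probability.
\<close>

text \<open>The box averages at different scales are not independent: only the signs are, and which
  signs are read depends on the whole environment. Concentration is therefore drawn from one-sided
  bounds. If \<open>d\<close> bounds the probability of the pattern at every fixed pair of branch
  points, products of averages at different scales have expectation at most
  \<open>d\<^sup>2\<close>, whatever the environment; if moreover each mean is at least
  \<open>d - \<delta>\<close>, the average over \<open>K\<close> scales has mean square distance at
  most \<open>1 / K + 2 * d * \<delta>\<close> from \<open>d\<close>. A usable pattern must thus
  nearly attain its largest possible probability. This is why the recursive model is tested with
  \<open>(\<noteq>)\<close>, with maximum \<open>2 * p * (1 - p)\<close> at distinct branch points,
  and the Brownian model with the complement \<open>(=)\<close>, with maximum 1. The scales that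
  compare the models are chosen from the law of the excursion; the recursive estimate only needs a
  small ratio between the middle and the far distance, so it holds on the same scales. The tests
  depend on the permitted error and are merged by Borel-Cantelli.\<close>

section \<open>Singularity and measurability on the space of permutons\<close>

text \<open>For \<open>\<epsilon> = (1/2)^k\<close> the errors are summable, so by Borel-Cantelli a
  \<open>Q\<close>-random point lies in only finitely many of the sets and a \<open>P\<close>-random
  point in all but finitely many. Their limsup separates \<open>P\<close> from
  \<open>Q\<close>.\<close>

lemma singularI_approx:
  assumes P: "prob_space P" and Q: "prob_space Q" and sets_eq: "sets P = sets Q"
    and approx: "\<And>\<epsilon>. \<epsilon> > 0 \<Longrightarrow> \<exists>A\<in>sets P. measure P (space P - A) \<le> \<epsilon> \<and> measure Q A \<le> \<epsilon>"
  shows "singular P Q"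
proof -
  interpret P: prob_space P by fact
  interpret Q: prob_space Q by fact
  have "\<exists>A. \<forall>k::nat. A k \<in> sets P \<and> P.prob (space P - A k) \<le> (1/2)^k \<and> Q.prob (A k) \<le> (1/2)^k"
    using approx[of "(1/2)^k" for k :: nat] by (intro choice) (metis zero_less_power half_gt_zero zero_less_one)
  then obtain A where A[measurable]: "\<And>k::nat. A k \<in> sets P"
    and AP: "\<And>k. P.prob (space P - A k) \<le> (1/2)^k" and AQ: "\<And>k. Q.prob (A k) \<le> (1/2)^k"
    by blast
  have AQm[measurable]: "A k \<in> sets Q" for k using A sets_eq by simp
  define B where "B = limsup A"
  have B[measurable]: "B \<in> sets P" unfolding B_def by measurable
  have "summable (\<lambda>k. Q.prob (A k))"
    by (rule summable_comparison_test'[of "\<lambda>k. (1/2::real)^k" 0]) (auto simp: AQ)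
  then have "AE x in Q. eventually (\<lambda>n. x \<in> space Q - A n) sequentially"
    by (intro borel_cantelli_AE1) (auto simp: less_top[symmetric] Q.emeasure_finite P.emeasure_finite)
  then have "AE x in Q. x \<notin> B"
    by eventually_elim (auto simp: B_def limsup_INF_SUP eventually_sequentially)
  then have Q0: "emeasure Q B = 0"
    using B sets_eq by (subst (asm) AE_iff_measurable[where N=B]) (auto dest: sets.sets_into_space)
  have "summable (\<lambda>k. P.prob (space P - A k))"
    by (rule summable_comparison_test'[of "\<lambda>k. (1/2::real)^k" 0]) (auto simp: AP)
  then have "AE x in P. eventually (\<lambda>n. x \<in> space P - (space P - A n)) sequentially"
    by (intro borel_cantelli_AE1) (auto simp: less_top[symmetric] Q.emeasure_finite P.emeasure_finite)
  then have "AE x in P. x \<in> B"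
  proof eventually_elim
    case (elim x)
    then obtain k where "\<And>n. n \<ge> k \<Longrightarrow> x \<in> A n" by (auto simp: eventually_sequentially)
    then have "\<exists>n\<in>{m..}. x \<in> A n" for m by (intro bexI[of _ "max m k"]) auto
    then show ?case unfolding B_def limsup_INF_SUP by blast
  qed
  then have "emeasure P B = 1"
    using B by (simp add: P.emeasure_eq_1_AE)
  with Q0 B sets_eq show ?thesis unfolding singular_def by auto
qed

lemma space_permuton_space: "space permuton_space = Collect permuton"
  and openin_weak_topology_sets: "openin weak_topology W \<Longrightarrow> W \<in> sets permuton_space"
proof -
  have *: "{W. openin weak_topology W} \<subseteq> Pow (Collect permuton)"
    using openin_subset[of weak_topology]
    unfolding weak_topology_def topology_generated_by_topspace by fastforce
  show "space permuton_space = Collect permuton"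
    unfolding permuton_space_def using * by (rule space_measure_of)
  show "openin weak_topology W \<Longrightarrow> W \<in> sets permuton_space"
    unfolding permuton_space_def using * by (simp add: sets_measure_of)
qed

abbreviation square_borel :: "(real \<times> real) measure" where
  "square_borel \<equiv> restrict_space borel unit_square"

lemma closed_unit_square: "closed unit_square"
  by (intro closed_Times closed_atLeastAtMost)

lemma borel_measurable_integral_permuton:
  fixes f :: "real \<times> real \<Rightarrow> real"
  assumes "continuous_on unit_square f"
  shows "(\<lambda>\<mu>. \<integral>z. f z \<partial>\<mu>) \<in> borel_measurable permuton_space"
proof (rule borel_measurableI)
  fix V :: "real set" assume V: "open V"
  have "openin weak_topology {\<mu>. permuton \<mu> \<and> (\<integral>z. f z \<partial>\<mu>) \<in> V}"
    unfolding weak_topology_def using V assms by (intro topology_generated_by_Basis) blast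
  from openin_weak_topology_sets[OF this]
  show "(\<lambda>\<mu>. \<integral>z. f z \<partial>\<mu>) -` V \<inter> space permuton_space \<in> sets permuton_space"
    by (simp add: space_permuton_space vimage_def Int_def conj_commute)
qed

text \<open>Closed subsets of the square form an intersection-stable generator, the form in which
  measurability of a kernel is checked below. Traces of closed sets stay closed because the square
  is closed.\<close>

lemma sets_square_borel: "sets square_borel = sigma_sets unit_square {K. closed K \<and> K \<subseteq> unit_square}"
proof
  show "sets square_borel \<subseteq> sigma_sets unit_square {K. closed K \<and> K \<subseteq> unit_square}"
  proof -
    have "sets square_borel = (\<inter>) unit_square ` sigma_sets UNIV (Collect closed)"
      by (simp add: sets_restrict_space borel_eq_closed)
    also have "\<dots> = sigma_sets unit_square ((\<inter>) unit_square ` Collect closed)"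
      using sigma_sets_Int[of unit_square UNIV "Collect closed"] closed_unit_square
      by (simp add: Int_commute)
    also have "\<dots> \<subseteq> sigma_sets unit_square {K. closed K \<and> K \<subseteq> unit_square}"
      by (intro sigma_sets_mono') (use closed_unit_square in \<open>auto intro: closed_Int\<close>)
    finally show ?thesis .
  qed
  show "sigma_sets unit_square {K. closed K \<and> K \<subseteq> unit_square} \<subseteq> sets square_borel"
  proof -
    have "{K. closed K \<and> K \<subseteq> unit_square} \<subseteq> sets square_borel"
      using closed_unit_square by (auto simp: sets_restrict_space_iff)
    from sets.sigma_sets_subset[OF this] show ?thesis by (simp add: space_restrict_space)
  qed
qed

lemma permutonD:
  assumes "permuton \<mu>"
  shows "prob_space \<mu>" "space \<mu> = unit_square" "sets \<mu> = sets square_borel"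
    "distr \<mu> Leb snd = Leb"
  using assms by (auto simp: permuton_def)

text \<open>The weak topology directly gives measurability only for integrals of continuous
  functions. Indicators of closed sets are limits of such functions, and closed sets generate.
  Afterwards a permuton may be used as a kernel in iterated integrals.\<close>

lemma measurable_permuton_kernel: "(\<lambda>\<mu>. \<mu>) \<in> permuton_space \<rightarrow>\<^sub>M subprob_algebra square_borel"
proof (rule measurable_subprob_algebra_generated[OF sets_square_borel])
  show "Int_stable {K. closed K \<and> K \<subseteq> unit_square}" by (auto simp: Int_stable_def)
  show "{K. closed K \<and> K \<subseteq> unit_square} \<subseteq> Pow unit_square" by auto
  show "subprob_space \<mu>" "sets \<mu> = sets square_borel" if "\<mu> \<in> space permuton_space" for \<mu>
  proof -
    have "permuton \<mu>" using that by (simp add: space_permuton_space)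
    then show "subprob_space \<mu>" "sets \<mu> = sets square_borel"
      by (rule permutonD(1)[THEN prob_space_imp_subprob_space], rule permutonD(3))
  qed
  \<comment> \<open>Nonempty sets only: \<open>infdist\<close> to the empty set is 0, so the
    approximations \<open>f n\<close> would be constantly 1.\<close>
  have meas: "(\<lambda>\<mu>. emeasure \<mu> K) \<in> borel_measurable permuton_space"
    if K: "closed K" "K \<subseteq> unit_square" "K \<noteq> {}" for K
  proof -
    define f :: "nat \<Rightarrow> real \<times> real \<Rightarrow> real" where "f n z = max 0 (1 - real n * infdist z K)" for n z
    have f_cont: "continuous_on S (f n)" for n S
      unfolding f_def by (intro continuous_intros)
    have lim: "(\<lambda>n. f n z) \<longlonglongrightarrow> indicator K z" for z
    proof (cases "z \<in> K")
      case True then show ?thesis by (simp add: f_def)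
    next
      case False
      then have pos: "infdist z K > 0"
        using K infdist_pos_not_in_closed by blast
      obtain n0 where n0: "1 < real n0 * infdist z K" using reals_Archimedean3[OF pos] by blast
      have "f n z = 0" if "n \<ge> n0" for n
        proof -
        have "real n0 * infdist z K \<le> real n * infdist z K"
          using that pos by (intro mult_right_mono) auto
        with n0 have "1 - real n * infdist z K \<le> 0" by linarith
        then show ?thesis by (simp only: f_def max_absorb1)
      qed
      then show ?thesis using False
        by (intro tendsto_eventually) (auto simp: eventually_sequentially)
    qed
    have "(\<lambda>\<mu>. ennreal (measure \<mu> K)) \<in> borel_measurable permuton_space"
    proof (rule measurable_compose[OF _ measurable_ennreal], rule borel_measurable_LIMSEQ_real)
      show "(\<lambda>\<mu>. \<integral>z. f n z \<partial>\<mu>) \<in> borel_measurable permuton_space" for n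
        by (rule borel_measurable_integral_permuton[OF f_cont])
      fix \<mu> assume "\<mu> \<in> space permuton_space"
      then have \<mu>: "permuton \<mu>" by (simp add: space_permuton_space)
      interpret prob_space \<mu> by (rule permutonD[OF \<mu>])
      have Km: "K \<in> sets \<mu>" unfolding permutonD(3)[OF \<mu>] sets_square_borel using K by auto
      have "(\<lambda>n. \<integral>z. f n z \<partial>\<mu>) \<longlonglongrightarrow> (\<integral>z. indicator K z \<partial>\<mu>)"
      proof (rule integral_dominated_convergence[where w="\<lambda>_. 1"])
        show "f n \<in> borel_measurable \<mu>" for n
          using borel_measurable_continuous_onI[OF f_cont, of n]
          by (simp add: measurable_restrict_space1 measurable_cong_sets[OF permutonD(3)[OF \<mu>] refl])
        show "AE z in \<mu>. norm (f n z) \<le> 1" for n by (simp add: f_def infdist_nonneg)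
      qed (use Km lim in auto)
      then show "(\<lambda>n. \<integral>z. f n z \<partial>\<mu>) \<longlonglongrightarrow> measure \<mu> K" using Km by simp
    qed
    then show ?thesis
    proof (rule measurable_cong[THEN iffD2, rotated])
      fix \<mu> assume "\<mu> \<in> space permuton_space"
      then interpret prob_space \<mu> by (simp add: permutonD(1) space_permuton_space)
      show "emeasure \<mu> K = ennreal (measure \<mu> K)" by (rule emeasure_eq_measure)
    qed
  qed
  show "(\<lambda>\<mu>. emeasure \<mu> K) \<in> borel_measurable permuton_space"
    if "K \<in> {K. closed K \<and> K \<subseteq> unit_square}" for K
    using that meas[of K] by (cases "K = {}") auto
  show "(\<lambda>\<mu>. emeasure \<mu> unit_square) \<in> borel_measurable permuton_space"
  proof (rule measurable_cong[THEN iffD2])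
    show "emeasure \<mu> unit_square = 1" if "\<mu> \<in> space permuton_space" for \<mu>
      using that permutonD[of \<mu>] prob_space.emeasure_space_1[of \<mu>] by (simp add: space_permuton_space)
  qed simp
qed

section \<open>Reading an order from its permuton\<close>

lemma (in pair_sigma_finite) AE_pairI:
  assumes "AE x in M1. P x" and "AE y in M2. R y"
  shows "AE z in M1 \<Otimes>\<^sub>M M2. P (fst z) \<and> R (snd z)"
proof -
  from assms obtain A B where A: "A \<in> null_sets M1" "{x\<in>space M1. \<not> P x} \<subseteq> A"
    and B: "B \<in> null_sets M2" "{y\<in>space M2. \<not> R y} \<subseteq> B"
    by (auto simp: eventually_ae_filter)
  have [measurable]: "A \<in> sets M1" "B \<in> sets M2" using A B by auto
  have "AE y in M2. x \<notin> A \<longrightarrow> y \<notin> B" for x using B(1) by (auto intro: AE_not_in)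
  then have "AE z in M1 \<Otimes>\<^sub>M M2. fst z \<notin> A \<and> snd z \<notin> B"
    using AE_not_in[OF A(1)] B(1) by (intro AE_pair_measure) (auto intro!: AE_not_in)
  then show ?thesis using A(2) B(2) by (elim AE_mp) (auto intro!: AE_I2 simp: space_pair_measure)
qed

interpretation Leb: prob_space Leb
  by (rule prob_spaceI) (simp add: Leb_def emeasure_restrict_space space_restrict_space)

interpretation Leb2: pair_prob_space Leb Leb ..

lemma space_Leb [simp]: "space Leb = {0..1}"
  by (simp add: Leb_def space_restrict_space)

lemma sets_Leb [measurable_cong]: "sets Leb = sets (restrict_space borel {0..1})"
  by (simp add: Leb_def sets_restrict_space)

lemma Leb_borel [measurable]: "(\<lambda>x. x) \<in> Leb \<rightarrow>\<^sub>M borel"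
  by (simp add: Leb_def measurable_restrict_space1)

lemma borel_of_Leb [measurable (raw)]: "f \<in> K \<rightarrow>\<^sub>M Leb \<Longrightarrow> f \<in> borel_measurable K"
  using measurable_compose[OF _ Leb_borel] by blast

lemma nn_integral_Leb_id: "(\<integral>\<^sup>+x. ennreal x \<partial>Leb) = ennreal (1/2)"
proof -
  have "(\<integral>\<^sup>+x. ennreal x \<partial>Leb) = (\<integral>\<^sup>+x. ennreal x * indicator {0..1} x \<partial>lborel)"
    unfolding Leb_def by (subst nn_integral_restrict_space) auto
  also have "\<dots> = ennreal (1\<^sup>2/2 - 0\<^sup>2/2)"
    by (rule nn_integral_FTC_Icc[where F="\<lambda>x. x\<^sup>2/2"]) (auto intro!: derivative_eq_intros)
  finally show ?thesis by simp
qed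

definition rank_below :: "(real \<Rightarrow> real \<Rightarrow> bool) \<Rightarrow> real \<Rightarrow> real" where
  "rank_below prec x = measure Leb {y \<in> {0..1}. prec y x}"

text \<open>\<open>acyclic3\<close> stands in for transitivity, which ties of the path can destroy:
  equal minima on the two sides of \<open>y\<close> leave \<open>x\<close> and \<open>z\<close>
  incomparable even if \<open>x\<close> precedes \<open>y\<close> and \<open>y\<close> precedes
  \<open>z\<close>. Where all pairs are comparable, it gives transitivity back.\<close>

locale measurable_order =
  fixes prec :: "real \<Rightarrow> real \<Rightarrow> bool"
  assumes meas_prec: "{z \<in> space (Leb \<Otimes>\<^sub>M Leb). prec (fst z) (snd z)} \<in> sets (Leb \<Otimes>\<^sub>M Leb)"
    and asym: "prec x y \<Longrightarrow> \<not> prec y x"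
    and acyclic3: "prec x y \<Longrightarrow> prec y z \<Longrightarrow> \<not> prec z x"
begin

lemma pred_prec [measurable]: "Measurable.pred (Leb \<Otimes>\<^sub>M Leb) (\<lambda>z. prec (fst z) (snd z))"
  using meas_prec by (simp add: pred_def)

lemma pred_prec_compose [measurable (raw)]:
  assumes [measurable]: "f \<in> K \<rightarrow>\<^sub>M Leb" "g \<in> K \<rightarrow>\<^sub>M Leb"
  shows "Measurable.pred K (\<lambda>w. prec (f w) (g w))"
  using measurable_compose[OF measurable_Pair[OF assms] pred_prec] by simp

lemma measurable_rank_below [measurable]: "rank_below prec \<in> borel_measurable Leb"
proof -
  have "(\<lambda>x. emeasure Leb (Pair x -` {z \<in> space (Leb \<Otimes>\<^sub>M Leb). prec (snd z) (fst z)})) \<in> borel_measurable Leb"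
    by (rule Leb.measurable_emeasure_Pair) measurable
  then have "(\<lambda>x. enn2real (emeasure Leb (Pair x -` {z \<in> space (Leb \<Otimes>\<^sub>M Leb). prec (snd z) (fst z)}))) \<in> borel_measurable Leb"
    by measurable
  then show ?thesis
    by (rule measurable_cong[THEN iffD1, rotated])
      (auto simp: rank_below_def measure_def space_pair_measure intro!: arg_cong[where f="\<lambda>A. enn2real (emeasure Leb A)"])
qed

lemma rank_below_bounds: "0 \<le> rank_below prec x" "rank_below prec x \<le> 1"
  by (auto simp: rank_below_def)

lemma measurable_graph [measurable]: "(\<lambda>x. (x, rank_below prec x)) \<in> Leb \<rightarrow>\<^sub>M square_borel"
proof (rule measurable_restrict_space2)
  have "(\<lambda>x. x) \<in> Leb \<rightarrow>\<^sub>M borel"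
    by (simp add: Leb_def measurable_restrict_space1)
  then show "(\<lambda>x. (x, rank_below prec x)) \<in> Leb \<rightarrow>\<^sub>M borel"
    by (simp add: borel_prod[symmetric])
qed (auto simp: rank_below_bounds)

lemma order_measure_eq: "order_measure prec = distr Leb square_borel (\<lambda>x. (x, rank_below prec x))"
  by (simp add: order_measure_def rank_below_def)

context
  assumes permuton: "permuton (order_measure prec)"
begin

lemma distr_rank_below: "distr Leb Leb (rank_below prec) = Leb"
proof -
  have "snd \<in> square_borel \<rightarrow>\<^sub>M Leb"
    unfolding measurable_cong_sets[OF refl sets_Leb]
    by (intro measurable_restrict_space2 measurable_restrict_space1) (auto simp: borel_prod[symmetric])
  then have "distr (order_measure prec) Leb snd = distr Leb Leb (rank_below prec)"
    unfolding order_measure_eq by (subst distr_distr) (auto simp: comp_def)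
  with permutonD(4)[OF permuton] show ?thesis by simp
qed

text \<open>The second marginal is uniform, so \<open>{(x, y). y \<prec> x}\<close> has area \<open>1/2\<close>; by asymmetry, so does its
  mirror image, which is disjoint from it.\<close>

lemma AE_comparable: "AE z in Leb \<Otimes>\<^sub>M Leb. prec (fst z) (snd z) \<or> prec (snd z) (fst z)"
proof -
  let ?L = "Leb \<Otimes>\<^sub>M Leb"
  have m: "rank_below prec \<in> Leb \<rightarrow>\<^sub>M Leb"
    unfolding measurable_cong_sets[OF refl sets_Leb]
    by (intro measurable_restrict_space2) (auto simp: rank_below_bounds)
  define D where "D = {z \<in> space ?L. prec (fst z) (snd z)}"
  define D' where "D' = {z \<in> space ?L. prec (snd z) (fst z)}"
  have [measurable]: "D \<in> sets ?L" "D' \<in> sets ?L" by (auto simp: D_def D'_def)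
  have "(\<integral>\<^sup>+x. ennreal x \<partial>Leb) = (\<integral>\<^sup>+x. ennreal x \<partial>distr Leb Leb (rank_below prec))"
    by (simp add: distr_rank_below)
  also have "\<dots> = (\<integral>\<^sup>+x. ennreal (rank_below prec x) \<partial>Leb)"
    by (rule nn_integral_distr[OF m]) (simp add: Leb_def measurable_restrict_space1)
  finally have half: "(\<integral>\<^sup>+x. ennreal (rank_below prec x) \<partial>Leb) = ennreal (1/2)"
    by (simp add: nn_integral_Leb_id)
  have "emeasure ?L D' = (\<integral>\<^sup>+x. emeasure Leb (Pair x -` D') \<partial>Leb)"
    by (rule Leb.emeasure_pair_measure_alt) simp
  also have "\<dots> = (\<integral>\<^sup>+x. ennreal (rank_below prec x) \<partial>Leb)"
    by (intro nn_integral_cong) (auto simp: D'_def rank_below_def space_pair_measure Leb.emeasure_eq_measure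
        intro!: arg_cong[where f="measure Leb"])
  finally have D': "emeasure ?L D' = ennreal (1/2)" using half by simp
  have "emeasure ?L D = (\<integral>\<^sup>+y. emeasure Leb ((\<lambda>x. (x, y)) -` D) \<partial>Leb)"
    by (rule Leb2.emeasure_pair_measure_alt2) simp
  also have "\<dots> = (\<integral>\<^sup>+x. ennreal (rank_below prec x) \<partial>Leb)"
    by (intro nn_integral_cong) (auto simp: D_def rank_below_def space_pair_measure Leb.emeasure_eq_measure
        intro!: arg_cong[where f="measure Leb"])
  finally have D: "emeasure ?L D = ennreal (1/2)" using half by simp
  have "emeasure ?L (D \<union> D') = emeasure ?L D + emeasure ?L D'"
    by (rule plus_emeasure[symmetric]) (auto simp: D_def D'_def dest: asym)
  also have "\<dots> = 1" unfolding D D' by (subst ennreal_plus[symmetric]) auto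
  finally have "AE z in ?L. z \<in> D \<union> D'"
    by (intro Leb2.P.AE_prob_1) (simp add: measure_def)
  then show ?thesis by eventually_elim (auto simp: D_def D'_def)
qed

text \<open>By \<open>distr_rank_below\<close> the rank of a uniform point is again uniform, hence
  without atoms; Fubini turns this into the absence of ties.\<close>

lemma AE_rank_below_neq: "AE z in Leb \<Otimes>\<^sub>M Leb. rank_below prec (fst z) \<noteq> rank_below prec (snd z)"
proof -
  have m: "rank_below prec \<in> Leb \<rightarrow>\<^sub>M Leb"
    unfolding measurable_cong_sets[OF refl sets_Leb]
    by (intro measurable_restrict_space2) (auto simp: rank_below_bounds)
  have "AE y in Leb. v \<noteq> rank_below prec y" for v
  proof -
    have "AE y in Leb. v \<noteq> y"
      unfolding Leb_def by (subst AE_restrict_space_iff) (auto intro: AE_mp[OF AE_lborel_singleton])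
    then have "AE y in distr Leb Leb (rank_below prec). v \<noteq> y" by (simp only: distr_rank_below)
    then show ?thesis by (subst (asm) AE_distr_iff[OF m]) (auto simp: Leb_def sets_restrict_space)
  qed
  then show ?thesis
    by (intro Leb2.AE_pair_measure) auto
qed

text \<open>If \<open>y\<close> precedes \<open>x\<close>, almost every \<open>z\<close> below
  \<open>y\<close> is comparable to \<open>x\<close>, and the absence of 3-cycles puts it below
  \<open>x\<close>. So the rank is monotone along the order, strictly once ties are excluded; as
  almost all pairs are comparable, the converse follows.\<close>

lemma AE_prec_iff_rank_below:
  "AE z in Leb \<Otimes>\<^sub>M Leb. prec (fst z) (snd z) \<longleftrightarrow> rank_below prec (fst z) < rank_below prec (snd z)"
proof -
  define good where "good x \<longleftrightarrow> (AE y in Leb. prec x y \<or> prec y x)" for x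
  have "AE x in Leb. AE y in Leb. prec x y \<or> prec y x"
    using Leb2.AE_pair[OF AE_comparable] by simp
  then have good: "AE x in Leb. good x" by (simp add: good_def)
  have good_pair: "AE z in Leb \<Otimes>\<^sub>M Leb. good (fst z) \<and> good (snd z)"
    by (rule Leb2.AE_pairI[OF good good])
  have mono: "rank_below prec y \<le> rank_below prec x" if "good x" "good y" "prec y x" "x \<in> {0..1}" "y \<in> {0..1}" for x y
    unfolding rank_below_def
  proof (rule finite_measure.finite_measure_mono_AE)
    have "AE z in Leb. prec x z \<or> prec z x" "AE z in Leb. prec y z \<or> prec z y"
      using that by (auto simp: good_def)
    then show "AE z in Leb. z \<in> {z \<in> {0..1}. prec z y} \<longrightarrow> z \<in> {z \<in> {0..1}. prec z x}"
      by eventually_elim (use \<open>prec y x\<close> acyclic3 in blast)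
    have "{z \<in> space Leb. prec z x} \<in> sets Leb" by measurable (use \<open>x \<in> {0..1}\<close> in auto)
    then show "{z \<in> {0..1}. prec z x} \<in> sets Leb" by simp
  qed unfold_locales
  show ?thesis
    using AE_comparable AE_rank_below_neq good_pair AE_space
  proof eventually_elim
    case (elim z)
    then have "fst z \<in> {0..1}" "snd z \<in> {0..1}" by (auto simp: space_pair_measure)
    then show ?case using elim mono[of "fst z" "snd z"] mono[of "snd z" "fst z"] asym
      by (meson antisym_conv1 not_le order.order_iff_strict)
  qed
qed

end

end

section \<open>Laws of large numbers and random indices\<close>

text \<open>With \<open>A\<close> the average, the mean square of \<open>A - c\<close> is E A^2 - 2
  c E A + c^2, at most (c^2 + 1/N) - 2 c (c - \<delta>) + c^2 = 1/N + 2 c \<delta>; Markov's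
  inequality concludes. An upper bound on correlations and a lower bound on means are
  enough.\<close>

lemma (in prob_space) average_deviation:
  fixes W :: "nat \<Rightarrow> 'a \<Rightarrow> real"
  assumes W [measurable]: "\<And>n. W n \<in> borel_measurable M"
    and W_bounds: "\<And>n \<omega>. 0 \<le> W n \<omega>" "\<And>n \<omega>. W n \<omega> \<le> 1"
    and c: "0 \<le> c"
    and mean: "\<And>n. c - \<delta> \<le> expectation (W n)"
    and corr: "\<And>m n. m \<noteq> n \<Longrightarrow> expectation (\<lambda>\<omega>. W m \<omega> * W n \<omega>) \<le> c\<^sup>2"
    and N: "0 < N" and r: "0 < r"
  shows "prob {\<omega> \<in> space M. r \<le> \<bar>(\<Sum>n<N. W n \<omega>) / real N - c\<bar>} \<le> (1 / real N + 2 * c * \<delta>) / r\<^sup>2"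
proof -
  have int1 [simp]: "integrable M (W n)" for n
    using W_bounds by (intro integrable_const_bound[where B=1]) auto
  have WW: "0 \<le> W m \<omega> * W n \<omega>" "W m \<omega> * W n \<omega> \<le> 1" for m n \<omega>
    using W_bounds by (auto intro: mult_le_one)
  have int2 [simp]: "integrable M (\<lambda>\<omega>. W m \<omega> * W n \<omega>)" for m n
    using WW by (intro integrable_const_bound[where B=1]) auto
  define A where "A \<omega> = (\<Sum>n<N. W n \<omega>) / real N" for \<omega>
  have [measurable]: "A \<in> borel_measurable M" unfolding A_def by measurable
  have sq: "(A \<omega>)\<^sup>2 = (\<Sum>m<N. \<Sum>n<N. W m \<omega> * W n \<omega>) / (real N)\<^sup>2" for \<omega>
    by (simp add: A_def power_divide power2_eq_square sum_product)
  have intA [simp]: "integrable M A" "integrable M (\<lambda>\<omega>. (A \<omega>)\<^sup>2)"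
    unfolding sq by (simp_all add: A_def[abs_def])
  \<comment> \<open>The diagonal terms, bounded by 1, are the only ones that may exceed
    \<open>c\<^sup>2\<close>; together they cost \<open>1 / N\<close>.\<close>
  have diag: "expectation (\<lambda>\<omega>. W m \<omega> * W n \<omega>) \<le> c\<^sup>2 + of_bool (m = n)" for m n
  proof (cases "m = n")
    case True
    have "expectation (\<lambda>\<omega>. W m \<omega> * W n \<omega>) \<le> expectation (\<lambda>\<omega>. 1)"
      by (intro integral_mono) (auto simp: WW)
    with True show ?thesis by (simp add: prob_space add_increasing)
  qed (use corr in simp)
  have "expectation (\<lambda>\<omega>. (A \<omega>)\<^sup>2) = (\<Sum>m<N. \<Sum>n<N. expectation (\<lambda>\<omega>. W m \<omega> * W n \<omega>)) / (real N)\<^sup>2"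
    by (simp add: sq)
  also have "\<dots> \<le> (\<Sum>m<N. \<Sum>n<N. c\<^sup>2 + of_bool (m = n)) / (real N)\<^sup>2"
    by (intro divide_right_mono sum_mono diag) auto
  also have "(\<Sum>m<N. \<Sum>n<N. c\<^sup>2 + of_bool (m = n)) = (\<Sum>m<N. real N * c\<^sup>2 + 1)"
    by (intro sum.cong refl) (simp add: sum.distrib of_bool_def)
  also have "\<dots> / (real N)\<^sup>2 = ((real N)\<^sup>2 * c\<^sup>2 + real N) / (real N)\<^sup>2"
    by (simp add: sum.distrib power2_eq_square distrib_left mult.assoc)
  also have "\<dots> = c\<^sup>2 + 1 / real N"
    using N by (simp add: field_simps power2_eq_square)
  finally have EA2: "expectation (\<lambda>\<omega>. (A \<omega>)\<^sup>2) \<le> c\<^sup>2 + 1 / real N" .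
  have "(\<Sum>n<N. c - \<delta>) / real N \<le> (\<Sum>n<N. expectation (W n)) / real N"
    by (intro divide_right_mono sum_mono mean) auto
  also have "\<dots> = expectation A" by (simp add: A_def[abs_def])
  finally have EA: "c - \<delta> \<le> expectation A" using N by simp
  have eq: "expectation (\<lambda>\<omega>. (A \<omega> - c)\<^sup>2) = expectation (\<lambda>\<omega>. (A \<omega>)\<^sup>2) - 2 * c * expectation A + c\<^sup>2"
    by (simp add: power2_diff prob_space mult.assoc mult.commute[of _ c] del: power2_eq_square)
  have le: "expectation (\<lambda>\<omega>. (A \<omega> - c)\<^sup>2) \<le> 1 / real N + 2 * c * \<delta>"
    using EA2 mult_left_mono[OF EA, of "2 * c"] c unfolding eq by (simp add: algebra_simps power2_eq_square)
  have "prob {\<omega> \<in> space M. r \<le> \<bar>A \<omega> - c\<bar>} = prob {\<omega> \<in> space M. r\<^sup>2 \<le> (A \<omega> - c)\<^sup>2}"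
    using r by (intro arg_cong[where f=prob] Collect_cong conj_cong refl)
      (metis abs_le_square_iff abs_of_pos power2_abs)
  also have "\<dots> \<le> expectation (\<lambda>\<omega>. (A \<omega> - c)\<^sup>2) / r\<^sup>2"
  proof (rule integral_Markov_inequality_measure[where A="{}"])
    show "integrable M (\<lambda>\<omega>. (A \<omega> - c)\<^sup>2)" by (simp add: power2_diff)
  qed (use r in auto)
  also have "\<dots> \<le> (1 / real N + 2 * c * \<delta>) / r\<^sup>2"
    using le by (intro divide_right_mono) auto
  finally show ?thesis by (simp add: A_def)
qed

lemma (in pair_prob_space) expectation_section:
  assumes S [measurable]: "S \<in> sets (M1 \<Otimes>\<^sub>M M2)"
  shows "M1.expectation (\<lambda>x. M2.prob (Pair x -` S)) = M2.expectation (\<lambda>y. M1.prob ((\<lambda>x. (x, y)) -` S))"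
proof -
  have [measurable]: "(\<lambda>x. M2.prob (Pair x -` S)) \<in> borel_measurable M1"
    "(\<lambda>y. M1.prob ((\<lambda>x. (x, y)) -` S)) \<in> borel_measurable M2"
    unfolding measure_def
    by (intro borel_measurable_enn2real M2.measurable_emeasure_Pair measurable_emeasure_Pair2 S)+
  have "ennreal (M1.expectation (\<lambda>x. M2.prob (Pair x -` S))) = (\<integral>\<^sup>+x. M2.prob (Pair x -` S) \<partial>M1)"
    by (intro nn_integral_eq_integral[symmetric] M1.integrable_const_bound[where B=1]) auto
  also have "\<dots> = emeasure (M1 \<Otimes>\<^sub>M M2) S"
    by (simp add: M2.emeasure_pair_measure_alt[OF S] M2.emeasure_eq_measure)
  also have "\<dots> = (\<integral>\<^sup>+y. M1.prob ((\<lambda>x. (x, y)) -` S) \<partial>M2)"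
    by (simp add: emeasure_pair_measure_alt2[OF S] M1.emeasure_eq_measure)
  also have "\<dots> = ennreal (M2.expectation (\<lambda>y. M1.prob ((\<lambda>x. (x, y)) -` S)))"
    by (intro nn_integral_eq_integral M2.integrable_const_bound[where B=1]) auto
  finally show ?thesis by (subst (asm) ennreal_inj) auto
qed

text \<open>Common frame of both models: \<open>F\<close> describes the environment (the points
  \<open>U j\<close>, or the path), and \<open>T k\<close> is the sign at the branch point with
  number \<open>k\<close>.\<close>

locale environment_signs = prob_space M for M :: "'a measure" +
  fixes p :: real and F :: "'a measure" and T :: "nat \<Rightarrow> 'a \<Rightarrow> bool"
  assumes p: "0 \<le> p" "p \<le> 1"
    and subF: "subalgebra M F"
    and iid: "iid_signs M p T"
    and indep: "indep_set (sets F)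
      (sets (vimage_algebra (space M) (\<lambda>\<omega> k. T k \<omega>) (PiM UNIV (\<lambda>_. count_space UNIV))))"
begin

abbreviation "sign_algebra \<equiv> vimage_algebra (space M) (\<lambda>\<omega> k. T k \<omega>) (PiM UNIV (\<lambda>_. count_space UNIV))"

lemma indep_T: "indep_vars (\<lambda>_. count_space UNIV) T UNIV"
  using iid by (simp add: iid_signs_def)

lemma measurable_T [measurable]: "T k \<in> M \<rightarrow>\<^sub>M count_space UNIV"
  using indep_T by (simp add: indep_vars_def)

lemma measurable_T_sign_algebra: "T k \<in> sign_algebra \<rightarrow>\<^sub>M count_space UNIV"
proof -
  have "(\<lambda>\<omega> k. T k \<omega>) \<in> sign_algebra \<rightarrow>\<^sub>M PiM UNIV (\<lambda>_. count_space UNIV)"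
    by (rule measurable_vimage_algebra1) (auto simp: space_PiM)
  from measurable_compose[OF this measurable_component_singleton[of k]] show ?thesis by simp
qed

lemma measurable_F: "X \<in> F \<rightarrow>\<^sub>M A \<Longrightarrow> X \<in> M \<rightarrow>\<^sub>M A"
  using subF by (rule measurable_from_subalg)

lemma space_F: "space F = space M"
  using subF by (simp add: subalgebra_def)

lemma prob_T: "prob {\<omega> \<in> space M. T k \<omega>} = p"
proof -
  have "measure (distr M (count_space UNIV) (T k)) {True} = p"
    using iid p by (simp add: iid_signs_def measure_pmf_single)
  then show ?thesis
    by (subst (asm) measure_distr) (auto simp: vimage_def Int_def conj_commute)
qed

lemma prob_not_T: "prob {\<omega> \<in> space M. \<not> T k \<omega>} = 1 - p"
  using prob_neg[of "\<lambda>\<omega>. T k \<omega>"] prob_T[of k] by simp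

lemma indep_disjoint:
  assumes AB: "A \<inter> B = {}"
    and f: "Measurable.pred (PiM A (\<lambda>_. count_space UNIV)) f"
    and g: "Measurable.pred (PiM B (\<lambda>_. count_space UNIV)) g"
  shows "prob {\<omega> \<in> space M. f (\<lambda>i\<in>A. T i \<omega>) \<and> g (\<lambda>i\<in>B. T i \<omega>)} =
    prob {\<omega> \<in> space M. f (\<lambda>i\<in>A. T i \<omega>)} * prob {\<omega> \<in> space M. g (\<lambda>i\<in>B. T i \<omega>)}"
  using indep_varD[OF indep_var_restrict[OF indep_T AB subset_UNIV subset_UNIV], of "{t \<in> space (PiM A (\<lambda>_. count_space UNIV)). f t}"
    "{t \<in> space (PiM B (\<lambda>_. count_space UNIV)). g t}"] f g
  by (simp add: pred_def vimage_def Int_def space_PiM conj_ac)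

text \<open>Here the numbers of the branch points are fixed; the random ones are inserted by
  \<open>random_index_upper\<close> and \<open>random_index_lower\<close>.\<close>

definition pattern_prob :: "(bool \<Rightarrow> bool \<Rightarrow> bool) \<Rightarrow> nat \<Rightarrow> nat \<Rightarrow> real" where
  "pattern_prob G i j = prob {\<omega> \<in> space M. G (T i \<omega>) (T j \<omega>)}"

lemma pattern_prob_fst: "pattern_prob (\<lambda>a b. a) i j = p"
  by (simp add: pattern_prob_def prob_T)

lemma pattern_prob_neq_refl: "pattern_prob (\<noteq>) i i = 0"
  by (simp add: pattern_prob_def)

lemma pattern_prob_neq:
  assumes "i \<noteq> j" shows "pattern_prob (\<noteq>) i j = 2 * p * (1 - p)"
proof -
  have "pattern_prob (\<noteq>) i j =
    prob ({\<omega> \<in> space M. T i \<omega> \<and> \<not> T j \<omega>} \<union> {\<omega> \<in> space M. \<not> T i \<omega> \<and> T j \<omega>})"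
    unfolding pattern_prob_def by (intro arg_cong[where f=prob]) auto
  also have "\<dots> = prob {\<omega> \<in> space M. T i \<omega> \<and> \<not> T j \<omega>} + prob {\<omega> \<in> space M. \<not> T i \<omega> \<and> T j \<omega>}"
    by (rule finite_measure_Union) auto
  also have "prob {\<omega> \<in> space M. T i \<omega> \<and> \<not> T j \<omega>} = p * (1 - p)"
    using indep_disjoint[of "{i}" "{j}" "\<lambda>t. t i" "\<lambda>t. \<not> t j"] assms by (simp add: prob_T prob_not_T)
  also have "prob {\<omega> \<in> space M. \<not> T i \<omega> \<and> T j \<omega>} = (1 - p) * p"
    using indep_disjoint[of "{i}" "{j}" "\<lambda>t. \<not> t i" "\<lambda>t. t j"] assms by (simp add: prob_T prob_not_T)
  finally show ?thesis by simp
qed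

lemma pattern_prob_indep:
  assumes "{i, j} \<inter> {i', j'} = {}"
  shows "prob {\<omega> \<in> space M. G (T i \<omega>) (T j \<omega>) \<and> G (T i' \<omega>) (T j' \<omega>)} =
    pattern_prob G i j * pattern_prob G i' j'"
  using indep_disjoint[OF assms, of "\<lambda>t. G (t i) (t j)" "\<lambda>t. G (t i') (t j')"]
  by (simp add: pattern_prob_def)

text \<open>Takes the place of conditioning on the environment. Split over the countably many values
  \<open>i\<close> of \<open>K\<close>: the event \<open>K = i\<close> lies in \<open>F\<close> and
  is independent of \<open>H i\<close>, so a bound on \<open>H i\<close> for fixed \<open>i\<close>
  carries over to the random index.\<close>

lemma
  fixes K :: "'a \<Rightarrow> 'i :: countable" and H :: "'i \<Rightarrow> 'a \<Rightarrow> bool"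
  assumes K: "K \<in> F \<rightarrow>\<^sub>M count_space UNIV"
    and H: "\<And>i. Measurable.pred sign_algebra (H i)"
  shows random_index_upper: "(\<And>i. i \<in> I \<Longrightarrow> prob {\<omega> \<in> space M. H i \<omega>} \<le> c) \<Longrightarrow> 0 \<le> c \<Longrightarrow>
      prob {\<omega> \<in> space M. K \<omega> \<in> I \<and> H (K \<omega>) \<omega>} \<le> c * prob {\<omega> \<in> space M. K \<omega> \<in> I}"
    and random_index_lower: "(\<And>i. i \<in> I \<Longrightarrow> c \<le> prob {\<omega> \<in> space M. H i \<omega>}) \<Longrightarrow> 0 \<le> c \<Longrightarrow>
      c * prob {\<omega> \<in> space M. K \<omega> \<in> I} \<le> prob {\<omega> \<in> space M. K \<omega> \<in> I \<and> H (K \<omega>) \<omega>}"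
proof -
  have H_ev: "{\<omega> \<in> space M. H i \<omega>} \<in> sets sign_algebra" for i
    using H[of i] by (simp add: pred_def)
  have K_ev: "{\<omega> \<in> space M. K \<omega> = i} \<in> sets F" for i
    using measurable_sets[OF K, of "{i}"] by (simp add: vimage_def Int_def conj_commute space_F)
  note ev = subsetD[OF indep_setD_ev1[OF indep] K_ev] subsetD[OF indep_setD_ev2[OF indep] H_ev]
  have prod: "{\<omega> \<in> space M. K \<omega> = i \<and> H i \<omega>} \<in> events"
    "prob {\<omega> \<in> space M. K \<omega> = i \<and> H i \<omega>} = prob {\<omega> \<in> space M. K \<omega> = i} * prob {\<omega> \<in> space M. H i \<omega>}" for i
  proof -
    have eq: "{\<omega> \<in> space M. K \<omega> = i \<and> H i \<omega>} = {\<omega> \<in> space M. K \<omega> = i} \<inter> {\<omega> \<in> space M. H i \<omega>}" by auto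
    show "{\<omega> \<in> space M. K \<omega> = i \<and> H i \<omega>} \<in> events"
      "prob {\<omega> \<in> space M. K \<omega> = i \<and> H i \<omega>} = prob {\<omega> \<in> space M. K \<omega> = i} * prob {\<omega> \<in> space M. H i \<omega>}"
      unfolding eq using ev indep_setD[OF indep K_ev H_ev] by auto
  qed
  have "emeasure M (\<Union>i\<in>I. {\<omega> \<in> space M. K \<omega> = i \<and> H i \<omega>}) =
      (\<integral>\<^sup>+i. emeasure M {\<omega> \<in> space M. K \<omega> = i \<and> H i \<omega>} \<partial>count_space I)"
    using prod(1) by (intro emeasure_UN_countable) (auto simp: disjoint_family_on_def)
  also have "(\<Union>i\<in>I. {\<omega> \<in> space M. K \<omega> = i \<and> H i \<omega>}) = {\<omega> \<in> space M. K \<omega> \<in> I \<and> H (K \<omega>) \<omega>}"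
    by auto
  finally have both: "ennreal (prob {\<omega> \<in> space M. K \<omega> \<in> I \<and> H (K \<omega>) \<omega>}) =
      (\<integral>\<^sup>+i. ennreal (prob {\<omega> \<in> space M. K \<omega> = i} * prob {\<omega> \<in> space M. H i \<omega>}) \<partial>count_space I)"
    by (simp add: emeasure_eq_measure prod(2))
  have "emeasure M (\<Union>i\<in>I. {\<omega> \<in> space M. K \<omega> = i}) =
      (\<integral>\<^sup>+i. emeasure M {\<omega> \<in> space M. K \<omega> = i} \<partial>count_space I)"
    using ev(1) by (intro emeasure_UN_countable) (auto simp: disjoint_family_on_def)
  also have "(\<Union>i\<in>I. {\<omega> \<in> space M. K \<omega> = i}) = {\<omega> \<in> space M. K \<omega> \<in> I}" by auto
  finally have one: "ennreal (prob {\<omega> \<in> space M. K \<omega> \<in> I}) =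
      (\<integral>\<^sup>+i. ennreal (prob {\<omega> \<in> space M. K \<omega> = i}) \<partial>count_space I)"
    by (simp add: emeasure_eq_measure)
  have scaled: "ennreal (c * prob {\<omega> \<in> space M. K \<omega> \<in> I}) =
      (\<integral>\<^sup>+i. ennreal (prob {\<omega> \<in> space M. K \<omega> = i} * c) \<partial>count_space I)" if "0 \<le> c"
    using that by (simp add: ennreal_mult one nn_integral_cmult[symmetric] mult.commute)
  show "prob {\<omega> \<in> space M. K \<omega> \<in> I \<and> H (K \<omega>) \<omega>} \<le> c * prob {\<omega> \<in> space M. K \<omega> \<in> I}"
    if le: "\<And>i. i \<in> I \<Longrightarrow> prob {\<omega> \<in> space M. H i \<omega>} \<le> c" and c: "0 \<le> c"
  proof -
    have "ennreal (prob {\<omega> \<in> space M. K \<omega> \<in> I \<and> H (K \<omega>) \<omega>}) \<le> ennreal (c * prob {\<omega> \<in> space M. K \<omega> \<in> I})"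
      unfolding both scaled[OF c] by (intro nn_integral_mono ennreal_leI mult_left_mono) (auto intro: le)
    then show ?thesis by (subst (asm) ennreal_le_iff) (auto simp: c)
  qed
  show "c * prob {\<omega> \<in> space M. K \<omega> \<in> I} \<le> prob {\<omega> \<in> space M. K \<omega> \<in> I \<and> H (K \<omega>) \<omega>}"
    if le: "\<And>i. i \<in> I \<Longrightarrow> c \<le> prob {\<omega> \<in> space M. H i \<omega>}" and c: "0 \<le> c"
  proof -
    have "ennreal (c * prob {\<omega> \<in> space M. K \<omega> \<in> I}) \<le> ennreal (prob {\<omega> \<in> space M. K \<omega> \<in> I \<and> H (K \<omega>) \<omega>})"
      unfolding both scaled[OF c] by (intro nn_integral_mono ennreal_leI mult_left_mono) (auto intro: le)
    then show ?thesis by (subst (asm) ennreal_le_iff) auto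
  qed
qed

end

section \<open>Pattern statistics\<close>

abbreviation Leb3 :: "(real \<times> real \<times> real) measure" where
  "Leb3 \<equiv> Leb \<Otimes>\<^sub>M (Leb \<Otimes>\<^sub>M Leb)"

interpretation Leb3: pair_prob_space Leb "Leb \<Otimes>\<^sub>M Leb" ..

text \<open>Both pairs share their first coordinate, so the argument passes to sections at that
  coordinate, over which the other two points are independent. The exceptional set is first enlarged
  to a measurable null set.\<close>

lemma AE_Leb3I:
  assumes "AE w in Leb \<Otimes>\<^sub>M Leb. P w"
  shows "AE z in Leb3. P (fst z, fst (snd z)) \<and> P (fst z, snd (snd z))"
proof -
  from assms obtain A where A: "A \<in> null_sets (Leb \<Otimes>\<^sub>M Leb)" "{w\<in>space (Leb \<Otimes>\<^sub>M Leb). \<not> P w} \<subseteq> A"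
    by (auto simp: eventually_ae_filter)
  have [measurable]: "A \<in> sets (Leb \<Otimes>\<^sub>M Leb)" using A by auto
  have "AE x in Leb. AE y in Leb. (x, y) \<notin> A"
    by (rule Leb2.AE_pair[OF AE_not_in[OF A(1)]])
  then have "AE x in Leb. AE w in Leb \<Otimes>\<^sub>M Leb. (x, fst w) \<notin> A \<and> (x, snd w) \<notin> A"
    by eventually_elim (rule Leb2.AE_pairI)
  then have "AE z in Leb3. (fst z, fst (snd z)) \<notin> A \<and> (fst z, snd (snd z)) \<notin> A"
    by (intro Leb3.AE_pair_measure) auto
  moreover have "P w" if "w \<in> space (Leb \<Otimes>\<^sub>M Leb)" "w \<notin> A" for w using that A(2) by blast
  ultimately show ?thesis by (elim AE_mp) (auto intro!: AE_I2 simp: space_pair_measure)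
qed

text \<open>\<open>G\<close> is arbitrary, so measurability is read off its truth table.\<close>

lemma pred_binary:
  fixes G :: "bool \<Rightarrow> bool \<Rightarrow> bool"
  assumes [measurable]: "Measurable.pred K P" "Measurable.pred K R"
  shows "Measurable.pred K (\<lambda>x. G (P x) (R x))"
proof -
  have "(\<lambda>x. G (P x) (R x)) = (\<lambda>x. (P x \<and> R x \<and> G True True) \<or> (P x \<and> \<not> R x \<and> G True False) \<or>
      (\<not> P x \<and> R x \<and> G False True) \<or> (\<not> P x \<and> \<not> R x \<and> G False False))"
    by (rule ext) (metis (full_types))
  then show ?thesis by simp
qed

text \<open>For \<open>u, v, w\<close> above \<open>x\<^sub>1 < x\<^sub>2 < x\<^sub>3\<close>, \<open>G\<close> is applied to the signs of the pairs \<open>(x\<^sub>1, x\<^sub>2)\<close> and \<open>(x\<^sub>1, x\<^sub>3)\<close>.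
  Only \<open>G a b = a\<close>, which detects the parameter, and inequality (with its negation), which detects
  the shape of the tree of branch points, are needed.\<close>

definition in_pattern :: "(bool \<Rightarrow> bool \<Rightarrow> bool) \<Rightarrow> real set \<Rightarrow> real set \<Rightarrow> real set \<Rightarrow>
    real \<times> real \<Rightarrow> real \<times> real \<Rightarrow> real \<times> real \<Rightarrow> bool" where
  "in_pattern G A B C u v w \<longleftrightarrow> fst u \<in> A \<and> fst v \<in> B \<and> fst w \<in> C \<and>
     G (snd u < snd v) (snd u < snd w)"

text \<open>For a permuton \<open>\<mu>\<close>, draw three independent points from it. As the first
  marginal is \<open>Leb\<close>, the quotient is the conditional probability of the pattern given
  that the first coordinates fall into \<open>A\<close>, \<open>B\<close> and \<open>C\<close>. It
  is a function of \<open>\<mu>\<close> alone, as a test for singularity must be.\<close>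

definition pattern_stat :: "(bool \<Rightarrow> bool \<Rightarrow> bool) \<Rightarrow> real set \<Rightarrow> real set \<Rightarrow> real set \<Rightarrow>
    (real \<times> real) measure \<Rightarrow> real" where
  "pattern_stat G A B C \<mu> =
     enn2real (\<integral>\<^sup>+u. \<integral>\<^sup>+v. \<integral>\<^sup>+w. of_bool (in_pattern G A B C u v w) \<partial>\<mu> \<partial>\<mu> \<partial>\<mu>) /
     measure Leb3 (A \<times> B \<times> C)"

lemma measurable_square_proj [measurable]:
  "fst \<in> square_borel \<rightarrow>\<^sub>M borel" "snd \<in> square_borel \<rightarrow>\<^sub>M borel"
  by (rule measurable_restrict_space1, rule borel_measurable_continuous_onI,
      rule continuous_on_fst[OF continuous_on_id] continuous_on_snd[OF continuous_on_id])+

lemma pred_in_pattern [measurable (raw)]: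
  assumes [measurable]: "A \<in> sets borel" "B \<in> sets borel" "C \<in> sets borel"
    "f \<in> K \<rightarrow>\<^sub>M square_borel" "g \<in> K \<rightarrow>\<^sub>M square_borel" "h \<in> K \<rightarrow>\<^sub>M square_borel"
  shows "Measurable.pred K (\<lambda>x. in_pattern G A B C (f x) (g x) (h x))"
proof -
  have [measurable]: "Measurable.pred K (\<lambda>x. G (snd (f x) < snd (g x)) (snd (f x) < snd (h x)))"
    by (rule pred_binary[where G=G]) measurable
  show ?thesis unfolding in_pattern_def by measurable
qed

lemma of_bool_measurable_ennreal [measurable (raw)]:
  assumes [measurable]: "Measurable.pred K P"
  shows "(\<lambda>x. of_bool (P x) :: ennreal) \<in> borel_measurable K"
  unfolding of_bool_def by measurable

lemma measurable_pattern_stat [measurable]: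
  assumes [measurable]: "A \<in> sets borel" "B \<in> sets borel" "C \<in> sets borel"
  shows "pattern_stat G A B C \<in> borel_measurable permuton_space"
proof -
  note kernel = measurable_permuton_kernel
  have 1: "(\<lambda>(x, v). \<integral>\<^sup>+w. of_bool (in_pattern G A B C (snd x) v w) \<partial>fst x) \<in>
      borel_measurable ((permuton_space \<Otimes>\<^sub>M square_borel) \<Otimes>\<^sub>M square_borel)"
    unfolding split_beta
  proof (rule nn_integral_measurable_subprob_algebra2[where N=square_borel])
    show "(\<lambda>(x, w). of_bool (in_pattern G A B C (snd (fst x)) (snd x) w) :: ennreal) \<in>
        borel_measurable (((permuton_space \<Otimes>\<^sub>M square_borel) \<Otimes>\<^sub>M square_borel) \<Otimes>\<^sub>M square_borel)"
      unfolding split_beta by measurable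
    show "(\<lambda>x. fst (fst x)) \<in> (permuton_space \<Otimes>\<^sub>M square_borel) \<Otimes>\<^sub>M square_borel \<rightarrow>\<^sub>M subprob_algebra square_borel"
      by (rule measurable_compose[OF measurable_compose[OF measurable_fst measurable_fst] kernel])
  qed
  have 2: "(\<lambda>(\<mu>, u). \<integral>\<^sup>+v. \<integral>\<^sup>+w. of_bool (in_pattern G A B C u v w) \<partial>\<mu> \<partial>\<mu>) \<in>
      borel_measurable (permuton_space \<Otimes>\<^sub>M square_borel)"
    unfolding split_beta
    by (rule nn_integral_measurable_subprob_algebra2[OF 1 measurable_compose[OF measurable_fst kernel]])
  have "(\<lambda>\<mu>. \<integral>\<^sup>+u. \<integral>\<^sup>+v. \<integral>\<^sup>+w. of_bool (in_pattern G A B C u v w) \<partial>\<mu> \<partial>\<mu> \<partial>\<mu>) \<in>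
      borel_measurable permuton_space"
    by (rule nn_integral_measurable_subprob_algebra2[OF 2 kernel])
  then show ?thesis unfolding pattern_stat_def[abs_def] by measurable
qed

context measurable_order
begin

lemma sets_order_measure [measurable_cong]: "sets (order_measure prec) = sets square_borel"
  by (simp add: order_measure_eq)

lemma prob_space_order_measure: "prob_space (order_measure prec)"
  unfolding order_measure_eq by (rule Leb.prob_space_distr) measurable

lemma nn_integral_order_measure3:
  assumes h: "h \<in> borel_measurable (square_borel \<Otimes>\<^sub>M (square_borel \<Otimes>\<^sub>M square_borel))"
  shows "(\<integral>\<^sup>+u. \<integral>\<^sup>+v. \<integral>\<^sup>+w. h (u, v, w) \<partial>order_measure prec \<partial>order_measure prec \<partial>order_measure prec) =
    (\<integral>\<^sup>+z. h ((fst z, rank_below prec (fst z)), (fst (snd z), rank_below prec (fst (snd z))),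
       (snd (snd z), rank_below prec (snd (snd z)))) \<partial>Leb3)"
proof -
  let ?O = "order_measure prec" and ?g = "\<lambda>x. (x, rank_below prec x)"
  interpret O: prob_space ?O by (rule prob_space_order_measure)
  interpret O2: pair_prob_space ?O ?O ..
  interpret O3: pair_prob_space ?O "?O \<Otimes>\<^sub>M ?O" ..
  have sets3: "sets (?O \<Otimes>\<^sub>M (?O \<Otimes>\<^sub>M ?O)) = sets (square_borel \<Otimes>\<^sub>M (square_borel \<Otimes>\<^sub>M square_borel))"
    by (intro sets_pair_measure_cong sets_order_measure)
  have h': "h \<in> borel_measurable (?O \<Otimes>\<^sub>M (?O \<Otimes>\<^sub>M ?O))"
    using h by (simp add: measurable_cong_sets[OF sets3 refl])
  have O2_eq: "?O \<Otimes>\<^sub>M ?O = distr (Leb \<Otimes>\<^sub>M Leb) (square_borel \<Otimes>\<^sub>M square_borel) (\<lambda>(x, y). (?g x, ?g y))"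
    unfolding order_measure_eq
    by (rule pair_measure_distr[OF measurable_graph measurable_graph])
      (fold order_measure_eq, rule O.sigma_finite_measure_axioms)
  have g2: "(\<lambda>(x, y). (?g x, ?g y)) \<in> Leb \<Otimes>\<^sub>M Leb \<rightarrow>\<^sub>M square_borel \<Otimes>\<^sub>M square_borel"
    unfolding split_beta
    by (intro measurable_Pair measurable_compose[OF measurable_fst measurable_graph]
        measurable_compose[OF measurable_snd measurable_graph])
  have O3_eq: "?O \<Otimes>\<^sub>M (?O \<Otimes>\<^sub>M ?O) = distr Leb3 (square_borel \<Otimes>\<^sub>M (square_borel \<Otimes>\<^sub>M square_borel))
      (\<lambda>(x, yz). (?g x, (\<lambda>(y, z). (?g y, ?g z)) yz))"
    unfolding O2_eq unfolding order_measure_eq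
    by (rule pair_measure_distr[OF measurable_graph g2])
      (fold O2_eq, rule O2.P.sigma_finite_measure_axioms)
  have g3: "(\<lambda>(x, yz). (?g x, (\<lambda>(y, z). (?g y, ?g z)) yz)) \<in>
      Leb3 \<rightarrow>\<^sub>M square_borel \<Otimes>\<^sub>M (square_borel \<Otimes>\<^sub>M square_borel)"
    unfolding split_beta[of _ "_ :: real \<times> real \<times> real"]
    by (intro measurable_Pair measurable_compose[OF measurable_fst measurable_graph]
        measurable_compose[OF measurable_snd g2])
  have "(\<integral>\<^sup>+u. \<integral>\<^sup>+v. \<integral>\<^sup>+w. h (u, v, w) \<partial>?O \<partial>?O \<partial>?O) = (\<integral>\<^sup>+u. \<integral>\<^sup>+vw. h (u, vw) \<partial>(?O \<Otimes>\<^sub>M ?O) \<partial>?O)"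
  proof (rule nn_integral_cong)
    fix u assume "u \<in> space ?O"
    from O.nn_integral_fst[OF measurable_compose[OF measurable_Pair1'[OF this] h']]
    show "(\<integral>\<^sup>+v. \<integral>\<^sup>+w. h (u, v, w) \<partial>?O \<partial>?O) = (\<integral>\<^sup>+vw. h (u, vw) \<partial>(?O \<Otimes>\<^sub>M ?O))" .
  qed
  also have "\<dots> = (\<integral>\<^sup>+z. h z \<partial>(?O \<Otimes>\<^sub>M (?O \<Otimes>\<^sub>M ?O)))"
    by (rule O2.P.nn_integral_fst[OF h'])
  also have "\<dots> = (\<integral>\<^sup>+z. h ((\<lambda>(x, yz). (?g x, (\<lambda>(y, z). (?g y, ?g z)) yz)) z) \<partial>Leb3)"
    unfolding O3_eq by (rule nn_integral_distr[OF g3]) (use h in simp)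
  finally show ?thesis by (simp add: split_beta)
qed

lemma pattern_stat_order_measure:
  assumes [measurable]: "A \<in> sets borel" "B \<in> sets borel" "C \<in> sets borel"
  shows "pattern_stat G A B C (order_measure prec) =
    measure Leb3 {z \<in> space Leb3. z \<in> A \<times> B \<times> C \<and>
      G (rank_below prec (fst z) < rank_below prec (fst (snd z)))
        (rank_below prec (fst z) < rank_below prec (snd (snd z)))} / measure Leb3 (A \<times> B \<times> C)"
proof -
  let ?S = "{z \<in> space Leb3. z \<in> A \<times> B \<times> C \<and>
      G (rank_below prec (fst z) < rank_below prec (fst (snd z)))
        (rank_below prec (fst z) < rank_below prec (snd (snd z)))}"
  have S: "?S \<in> sets Leb3"
  proof -
    have "?S = {z \<in> space Leb3. fst z \<in> A \<and> fst (snd z) \<in> B \<and> snd (snd z) \<in> C \<and>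
      G (rank_below prec (fst z) < rank_below prec (fst (snd z)))
        (rank_below prec (fst z) < rank_below prec (snd (snd z)))}" by auto
    also have "\<dots> \<in> sets Leb3"
    proof -
      have [measurable]: "Measurable.pred Leb3 (\<lambda>z. G (rank_below prec (fst z) < rank_below prec (fst (snd z)))
          (rank_below prec (fst z) < rank_below prec (snd (snd z))))"
        by (rule pred_binary[where G=G]) measurable
      show ?thesis by measurable
    qed
    finally show ?thesis .
  qed
  have "(\<integral>\<^sup>+u. \<integral>\<^sup>+v. \<integral>\<^sup>+w. of_bool (in_pattern G A B C u v w) \<partial>order_measure prec \<partial>order_measure prec \<partial>order_measure prec) =
    (\<integral>\<^sup>+z. of_bool (in_pattern G A B C (fst z, rank_below prec (fst z)) (fst (snd z), rank_below prec (fst (snd z)))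
       (snd (snd z), rank_below prec (snd (snd z)))) \<partial>Leb3)"
    using nn_integral_order_measure3[of "\<lambda>z. of_bool (in_pattern G A B C (fst z) (fst (snd z)) (snd (snd z)))"]
    by simp
  also have "\<dots> = (\<integral>\<^sup>+z. indicator ?S z \<partial>Leb3)"
    by (intro nn_integral_cong) (auto simp: in_pattern_def indicator_def mem_Times_iff)
  also have "\<dots> = emeasure Leb3 ?S" using S by simp
  finally show ?thesis by (simp add: pattern_stat_def measure_def)
qed

end

section \<open>Orders with independent signs at branch points\<close>

text \<open>\<open>Q k \<omega> x y\<close> says that \<open>k\<close> is a candidate for the number
  of the branch point of \<open>x < y\<close>, and \<open>N k \<omega>\<close> is its position;
  among several candidates the least counts. \<open>Q\<close> is measurable in the environment
  alone, so the random index can be treated by the lemmas above. The sign rule is demanded for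
  comparable pairs only, which will be almost all pairs.\<close>

locale random_signed_order = environment_signs M p F T
  for M :: "'a measure" and p F T +
  fixes X :: "'a \<Rightarrow> (real \<times> real) measure" and prec :: "'a \<Rightarrow> real \<Rightarrow> real \<Rightarrow> bool"
    and Q :: "nat \<Rightarrow> 'a \<Rightarrow> real \<Rightarrow> real \<Rightarrow> bool" and N :: "nat \<Rightarrow> 'a \<Rightarrow> real"
  assumes X: "X \<in> M \<rightarrow>\<^sub>M permuton_space"
    and X_eq: "AE \<omega> in M. X \<omega> = order_measure (prec \<omega>) \<and> measurable_order (prec \<omega>)"
    and sign: "AE \<omega> in M. \<forall>x\<in>{0..1}. \<forall>y\<in>{0..1}. x < y \<longrightarrow> prec \<omega> x y \<or> prec \<omega> y x \<longrightarrow>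
      (\<exists>k. Q k \<omega> x y) \<and> (prec \<omega> x y \<longleftrightarrow> T (LEAST k. Q k \<omega> x y) \<omega>)"
    and Q_pos: "\<And>k \<omega> x y. \<omega> \<in> space M \<Longrightarrow> Q k \<omega> x y \<Longrightarrow> N k \<omega> \<in> {x..y}"
    and Q_meas: "\<And>k. Measurable.pred (F \<Otimes>\<^sub>M (borel \<Otimes>\<^sub>M borel)) (\<lambda>v. Q k (fst v) (fst (snd v)) (snd (snd v)))"
begin

definition branch :: "'a \<Rightarrow> real \<Rightarrow> real \<Rightarrow> nat" where
  "branch \<omega> x y = (LEAST k. Q k \<omega> x y)"

definition pattern :: "(bool \<Rightarrow> bool \<Rightarrow> bool) \<Rightarrow> 'a \<Rightarrow> real \<times> real \<times> real \<Rightarrow> bool" where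
  "pattern G \<omega> z \<longleftrightarrow> G (T (branch \<omega> (fst z) (fst (snd z))) \<omega>) (T (branch \<omega> (fst z) (snd (snd z))) \<omega>)"

lemma pred_Q_F:
  assumes "g \<in> K \<rightarrow>\<^sub>M F" "f \<in> borel_measurable K" "h \<in> borel_measurable K"
  shows "Measurable.pred K (\<lambda>v. Q k (g v) (f v) (h v))"
  using measurable_compose[OF measurable_Pair[OF assms(1) measurable_Pair[OF assms(2,3)]] Q_meas[of k]] by simp

lemma pred_Q [measurable (raw)]:
  assumes "g \<in> K \<rightarrow>\<^sub>M M" "f \<in> borel_measurable K" "h \<in> borel_measurable K"
  shows "Measurable.pred K (\<lambda>v. Q k (g v) (f v) (h v))"
  by (rule pred_Q_F[OF _ assms(2,3)])
    (use assms(1) subF in \<open>auto simp: subalgebra_def intro: measurable_mono1 measurable_sets simp: measurable_def\<close>)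

lemma branch_measurable_F: "(\<lambda>\<omega>. branch \<omega> x y) \<in> F \<rightarrow>\<^sub>M count_space UNIV"
  unfolding branch_def by (intro measurable_Least pred_Q_F) auto

lemma branch_measurable [measurable (raw)]:
  assumes [measurable]: "g \<in> K \<rightarrow>\<^sub>M M" "f \<in> borel_measurable K" "h \<in> borel_measurable K"
  shows "(\<lambda>v. branch (g v) (f v) (h v)) \<in> K \<rightarrow>\<^sub>M count_space UNIV"
  unfolding branch_def by measurable

lemma sign_measurable [measurable (raw)]:
  assumes [measurable]: "g \<in> K \<rightarrow>\<^sub>M M" "f \<in> borel_measurable K" "h \<in> borel_measurable K"
  shows "Measurable.pred K (\<lambda>v. T (branch (g v) (f v) (h v)) (g v))"
proof -
  have "(\<lambda>v. T k (g v)) \<in> K \<rightarrow>\<^sub>M count_space UNIV" for k by measurable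
  from measurable_compose_countable[OF this, of "\<lambda>v. branch (g v) (f v) (h v)"]
  show ?thesis by measurable
qed

lemma pattern_measurable [measurable (raw)]:
  assumes [measurable]: "g \<in> K \<rightarrow>\<^sub>M M" "f \<in> K \<rightarrow>\<^sub>M Leb3"
  shows "Measurable.pred K (\<lambda>v. pattern G (g v) (f v))"
  unfolding pattern_def by (rule pred_binary[where G=G]) measurable

text \<open>As a value of \<open>X\<close> the order measure is a permuton, so almost all pairs are
  comparable and ordered like their ranks, which the permuton shows. \<open>sign\<close> translates
  this order into the sign at the branch point.\<close>

lemma AE_reading:
  "AE \<omega> in M. AE w in Leb \<Otimes>\<^sub>M Leb. fst w < snd w \<longrightarrow>
     (\<exists>k. Q k \<omega> (fst w) (snd w)) \<and>
     (rank_below (prec \<omega>) (fst w) < rank_below (prec \<omega>) (snd w) \<longleftrightarrow> T (branch \<omega> (fst w) (snd w)) \<omega>)"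
  using X_eq sign AE_space
proof eventually_elim
  case (elim \<omega>)
  then interpret measurable_order "prec \<omega>" by simp
  have "permuton (order_measure (prec \<omega>))"
    using measurable_space[OF X, of \<omega>] elim by (simp add: space_permuton_space)
  note sgn = elim(2)
  from AE_comparable[OF \<open>permuton _\<close>] AE_prec_iff_rank_below[OF \<open>permuton _\<close>] AE_space
  show ?case
  proof eventually_elim
    case (elim w)
    then have "fst w \<in> {0..1}" "snd w \<in> {0..1}" by (auto simp: space_pair_measure)
    with sgn elim(1,2) show ?case unfolding branch_def by blast
  qed
qed

text \<open>Fubini exchanges the two quantifiers, since the random index lemmas work with fixed
  points in a random environment. Once some candidate exists, \<open>LEAST\<close> returns
  one.\<close>

lemma AE_branch: "AE w in Leb \<Otimes>\<^sub>M Leb. fst w < snd w \<longrightarrow>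
    (AE \<omega> in M. Q (branch \<omega> (fst w) (snd w)) \<omega> (fst w) (snd w))"
proof -
  interpret ME: pair_prob_space M "Leb \<Otimes>\<^sub>M Leb" ..
  have "AE \<omega> in M. AE w in Leb \<Otimes>\<^sub>M Leb. fst w < snd w \<longrightarrow> (\<exists>k. Q k \<omega> (fst w) (snd w))"
    using AE_reading by eventually_elim (auto elim: AE_mp)
  then have "AE w in Leb \<Otimes>\<^sub>M Leb. AE \<omega> in M. fst w < snd w \<longrightarrow> (\<exists>k. Q k \<omega> (fst w) (snd w))"
    by (subst (asm) ME.AE_commute) measurable
  then show ?thesis
  proof eventually_elim
    case (elim w)
    show ?case
    proof
      assume "fst w < snd w"
      with elim have "AE \<omega> in M. \<exists>k. Q k \<omega> (fst w) (snd w)" by simp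
      then show "AE \<omega> in M. Q (branch \<omega> (fst w) (snd w)) \<omega> (fst w) (snd w)"
        unfolding branch_def by eventually_elim (rule LeastI_ex)
    qed
  qed
qed

end

section \<open>Averages over disjoint scales\<close>

lemma measure_Leb_Icc: "0 \<le> s \<Longrightarrow> s \<le> t \<Longrightarrow> t \<le> 1 \<Longrightarrow> measure Leb {s..t} = t - s"
  by (simp add: Leb_def measure_restrict_space)

lemma Icc_sets_Leb [measurable]: "0 \<le> s \<Longrightarrow> t \<le> 1 \<Longrightarrow> {s..t} \<in> sets Leb"
  by (simp add: sets_Leb sets_restrict_space_iff)

lemma (in pair_prob_space) integrable_prob_section:
  assumes "S \<in> sets (M1 \<Otimes>\<^sub>M M2)"
  shows "integrable M2 (\<lambda>y. M1.prob ((\<lambda>x. (x, y)) -` S))"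
proof (rule M2.integrable_const_bound[where B=1])
  show "(\<lambda>y. M1.prob ((\<lambda>x. (x, y)) -` S)) \<in> borel_measurable M2"
    unfolding measure_def by (intro borel_measurable_enn2real measurable_emeasure_Pair2 assms)
qed simp

lemma (in pair_prob_space) prob_Times:
  "A \<in> sets M1 \<Longrightarrow> B \<in> sets M2 \<Longrightarrow> prob (A \<times> B) = M1.prob A * M2.prob B"
  by (simp add: measure_def M2.emeasure_pair_measure_Times enn2real_mult)

text \<open>The inequalities put \<open>near n\<close>, \<open>mid n\<close> and
  \<open>far n\<close> in this order and make the windows from \<open>a n / 2\<close> to
  \<open>b n\<close> disjoint for different \<open>n\<close>.\<close>

locale scales =
  fixes a b c :: "nat \<Rightarrow> real"
  assumes a_pos: "0 < a n" and a_c: "a n < c n" and c_b: "2 * c n < b n / 2"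
    and b_Suc: "b (Suc n) < a n / 2" and b_0: "b 0 \<le> 1"
begin

definition "near n = {a n / 2..a n}"
definition "mid n = {c n..2 * c n}"
definition "far n = {b n / 2..b n}"

lemma a_b: "a n < b n"
  using a_pos[of n] a_c[of n] c_b[of n] by linarith

lemma b_decreasing: "m < n \<Longrightarrow> b n < a m / 2"
proof (induction n)
  case (Suc n)
  then show ?case using b_Suc[of n] a_b[of n] a_pos[of n] by (cases "m = n") (auto simp: less_Suc_eq)
qed simp

lemma b_le_1: "b n \<le> 1"
  using b_decreasing[of 0 n] b_0 a_b[of 0] a_pos[of 0] by (cases "n = 0") auto

lemma box_bounds:
  assumes "z \<in> near n \<times> mid n \<times> far n"
  shows "0 < fst z" "a n / 2 \<le> fst z" "fst z < fst (snd z)" "fst (snd z) < snd (snd z)" "snd (snd z) \<le> b n"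
  using assms a_pos[of n] a_c[of n] c_b[of n] by (auto simp: near_def mid_def far_def)

lemma sets_box [measurable]: "near n \<in> sets Leb" "mid n \<in> sets Leb" "far n \<in> sets Leb"
  and sets_box_borel [measurable]: "near n \<in> sets borel" "mid n \<in> sets borel" "far n \<in> sets borel"
  using a_pos[of n] a_c[of n] c_b[of n] b_le_1[of n]
  by (auto simp: near_def mid_def far_def intro!: Icc_sets_Leb)

lemma box_sets: "near n \<times> mid n \<times> far n \<in> sets Leb3"
  by measurable

lemma measure_box_pos: "0 < measure Leb3 (near n \<times> mid n \<times> far n)"
proof -
  have "measure Leb3 (near n \<times> mid n \<times> far n) = (a n / 2) * (c n * (b n / 2))"
    using a_pos[of n] a_c[of n] c_b[of n] b_le_1[of n]
    by (simp add: Leb3.prob_Times Leb2.prob_Times sets_box)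
      (simp add: near_def mid_def far_def measure_Leb_Icc)
  moreover have "0 < (a n / 2) * (c n * (b n / 2))"
    using a_pos[of n] a_c[of n] c_b[of n] by (intro mult_pos_pos) auto
  ultimately show ?thesis by simp
qed

definition box :: "nat \<Rightarrow> (real \<times> real \<times> real) measure" where
  "box n = uniform_measure Leb3 (near n \<times> mid n \<times> far n)"

lemma sets_box_measure [measurable_cong, simp]: "sets (box n) = sets Leb3"
  and space_box [simp]: "space (box n) = space Leb3"
  by (simp_all add: box_def)

lemma prob_space_box: "prob_space (box n)"
  unfolding box_def using measure_box_pos[of n]
  by (intro prob_space_uniform_measure) (auto simp: measure_def)

lemma measure_box:
  "S \<in> sets Leb3 \<Longrightarrow> measure (box n) S = measure Leb3 (near n \<times> mid n \<times> far n \<inter> S) / measure Leb3 (near n \<times> mid n \<times> far n)"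
  unfolding box_def using measure_box_pos[of n] box_sets
  by (intro measure_uniform_measure) (auto simp: measure_def)

lemma AE_boxI:
  assumes "AE z in Leb3. P z"
  shows "AE z in box n. P z \<and> z \<in> near n \<times> mid n \<times> far n"
  unfolding box_def
proof (rule AE_uniform_measureI[OF box_sets])
  show "AE z in Leb3. z \<in> near n \<times> mid n \<times> far n \<longrightarrow>
      P z \<and> z \<in> near n \<times> mid n \<times> far n"
    using assms by eventually_elim blast
qed

definition stat :: "(bool \<Rightarrow> bool \<Rightarrow> bool) \<Rightarrow> nat \<Rightarrow> (real \<times> real) measure \<Rightarrow> real" where
  "stat G n = pattern_stat G (near n) (mid n) (far n)"

lemma measurable_stat [measurable]: "stat G n \<in> borel_measurable permuton_space"
  unfolding stat_def by measurable

end

locale random_signed_order_scales = random_signed_order M p F T X prec Q N + scales a b c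
  for M :: "'a measure" and p F T X prec Q N a b c
begin

text \<open>The counterpart of \<open>stat\<close>, read from the signs at the branch points instead
  of the permuton: here the independence of the signs can be used. \<open>AE_stat\<close> identifies
  the two.\<close>

definition W :: "(bool \<Rightarrow> bool \<Rightarrow> bool) \<Rightarrow> nat \<Rightarrow> 'a \<Rightarrow> real" where
  "W G n \<omega> = measure (box n) {z \<in> space Leb3. pattern G \<omega> z}"

lemma AE_stat: "AE \<omega> in M. stat G n (X \<omega>) = W G n \<omega>"
  using AE_reading X_eq AE_space
proof eventually_elim
  case (elim \<omega>)
  then interpret measurable_order "prec \<omega>" by simp
  have [measurable]: "\<omega> \<in> space M" using elim by simp
  let ?B = "near n \<times> mid n \<times> far n"
  let ?S = "{z \<in> space Leb3. z \<in> ?B \<and>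
      G (rank_below (prec \<omega>) (fst z) < rank_below (prec \<omega>) (fst (snd z)))
        (rank_below (prec \<omega>) (fst z) < rank_below (prec \<omega>) (snd (snd z)))}"
  have [measurable]: "{z \<in> space Leb3. pattern G \<omega> z} \<in> sets Leb3" by measurable
  have S: "?S \<in> sets Leb3"
  proof -
    have [measurable]: "Measurable.pred Leb3 (\<lambda>z. G (rank_below (prec \<omega>) (fst z) < rank_below (prec \<omega>) (fst (snd z)))
        (rank_below (prec \<omega>) (fst z) < rank_below (prec \<omega>) (snd (snd z))))"
      by (rule pred_binary[where G=G]) measurable
    have [measurable]: "?B \<in> sets Leb3" by (rule box_sets)
    show ?thesis by measurable
  qed
  have "measure Leb3 ?S = measure Leb3 (?B \<inter> {z \<in> space Leb3. pattern G \<omega> z})"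
  proof (rule Leb3.P.finite_measure_eq_AE)
    show "AE z in Leb3. z \<in> ?S \<longleftrightarrow> z \<in> ?B \<inter> {z \<in> space Leb3. pattern G \<omega> z}"
      using AE_Leb3I[OF elim(1)]
    proof eventually_elim
      case (elim z)
      show ?case
      proof (cases "z \<in> ?B")
        case True
        with elim box_bounds[OF True] show ?thesis by (auto simp: pattern_def)
      qed auto
    qed
    show "?B \<inter> {z \<in> space Leb3. pattern G \<omega> z} \<in> sets Leb3" using box_sets[of n] by (intro sets.Int) auto
  qed (rule S)
  then show ?case
    using elim by (simp add: stat_def W_def measure_box pattern_stat_order_measure)
qed

lemma pattern_events [measurable]: "{v \<in> space (M \<Otimes>\<^sub>M box n). pattern G (fst v) (snd v)} \<in> sets (M \<Otimes>\<^sub>M box n)"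
  by measurable

lemma W_section: "\<omega> \<in> space M \<Longrightarrow>
    W G n \<omega> = measure (box n) (Pair \<omega> -` {v \<in> space (M \<Otimes>\<^sub>M box n). pattern G (fst v) (snd v)})"
  unfolding W_def by (intro arg_cong[where f="measure (box n)"]) (auto simp: space_pair_measure)

lemma W_measurable [measurable]: "W G n \<in> borel_measurable M"
proof -
  interpret box: prob_space "box n" by (rule prob_space_box)
  have "(\<lambda>\<omega>. measure (box n) (Pair \<omega> -` {v \<in> space (M \<Otimes>\<^sub>M box n). pattern G (fst v) (snd v)})) \<in> borel_measurable M"
    unfolding measure_def
    by (intro borel_measurable_enn2real box.measurable_emeasure_Pair pattern_events)
  then show ?thesis by (subst measurable_cong[OF W_section])
qed

lemma W_bounds: "0 \<le> W G n \<omega>" "W G n \<omega> \<le> 1"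
  using prob_space.prob_le_1[OF prob_space_box] by (auto simp: W_def)

lemma W_mean_lower:
  assumes "AE z in box n. d \<le> prob {\<omega> \<in> space M. pattern G \<omega> z}"
  shows "d \<le> expectation (W G n)"
proof -
  interpret box: prob_space "box n" by (rule prob_space_box)
  interpret MB: pair_prob_space M "box n" ..
  let ?S = "{v \<in> space (M \<Otimes>\<^sub>M box n). pattern G (fst v) (snd v)}"
  have "d = box.expectation (\<lambda>z. d)" using box.prob_space by simp
  also have "\<dots> \<le> box.expectation (\<lambda>z. prob ((\<lambda>\<omega>. (\<omega>, z)) -` ?S))"
  proof (rule integral_mono_AE)
    show "integrable (box n) (\<lambda>z. prob ((\<lambda>\<omega>. (\<omega>, z)) -` ?S))"
      by (rule MB.integrable_prob_section[OF pattern_events])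
    show "AE z in box n. d \<le> prob ((\<lambda>\<omega>. (\<omega>, z)) -` ?S)"
      using assms AE_space
    proof eventually_elim
      case (elim z)
      then have "(\<lambda>\<omega>. (\<omega>, z)) -` ?S = {\<omega> \<in> space M. pattern G \<omega> z}" by (auto simp: space_pair_measure)
      with elim show ?case by simp
    qed
  qed simp
  also have "\<dots> = expectation (\<lambda>\<omega>. measure (box n) (Pair \<omega> -` ?S))"
    by (rule MB.expectation_section[symmetric]) (rule pattern_events)
  also have "\<dots> = expectation (W G n)"
    by (intro Bochner_Integration.integral_cong refl) (simp add: W_section)
  finally show ?thesis .
qed

text \<open>\<open>random_index_lower\<close> with the pair of branch numbers as index.
  \<open>I\<close> collects the pairs at which the pattern has its large probability: all pairs for
  \<open>G a b = a\<close>, distinct numbers for \<open>(\<noteq>)\<close>.\<close>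

lemma pattern_prob_lower:
  assumes "\<And>i j. (i, j) \<in> I \<Longrightarrow> d \<le> pattern_prob G i j" and "0 \<le> d"
  shows "d * prob {\<omega> \<in> space M. (branch \<omega> x y, branch \<omega> x z) \<in> I} \<le> prob {\<omega> \<in> space M. pattern G \<omega> (x, y, z)}"
proof -
  have [measurable]: "(\<lambda>\<omega>. (branch \<omega> x y, branch \<omega> x z)) \<in> F \<rightarrow>\<^sub>M count_space UNIV"
    using branch_measurable_F[of x y] branch_measurable_F[of x z] by measurable
  have "d * prob {\<omega> \<in> space M. (branch \<omega> x y, branch \<omega> x z) \<in> I} \<le>
      prob {\<omega> \<in> space M. (branch \<omega> x y, branch \<omega> x z) \<in> I \<and>
        (\<lambda>(i, j) \<omega>. G (T i \<omega>) (T j \<omega>)) (branch \<omega> x y, branch \<omega> x z) \<omega>}"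
  proof (rule random_index_lower)
    show "Measurable.pred sign_algebra ((\<lambda>(i, j) \<omega>. G (T i \<omega>) (T j \<omega>)) ij)" for ij
      by (cases ij) (auto intro!: pred_binary[where G=G] measurable_T_sign_algebra)
    show "d \<le> prob {\<omega> \<in> space M. (\<lambda>(i, j) \<omega>. G (T i \<omega>) (T j \<omega>)) ij \<omega>}" if "ij \<in> I" for ij
      using assms(1)[of "fst ij" "snd ij"] that by (simp add: pattern_prob_def split_beta)
  qed (use assms in measurable)
  also have "\<dots> \<le> prob {\<omega> \<in> space M. pattern G \<omega> (x, y, z)}"
  proof (rule finite_measure_mono)
    have [measurable]: "Measurable.pred M (\<lambda>\<omega>. G (T (branch \<omega> x y) \<omega>) (T (branch \<omega> x z) \<omega>))"
      by (rule pred_binary[where G=G]) measurable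
    show "{\<omega> \<in> space M. pattern G \<omega> (x, y, z)} \<in> events" unfolding pattern_def by simp
  qed (auto simp: pattern_def)
  finally show ?thesis .
qed

lemma AE_box_branch: "AE z in box n.
   (AE \<omega> in M. N (branch \<omega> (fst z) (fst (snd z))) \<omega> \<in> {a n / 2..b n} \<and>
      N (branch \<omega> (fst z) (snd (snd z))) \<omega> \<in> {a n / 2..b n})"
  using AE_boxI[OF AE_Leb3I[OF AE_branch]]
proof eventually_elim
  case (elim z)
  note bounds = box_bounds[OF conjunct2[OF elim]]
  from elim bounds have "AE \<omega> in M. Q (branch \<omega> (fst z) (fst (snd z))) \<omega> (fst z) (fst (snd z))"
    "AE \<omega> in M. Q (branch \<omega> (fst z) (snd (snd z))) \<omega> (fst z) (snd (snd z))"
    by auto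
  then show ?case using AE_space
    by eventually_elim (use Q_pos bounds in fastforce)
qed

text \<open>Branch points at different scales lie in disjoint intervals, so their signs are independent given
  the environment.\<close>

lemma W_correlation:
  assumes le: "\<And>i j. pattern_prob G i j \<le> d" and "m \<noteq> n"
  shows "expectation (\<lambda>\<omega>. W G m \<omega> * W G n \<omega>) \<le> d\<^sup>2"
proof -
  interpret bm: prob_space "box m" by (rule prob_space_box)
  interpret bn: prob_space "box n" by (rule prob_space_box)
  interpret bb: pair_prob_space "box m" "box n" ..
  interpret MB: pair_prob_space M "box m \<Otimes>\<^sub>M box n" ..
  have d: "0 \<le> d" using le[of 0 0] by (auto simp: pattern_prob_def intro: order_trans[OF measure_nonneg])
  let ?S = "{v \<in> space (M \<Otimes>\<^sub>M (box m \<Otimes>\<^sub>M box n)).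
      pattern G (fst v) (fst (snd v)) \<and> pattern G (fst v) (snd (snd v))}"
  have S [measurable]: "?S \<in> sets (M \<Otimes>\<^sub>M (box m \<Otimes>\<^sub>M box n))" by measurable
  \<comment> \<open>The product of two box averages is the average over two independent triples;
    Fubini then allows both triples to be fixed.\<close>
  have "expectation (\<lambda>\<omega>. W G m \<omega> * W G n \<omega>) = expectation (\<lambda>\<omega>. measure (box m \<Otimes>\<^sub>M box n) (Pair \<omega> -` ?S))"
  proof (intro Bochner_Integration.integral_cong refl)
    fix \<omega> assume [measurable]: "\<omega> \<in> space M"
    have "Pair \<omega> -` ?S = {z \<in> space Leb3. pattern G \<omega> z} \<times> {z \<in> space Leb3. pattern G \<omega> z}"
      using \<open>\<omega> \<in> space M\<close> by (auto simp: space_pair_measure)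
    moreover have "{z \<in> space Leb3. pattern G \<omega> z} \<in> sets Leb3" by measurable
    ultimately show "W G m \<omega> * W G n \<omega> = measure (box m \<Otimes>\<^sub>M box n) (Pair \<omega> -` ?S)"
      by (simp add: bb.prob_Times W_def)
  qed
  also have "\<dots> = bb.P.expectation (\<lambda>w. prob ((\<lambda>\<omega>. (\<omega>, w)) -` ?S))"
    by (rule MB.expectation_section[OF S])
  also have "\<dots> \<le> bb.P.expectation (\<lambda>w. d\<^sup>2)"
  proof (rule integral_mono_AE)
    show "integrable (box m \<Otimes>\<^sub>M box n) (\<lambda>w. prob ((\<lambda>\<omega>. (\<omega>, w)) -` ?S))"
      by (rule MB.integrable_prob_section[OF S])
    show "AE w in box m \<Otimes>\<^sub>M box n. prob ((\<lambda>\<omega>. (\<omega>, w)) -` ?S) \<le> d\<^sup>2"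
      using bb.AE_pairI[OF AE_box_branch AE_box_branch] AE_space
    proof eventually_elim
      case (elim w)
      obtain x y z x' y' z' where w: "w = ((x, y, z), (x', y', z'))" by (metis prod.collapse)
      \<comment> \<open>All four branch numbers form a single index measurable with respect to
        \<open>F\<close>. On \<open>?I\<close> the two pairs of signs are independent, which gives
        the bound \<open>d\<^sup>2\<close>.\<close>
      let ?K = "\<lambda>\<omega>. (branch \<omega> x y, branch \<omega> x z, branch \<omega> x' y', branch \<omega> x' z')"
      let ?I = "{(i, j, i', j'). {i, j} \<inter> {i', j'} = {}}"
      let ?H = "\<lambda>(i, j, i', j') \<omega>. G (T i \<omega>) (T j \<omega>) \<and> G (T i' \<omega>) (T j' \<omega>)"
      have K: "?K \<in> F \<rightarrow>\<^sub>M count_space UNIV"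
        using branch_measurable_F[of x y] branch_measurable_F[of x z]
          branch_measurable_F[of x' y'] branch_measurable_F[of x' z'] by measurable
      have disj: "{a m / 2..b m} \<inter> {a n / 2..b n} = {}"
        using b_decreasing[of m n] b_decreasing[of n m] \<open>m \<noteq> n\<close> by (cases "m < n") auto
      have ae: "AE \<omega> in M. ?K \<omega> \<in> ?I"
        using conjunct1[OF elim(1)] conjunct2[OF elim(1)] unfolding w
        by eventually_elim (use disj in \<open>auto; metis disjoint_iff\<close>)
      have [measurable]: "Measurable.pred M (\<lambda>\<omega>. pattern G \<omega> (x, y, z))"
        "Measurable.pred M (\<lambda>\<omega>. pattern G \<omega> (x', y', z'))"
        unfolding pattern_def by (rule pred_binary[where G=G]; measurable)+
      have sec: "(\<lambda>\<omega>. (\<omega>, w)) -` ?S = {\<omega> \<in> space M. pattern G \<omega> (x, y, z) \<and> pattern G \<omega> (x', y', z')}"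
        using elim(2) by (auto simp: w space_pair_measure)
      have "prob ((\<lambda>\<omega>. (\<omega>, w)) -` ?S) = prob {\<omega> \<in> space M. ?K \<omega> \<in> ?I \<and> ?H (?K \<omega>) \<omega>}"
        unfolding sec
      proof (rule finite_measure_eq_AE)
        have [measurable]: "Measurable.pred M (\<lambda>\<omega>. ?K \<omega> \<in> ?I)"
          by (rule measurable_compose[OF measurable_F[OF K]]) simp
        have "{\<omega> \<in> space M. ?K \<omega> \<in> ?I \<and> ?H (?K \<omega>) \<omega>} =
            {\<omega> \<in> space M. ?K \<omega> \<in> ?I \<and> pattern G \<omega> (x, y, z) \<and> pattern G \<omega> (x', y', z')}"
          by (auto simp: pattern_def)
        also have "\<dots> \<in> events" by measurable
        finally show "{\<omega> \<in> space M. ?K \<omega> \<in> ?I \<and> ?H (?K \<omega>) \<omega>} \<in> events" .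
        show "{\<omega> \<in> space M. pattern G \<omega> (x, y, z) \<and> pattern G \<omega> (x', y', z')} \<in> events" by measurable
        show "AE \<omega> in M. \<omega> \<in> {\<omega> \<in> space M. pattern G \<omega> (x, y, z) \<and> pattern G \<omega> (x', y', z')} \<longleftrightarrow>
            \<omega> \<in> {\<omega> \<in> space M. ?K \<omega> \<in> ?I \<and> ?H (?K \<omega>) \<omega>}"
          using ae by eventually_elim (auto simp: pattern_def)
      qed
      also have "\<dots> \<le> d\<^sup>2 * prob {\<omega> \<in> space M. ?K \<omega> \<in> ?I}"
      proof (rule random_index_upper[OF K])
        show "Measurable.pred sign_algebra (?H i)" for i
          by (auto simp: split_beta intro!: pred_intros_logic pred_binary[where G=G] measurable_T_sign_algebra)
        show "prob {\<omega> \<in> space M. ?H i \<omega>} \<le> d\<^sup>2" if "i \<in> ?I" for i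
          using that pattern_prob_indep[of "fst i" "fst (snd i)" "fst (snd (snd i))" "snd (snd (snd i))" G]
          by (auto simp: split_beta power2_eq_square pattern_prob_def d intro!: mult_mono le[unfolded pattern_prob_def])
      qed (simp add: d)
      also have "\<dots> \<le> d\<^sup>2 * 1" by (intro mult_left_mono) auto
      finally show ?case by simp
    qed
  qed simp
  also have "\<dots> = d\<^sup>2" using bb.P.prob_space by simp
  finally show ?thesis .
qed

text \<open>\<open>\<delta>\<close> measures how far the means may stay below the largest possible
  probability \<open>d\<close>.\<close>

lemma stat_deviation:
  assumes le: "\<And>i j. pattern_prob G i j \<le> d"
    and mean: "\<And>n. AE z in box n. d - \<delta> \<le> prob {\<omega> \<in> space M. pattern G \<omega> z}"
    and "0 < K" "0 < r"
  shows "prob {\<omega> \<in> space M. r \<le> \<bar>(\<Sum>n<K. stat G n (X \<omega>)) / real K - d\<bar>} \<le> (1 / real K + 2 * d * \<delta>) / r\<^sup>2"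
proof -
  have d: "0 \<le> d" using le[of 0 0] by (auto simp: pattern_prob_def intro: order_trans[OF measure_nonneg])
  have [measurable]: "(\<lambda>\<omega>. stat G n (X \<omega>)) \<in> borel_measurable M" for n
    by (rule measurable_compose[OF X measurable_stat])
  have "AE \<omega> in M. \<forall>n. stat G n (X \<omega>) = W G n \<omega>" by (simp add: AE_all_countable AE_stat)
  then have "prob {\<omega> \<in> space M. r \<le> \<bar>(\<Sum>n<K. stat G n (X \<omega>)) / real K - d\<bar>} =
      prob {\<omega> \<in> space M. r \<le> \<bar>(\<Sum>n<K. W G n \<omega>) / real K - d\<bar>}"
    by (intro finite_measure_eq_AE) (auto elim: eventually_mono)
  also have "\<dots> \<le> (1 / real K + 2 * d * \<delta>) / r\<^sup>2"
    using W_bounds W_mean_lower[OF mean] W_correlation[OF le] d assms(3,4)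
    by (intro average_deviation) auto
  finally show ?thesis .
qed

end

section \<open>The recursive order\<close>

definition signed_order :: "(real \<Rightarrow> real \<Rightarrow> 'i \<Rightarrow> bool) \<Rightarrow> ('i \<Rightarrow> bool) \<Rightarrow> real \<Rightarrow> real \<Rightarrow> bool" where
  "signed_order R s x y \<longleftrightarrow> (x < y \<and> (\<exists>k. R x y k \<and> s k)) \<or> (y < x \<and> (\<exists>k. R y x k \<and> \<not> s k))"

text \<open>\<open>R x y k\<close> stands for: \<open>k\<close> is the branch point of
  \<open>x < y\<close>. Start a 3-cycle at its smallest point \<open>x\<close>. The two pairs
  containing \<open>x\<close> have opposite signs, so by \<open>split\<close> the branch point of
  the longer one is that of the pair formed by the other two points. The direction of the cycle
  gives that pair the sign of the shorter one, a contradiction. Countability of the branch points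
  yields measurability.\<close>

lemma measurable_signed_order:
  assumes func: "\<And>x y k k'. R x y k \<Longrightarrow> R x y k' \<Longrightarrow> k = k'"
    and split: "\<And>x y z k. x < y \<Longrightarrow> y < z \<Longrightarrow> R x z k \<Longrightarrow> R x y k \<or> R y z k"
    and I: "countable I" "\<And>x y k. R x y k \<Longrightarrow> k \<in> I"
    and R: "\<And>k. k \<in> I \<Longrightarrow> Measurable.pred (borel \<Otimes>\<^sub>M borel) (\<lambda>w. R (fst w) (snd w) k)"
  shows "measurable_order (signed_order R s)"
proof
  show "\<not> signed_order R s y x" if "signed_order R s x y" for x y
    using that unfolding signed_order_def by (metis func less_asym)
  have no_cycle: False if cyc: "signed_order R s x y" "signed_order R s y z" "signed_order R s z x" "x < y" "x < z" for x y z
  proof -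
    obtain k where k: "R x y k" "s k" using cyc(1,4) unfolding signed_order_def by auto
    obtain k' where k': "R x z k'" "\<not> s k'" using cyc(3,5) unfolding signed_order_def by auto
    consider "y < z" | "z < y" using cyc(2) unfolding signed_order_def by auto
    then show False
    proof cases
      case 1
      then obtain l where "R y z l" "s l" using cyc(2) unfolding signed_order_def by auto
      with split[OF \<open>x < y\<close> 1 k'(1)] k k' func show False by blast
    next
      case 2
      then obtain l where "R z y l" "\<not> s l" using cyc(2) unfolding signed_order_def by auto
      with split[OF \<open>x < z\<close> 2 k(1)] k k' func show False by blast
    qed
  qed
  show "\<not> signed_order R s z x" if "signed_order R s x y" "signed_order R s y z" for x y z
  proof
    assume zx: "signed_order R s z x"
    have "x \<noteq> y" "y \<noteq> z" "z \<noteq> x" using that zx by (auto simp: signed_order_def)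
    then consider "x < y" "x < z" | "y < z" "y < x" | "z < x" "z < y" by linarith
    then show False
      using no_cycle[OF that zx] no_cycle[OF that(2) zx that(1)] no_cycle[OF zx that] by cases
  qed
  have L: "Measurable.pred (Leb \<Otimes>\<^sub>M Leb) (\<lambda>w. R (f w) (g w) k)"
    if "k \<in> I" and [measurable]: "f \<in> Leb \<Otimes>\<^sub>M Leb \<rightarrow>\<^sub>M Leb" "g \<in> Leb \<Otimes>\<^sub>M Leb \<rightarrow>\<^sub>M Leb" for f g k
  proof -
    have "(\<lambda>w. (f w, g w)) \<in> Leb \<Otimes>\<^sub>M Leb \<rightarrow>\<^sub>M borel \<Otimes>\<^sub>M borel" by measurable
    from measurable_compose[OF this R[OF that(1)]] show ?thesis by simp
  qed
  have eq: "signed_order R s (fst w) (snd w) \<longleftrightarrow>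
      (fst w < snd w \<and> (\<exists>k\<in>I. R (fst w) (snd w) k \<and> s k)) \<or> (snd w < fst w \<and> (\<exists>k\<in>I. R (snd w) (fst w) k \<and> \<not> s k))" for w
    unfolding signed_order_def using I(2) by blast
  have "Measurable.pred (Leb \<Otimes>\<^sub>M Leb) (\<lambda>w. \<exists>k\<in>I. R (f w) (g w) k \<and> P k)"
    if "f \<in> Leb \<Otimes>\<^sub>M Leb \<rightarrow>\<^sub>M Leb" "g \<in> Leb \<Otimes>\<^sub>M Leb \<rightarrow>\<^sub>M Leb" for f g P
  proof -
    have [measurable]: "Measurable.pred (Leb \<Otimes>\<^sub>M Leb) (\<lambda>w. R (f w) (g w) k)" if "k \<in> I" for k
      by (rule L[OF that]) fact+
    have "{w \<in> space (Leb \<Otimes>\<^sub>M Leb). \<exists>k\<in>I. R (f w) (g w) k \<and> P k} =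
        (\<Union>k\<in>I. {w \<in> space (Leb \<Otimes>\<^sub>M Leb). R (f w) (g w) k \<and> P k})" by auto
    also have "\<dots> \<in> sets (Leb \<Otimes>\<^sub>M Leb)"
      by (intro sets.countable_UN'' I(1)) measurable
    finally show ?thesis by (simp add: pred_def)
  qed
  note [measurable] = this[OF measurable_fst measurable_snd] this[OF measurable_snd measurable_fst]
  show "{w \<in> space (Leb \<Otimes>\<^sub>M Leb). signed_order R s (fst w) (snd w)} \<in> sets (Leb \<Otimes>\<^sub>M Leb)"
    unfolding eq by measurable
qed

lemma subalgebra_vimage_algebra: "f \<in> M \<rightarrow>\<^sub>M N \<Longrightarrow> subalgebra M (vimage_algebra (space M) f N)"
  by (simp add: subalgebra_def measurable_iff_sets)

lemma measurable_order_rec_prec: "measurable_order (rec_prec u s)"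
proof -
  have "rec_prec u s = signed_order (first_hit u) s"
    by (intro ext) (simp add: rec_prec_def signed_order_def)
  moreover have "measurable_order (signed_order (first_hit u) s)"
  proof (rule measurable_signed_order[where I=UNIV])
    show "k = k'" if "first_hit u x y k" "first_hit u x y k'" for x y k k'
      using that unfolding first_hit_def by (metis nat_neq_iff)
    show "first_hit u x y k \<or> first_hit u y z k" if "x < y" "y < z" "first_hit u x z k" for x y z k
      using that by (cases "u k \<le> y") (auto simp: first_hit_def)
    show "Measurable.pred (borel \<Otimes>\<^sub>M borel) (\<lambda>w. first_hit u (fst w) (snd w) k)" for k
      unfolding first_hit_def greaterThanAtMost_iff by measurable
  qed auto
  ultimately show ?thesis by simp
qed

locale recursive_order = prob_space M for M :: "'a measure" +
  fixes p :: real and X :: "'a \<Rightarrow> (real \<times> real) measure" and U :: "nat \<Rightarrow> 'a \<Rightarrow> real" and S :: "nat \<Rightarrow> 'a \<Rightarrow> bool"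
  assumes p_bounds: "0 \<le> p" "p \<le> 1"
    and X_measurable: "X \<in> M \<rightarrow>\<^sub>M permuton_space"
    and U_indep: "indep_vars (\<lambda>_. borel) U UNIV"
    and U_uniform: "\<And>j. distr M borel (U j) = uniform_measure lborel {0..1}"
    and S_iid: "iid_signs M p S"
    and US: "independent_vars M (PiM UNIV (\<lambda>_. borel)) (\<lambda>\<omega> j. U j \<omega>)
        (PiM UNIV (\<lambda>_. count_space UNIV)) (\<lambda>\<omega> j. S j \<omega>)"
    and X_rec: "AE \<omega> in M. X \<omega> = order_measure (rec_prec (\<lambda>j. U j \<omega>) (\<lambda>j. S j \<omega>))"
begin

lemma U_measurable [measurable]: "U j \<in> borel_measurable M"
  using U_indep by (simp add: indep_vars_def)

text \<open>All hits of the interval are candidates; the least one is the first hit.\<close>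

sublocale random_signed_order M p "vimage_algebra (space M) (\<lambda>\<omega> j. U j \<omega>) (PiM UNIV (\<lambda>_. borel))" S X
  "\<lambda>\<omega>. rec_prec (\<lambda>j. U j \<omega>) (\<lambda>j. S j \<omega>)" "\<lambda>k \<omega> x y. U k \<omega> \<in> {x<..y}" U
proof
  let ?F = "vimage_algebra (space M) (\<lambda>\<omega> j. U j \<omega>) (PiM UNIV (\<lambda>_. borel))"
  show "0 \<le> p" "p \<le> 1" "iid_signs M p S" "X \<in> M \<rightarrow>\<^sub>M permuton_space"
    by (rule p_bounds S_iid X_measurable)+
  show "subalgebra M ?F"
    using US by (intro subalgebra_vimage_algebra) (simp add: independent_vars_def)
  show "indep_set (sets ?F) (sets (vimage_algebra (space M) (\<lambda>\<omega> k. S k \<omega>) (PiM UNIV (\<lambda>_. count_space UNIV))))"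
    using US by (simp add: independent_vars_def)
  show "AE \<omega> in M. X \<omega> = order_measure (rec_prec (\<lambda>j. U j \<omega>) (\<lambda>j. S j \<omega>)) \<and>
      measurable_order (rec_prec (\<lambda>j. U j \<omega>) (\<lambda>j. S j \<omega>))"
    using X_rec by eventually_elim (simp add: measurable_order_rec_prec)
  have sign: "(\<exists>k. u k \<in> {x<..y}) \<and> (rec_prec u s x y \<longleftrightarrow> s (LEAST k. u k \<in> {x<..y}))"
    if "x < y" "rec_prec u s x y \<or> rec_prec u s y x" for u s x y
  proof -
    have least: "(LEAST k. u k \<in> {x<..y}) = k" if "first_hit u x y k" for k
      using that by (intro Least_equality) (auto simp: first_hit_def not_less[symmetric])
    from that obtain k where k: "first_hit u x y k" by (auto simp: rec_prec_def)
    then have "rec_prec u s x y \<longleftrightarrow> s k" using \<open>x < y\<close> least by (auto simp: rec_prec_def)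
    with k least[OF k] show ?thesis by (auto simp: first_hit_def)
  qed
  show "AE \<omega> in M. \<forall>x\<in>{0..1}. \<forall>y\<in>{0..1}. x < y \<longrightarrow>
      rec_prec (\<lambda>j. U j \<omega>) (\<lambda>j. S j \<omega>) x y \<or> rec_prec (\<lambda>j. U j \<omega>) (\<lambda>j. S j \<omega>) y x \<longrightarrow>
      (\<exists>k. U k \<omega> \<in> {x<..y}) \<and>
      (rec_prec (\<lambda>j. U j \<omega>) (\<lambda>j. S j \<omega>) x y \<longleftrightarrow> S (LEAST k. U k \<omega> \<in> {x<..y}) \<omega>)"
    by (intro AE_I2 ballI impI) (rule sign)
  show "U k \<omega> \<in> {x..y}" if "U k \<omega> \<in> {x<..y}" for k \<omega> x y using that by auto
  have [measurable]: "U k \<in> borel_measurable ?F" for k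
  proof -
    have "(\<lambda>\<omega> j. U j \<omega>) \<in> ?F \<rightarrow>\<^sub>M PiM UNIV (\<lambda>_. borel)"
      by (rule measurable_vimage_algebra1) (auto simp: space_PiM)
    from measurable_compose[OF this measurable_component_singleton[of k]] show ?thesis by simp
  qed
  show "Measurable.pred (?F \<Otimes>\<^sub>M (borel \<Otimes>\<^sub>M borel)) (\<lambda>v. U k (fst v) \<in> {fst (snd v)<..snd (snd v)})" for k
    unfolding greaterThanAtMost_iff by measurable
qed

lemma prob_U_Ioc: "0 \<le> x \<Longrightarrow> x \<le> y \<Longrightarrow> y \<le> 1 \<Longrightarrow> prob (U j -` {x<..y} \<inter> space M) = y - x"
proof -
  assume "0 \<le> x" "x \<le> y" "y \<le> 1"
  have "prob (U j -` {x<..y} \<inter> space M) = measure (uniform_measure lborel {0..1}) {x<..y}"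
    by (subst U_uniform[symmetric], subst measure_distr) auto
  also have "\<dots> = measure lborel ({0..1} \<inter> {x<..y}) / measure lborel {0..1::real}"
    by (rule measure_uniform_measure) auto
  also have "{0..1} \<inter> {x<..y} = {x<..y}" using \<open>0 \<le> x\<close> \<open>y \<le> 1\<close> by auto
  finally show ?thesis using \<open>x \<le> y\<close> by simp
qed

text \<open>The numbers agree only if the first \<open>U j\<close> to hit the long interval already
  falls into the short one. Splitting by the index \<open>j\<close> of this hit (event
  \<open>E j\<close>) and summing a geometric series of ratio \<open>1 - (z - x)\<close> gives the
  quotient of the lengths.\<close>

lemma prob_same_branch:
  assumes "0 \<le> x" "x < y" "y < z" "z \<le> 1"
    and ae_y: "AE \<omega> in M. U (branch \<omega> x y) \<omega> \<in> {x<..y}"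
    and ae_z: "AE \<omega> in M. U (branch \<omega> x z) \<omega> \<in> {x<..z}"
  shows "prob {\<omega> \<in> space M. branch \<omega> x y = branch \<omega> x z} \<le> (y - x) / (z - x)"
proof -
  define A where "A j i = (if i < j then - {x<..z} else {x<..y})" for i j :: nat
  define E where "E j = (\<Inter>i\<in>{..j}. U i -` A j i \<inter> space M)" for j
  have A [measurable]: "A j i \<in> sets borel" for i j by (simp add: A_def)
  have prob_compl: "prob (U i -` (- {x<..z}) \<inter> space M) = 1 - (z - x)" for i
  proof -
    have "U i -` (- {x<..z}) \<inter> space M = space M - (U i -` {x<..z} \<inter> space M)" by auto
    then show ?thesis using prob_U_Ioc[of x z i] assms by (simp add: prob_compl)
  qed
  have prob_E: "prob (E j) = (1 - (z - x)) ^ j * (y - x)" for j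
  proof -
    have "prob (E j) = (\<Prod>i\<in>{..j}. prob (U i -` A j i \<inter> space M))"
      unfolding E_def by (rule indep_varsD[OF U_indep]) auto
    also have "\<dots> = (\<Prod>i\<in>{..<j}. prob (U i -` A j i \<inter> space M)) * prob (U j -` A j j \<inter> space M)"
      by (simp add: lessThan_Suc_atMost[symmetric])
    also have "\<dots> = (\<Prod>i\<in>{..<j}. 1 - (z - x)) * (y - x)"
      using assms by (simp add: A_def prob_compl prob_U_Ioc)
    finally show ?thesis by simp
  qed
  have E [measurable]: "E j \<in> events" for j unfolding E_def by (intro sets.finite_INT) auto
  have sums: "(\<lambda>j. prob (E j)) sums ((y - x) / (z - x))"
    using sums_mult2[OF geometric_sums[of "1 - (z - x)"], of "y - x"] assms by (simp add: prob_E)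
  have "prob {\<omega> \<in> space M. branch \<omega> x y = branch \<omega> x z} \<le> prob (\<Union>j. E j)"
  proof (rule finite_measure_mono_AE)
    show "AE \<omega> in M. \<omega> \<in> {\<omega> \<in> space M. branch \<omega> x y = branch \<omega> x z} \<longrightarrow> \<omega> \<in> (\<Union>j. E j)"
      using ae_y ae_z
    proof eventually_elim
      case (elim \<omega>)
      have "U i \<omega> \<notin> {x<..z}" if "i < branch \<omega> x z" for i
        by (rule not_less_Least[OF that[unfolded branch_def]])
      with elim show ?case by (auto simp: E_def A_def intro!: exI[of _ "branch \<omega> x z"])
    qed
  qed auto
  also have "\<dots> \<le> (\<Sum>j. prob (E j))"
    using sums by (intro finite_measure_subadditive_countably) (auto simp: sums_iff)
  finally show ?thesis using sums by (simp add: sums_iff)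
qed

end

section \<open>Minima of continuous paths\<close>

lemma min_position_unique: "min_position f x y m \<Longrightarrow> min_position f x y m' \<Longrightarrow> m = m'"
  unfolding min_position_def by (metis less_asym)

lemma min_position_split:
  "x < y \<Longrightarrow> y < z \<Longrightarrow> min_position f x z m \<Longrightarrow> min_position f x y m \<or> min_position f y z m"
  unfolding min_position_def by (cases "m \<le> y") auto

text \<open>The condition separates into one on each endpoint, and the admissible endpoints form
  intervals, which are Borel for an arbitrary \<open>f\<close>.\<close>

lemma pred_min_position: "Measurable.pred (borel \<Otimes>\<^sub>M borel) (\<lambda>w. min_position f (fst w) (snd w) m)"
proof -
  define A where "A = {x. x \<le> m \<and> (\<forall>t\<in>{x..<m}. f m < f t)}"
  define B where "B = {y. m \<le> y \<and> (\<forall>t\<in>{m<..y}. f m < f t)}"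
  have eq: "min_position f (fst w) (snd w) m \<longleftrightarrow> fst w \<in> A \<and> snd w \<in> B" for w
    unfolding min_position_def A_def B_def by (force simp: neq_iff)
  have "A \<in> sets borel" "B \<in> sets borel"
    by (auto intro!: real_interval_borel_measurable simp: is_interval_1 A_def B_def)
  then have [measurable]: "A \<in> sets borel" "B \<in> sets borel" by auto
  show ?thesis unfolding eq by measurable
qed

lemma br_prec_eq_signed_order:
  "br_prec f s = signed_order (\<lambda>x y m. m \<in> local_minima f \<and> min_position f x y m) s"
  by (intro ext) (auto simp: br_prec_def signed_order_def)

lemma measurable_order_br_prec:
  assumes "countable (local_minima f)"
  shows "measurable_order (br_prec f s)"
  unfolding br_prec_eq_signed_order
proof (rule measurable_signed_order[where I="local_minima f"])
  show "Measurable.pred (borel \<Otimes>\<^sub>M borel) (\<lambda>w. k \<in> local_minima f \<and> min_position f (fst w) (snd w) k)" for k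
    by (intro pred_intros_logic pred_min_position) simp
qed (use assms in \<open>auto dest: min_position_unique min_position_split\<close>)

text \<open>The minimum over an interval, expressed through countably many values of the path, so that
  it depends measurably on the path and on \<open>m\<close>.\<close>

definition rational_min :: "(real \<Rightarrow> real) \<Rightarrow> real \<Rightarrow> real \<Rightarrow> real \<Rightarrow> bool" where
  "rational_min f x y m \<longleftrightarrow> m \<in> {x..y} \<and>
     (\<forall>t\<in>\<rat> \<inter> {0..1}. x \<le> t \<longrightarrow> t \<le> y \<longrightarrow>
       (\<forall>n::nat. \<exists>r\<in>\<rat> \<inter> {0..1}. \<bar>r - m\<bar> < 1 / Suc n \<and> f r < f t + 1 / Suc n))"

lemma Rats_dense_Icc:
  fixes t u v d :: real
  assumes "t \<in> {u..v}" "u < v" "0 < d"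
  shows "\<exists>r\<in>\<rat> \<inter> {u..v}. \<bar>r - t\<bar> < d"
proof -
  have "max u (t - d) < min v (t + d)" using assms by auto
  then obtain r where "r \<in> \<rat>" "max u (t - d) < r" "r < min v (t + d)" using Rats_dense_in_real by blast
  then show ?thesis by (intro bexI[of _ r]) (auto simp: abs_less_iff)
qed

lemma continuous_on_unit_near:
  fixes f :: "real \<Rightarrow> real"
  assumes "continuous_on {0..1} f" "t \<in> {0..1}" "0 < \<eta>"
  obtains d where "0 < d" "\<And>r. r \<in> {0..1} \<Longrightarrow> \<bar>r - t\<bar> < d \<Longrightarrow> \<bar>f r - f t\<bar> < \<eta>"
  using assms unfolding continuous_on_iff dist_real_def by metis

lemma rational_min_iff:
  assumes f: "continuous_on {0..1} f" and xy: "0 \<le> x" "x < y" "y \<le> 1"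
  shows "rational_min f x y m \<longleftrightarrow> m \<in> {x..y} \<and> (\<forall>t\<in>{x..y}. f m \<le> f t)"
proof
  {
    assume min: "rational_min f x y m"
    then have m: "m \<in> {x..y}" by (simp add: rational_min_def)
    then have m01: "m \<in> {0..1}" using xy by auto
    have "f m \<le> f t" if t: "t \<in> {x..y}" for t
    proof (rule field_le_epsilon)
      fix e :: real assume e: "0 < e"
      have t01: "t \<in> {0..1}" using t xy by auto
      \<comment> \<open>One third of \<open>e\<close> each for replacing \<open>t\<close> by a
        rational \<open>q\<close>, for replacing \<open>m\<close> by a rational \<open>r\<close>,
        and for the tolerance \<open>1 / Suc n\<close>.\<close>
      obtain d where d: "0 < d" "\<And>r. r \<in> {0..1} \<Longrightarrow> \<bar>r - t\<bar> < d \<Longrightarrow> \<bar>f r - f t\<bar> < e / 3"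
        using continuous_on_unit_near[OF f t01, of "e / 3"] e by auto
      obtain d' where d': "0 < d'" "\<And>r. r \<in> {0..1} \<Longrightarrow> \<bar>r - m\<bar> < d' \<Longrightarrow> \<bar>f r - f m\<bar> < e / 3"
        using continuous_on_unit_near[OF f m01, of "e / 3"] e by auto
      obtain q where q: "q \<in> \<rat>" "q \<in> {x..y}" "\<bar>q - t\<bar> < d" using Rats_dense_Icc[OF t _ d(1)] xy by auto
      obtain n :: nat where n: "1 / Suc n < min d' (e / 3)"
        using nat_approx_posE[of "min d' (e / 3)"] d' e by auto
      have "q \<in> \<rat> \<inter> {0..1}" using q xy by auto
      note min_q = conjunct2[OF min[unfolded rational_min_def], rule_format, OF this, of n]
      obtain r where r: "r \<in> {0..1}" "\<bar>r - m\<bar> < 1 / Suc n" "f r < f q + 1 / Suc n"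
        using min_q q(2) by auto
      have "\<bar>f r - f m\<bar> < e / 3" using d'(2)[of r] r n by auto
      moreover have "\<bar>f q - f t\<bar> < e / 3" using d(2)[of q] q xy by auto
      ultimately show "f m \<le> f t + e" using r(3) n by linarith
    qed
    with m show "m \<in> {x..y} \<and> (\<forall>t\<in>{x..y}. f m \<le> f t)" by blast
  next
    assume min: "m \<in> {x..y} \<and> (\<forall>t\<in>{x..y}. f m \<le> f t)"
    then have m01: "m \<in> {0..1}" using xy by auto
    have "\<exists>r\<in>\<rat> \<inter> {0..1}. \<bar>r - m\<bar> < 1 / Suc n \<and> f r < f t + 1 / Suc n"
      if t: "x \<le> t" "t \<le> y" for t and n :: nat
    proof -
      obtain d where d: "0 < d" "\<And>r. r \<in> {0..1} \<Longrightarrow> \<bar>r - m\<bar> < d \<Longrightarrow> \<bar>f r - f m\<bar> < 1 / Suc n"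
        using continuous_on_unit_near[OF f m01, of "1 / Suc n"] by auto
      obtain r where r: "r \<in> \<rat> \<inter> {0..1}" "\<bar>r - m\<bar> < min d (1 / Suc n)"
        using Rats_dense_Icc[OF m01, of "min d (1 / Suc n)"] d(1) by auto
      have "f m \<le> f t" using min t by auto
      moreover have "\<bar>f r - f m\<bar> < 1 / Suc n" using d(2)[of r] r by auto
      ultimately show ?thesis using r by (intro bexI[of _ r]) auto
    qed
    then show "rational_min f x y m" using min by (simp add: rational_min_def)
  }
qed

text \<open>Points separated by two zeros of the path are incomparable, since the minimum between them is
  not unique.\<close>

lemma at_most_one_zero:
  assumes nonneg: "\<And>t. t \<in> {0..1} \<Longrightarrow> 0 \<le> f t"
    and comparable: "AE w in Leb \<Otimes>\<^sub>M Leb. fst w < snd w \<longrightarrow> (\<exists>m. min_position f (fst w) (snd w) m)"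
    and z: "0 < z" "z < z'" "z' < 1" "f z = 0" "f z' = 0"
  shows False
proof -
  have "AE w in Leb \<Otimes>\<^sub>M Leb. w \<notin> {0..z} \<times> {z'..1}"
    using comparable
  proof eventually_elim
    case (elim w)
    show ?case
    proof
      assume w: "w \<in> {0..z} \<times> {z'..1}"
      with elim z obtain m where m: "m \<in> {fst w..snd w}" "\<And>t. t \<in> {fst w..snd w} \<Longrightarrow> t \<noteq> m \<Longrightarrow> f m < f t"
        unfolding min_position_def by force
      have "0 \<le> f m" using m(1) w by (intro nonneg) auto
      \<comment> \<open>\<open>m\<close> differs from at least one of the two zeros, so its value
        would be negative.\<close>
      moreover have "f m < f z \<or> f m < f z'" using m(2)[of z] m(2)[of z'] w z by fastforce
      ultimately show False using z by auto
    qed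
  qed
  moreover have "{0..z} \<times> {z'..1} \<in> sets (Leb \<Otimes>\<^sub>M Leb)"
    using z by (intro pair_measureI Icc_sets_Leb) auto
  moreover have "Leb2.prob ({0..z} \<times> {z'..1}) = z * (1 - z')"
    using z by (simp add: Leb2.prob_Times measure_Leb_Icc)
  moreover have "Leb2.prob ({0..z} \<times> {z'..1}) = 0"
    by (subst Leb2.P.prob_eq_0) (fact calculation)+
  ultimately have "z * (1 - z') = 0" by simp
  with z show False by simp
qed

text \<open>The value at the left end \<open>x\<close> is below all values on \<open>[c, b]\<close>,
  so the minimum is attained before \<open>c\<close>, and moving the right end inside
  \<open>[c, b]\<close> does not affect it.\<close>

lemma rational_min_independent:
  assumes f: "continuous_on {0..1} f" and low: "\<And>t. t \<in> {c..b} \<Longrightarrow> f x < f t"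
    and "0 \<le> x" "x < c" "b \<le> 1" "y \<in> {c..b}" "z \<in> {c..b}"
  shows "rational_min f x y m \<longleftrightarrow> rational_min f x z m"
proof -
  have "rational_min f x v m" if min: "rational_min f x u m" and uv: "u \<in> {c..b}" "v \<in> {c..b}" for u v
  proof -
    have m: "m \<in> {x..u}" "\<And>t. t \<in> {x..u} \<Longrightarrow> f m \<le> f t"
      using min uv assms by (auto simp: rational_min_iff[OF f])
    have fx: "f m \<le> f x" using uv assms by (intro m(2)) auto
    have "m < c"
    proof (rule ccontr)
      assume "\<not> m < c"
      then have "f x < f m" using m(1) uv by (intro low) auto
      with fx show False by simp
    qed
    moreover have "f m \<le> f t" if t: "t \<in> {x..v}" for t
    proof (cases "t < c")
      case True
      then show ?thesis using t uv by (intro m(2)) auto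
    next
      case False
      then have "f x < f t" using t uv by (intro low) auto
      with fx show ?thesis by simp
    qed
    ultimately show ?thesis using m(1) uv assms by (auto simp: rational_min_iff[OF f])
  qed
  then show ?thesis using assms by blast
qed

text \<open>A measurable form of \<open>sup f [0, a] < inf f [c, b]\<close>.\<close>

definition low_start :: "(real \<Rightarrow> real) \<Rightarrow> real \<Rightarrow> real \<Rightarrow> real \<Rightarrow> bool" where
  "low_start f a c b \<longleftrightarrow> (\<exists>n::nat. \<forall>x\<in>\<rat> \<inter> {0..a}. \<forall>t\<in>\<rat> \<inter> {c..b}. f x + 1 / Suc n \<le> f t)"

lemma low_start_mono: "low_start f a c b \<Longrightarrow> a' \<le> a \<Longrightarrow> low_start f a' c b"
  unfolding low_start_def by (meson IntE IntI atLeastAtMost_iff order_trans)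

text \<open>The gap \<open>1 / Suc n\<close> is uniform over rational arguments and thus survives
  the passage to real ones as a strict inequality.\<close>

lemma low_startD:
  assumes f: "continuous_on {0..1} f" and "low_start f a c b"
    and ab: "0 < a" "a \<le> 1" "0 \<le> c" "c < b" "b \<le> 1" and x: "x \<in> {0..a}" and t: "t \<in> {c..b}"
  shows "f x < f t"
proof -
  obtain n :: nat where n: "\<And>x t. x \<in> \<rat> \<inter> {0..a} \<Longrightarrow> t \<in> \<rat> \<inter> {c..b} \<Longrightarrow> f x + 1 / Suc n \<le> f t"
    using assms(2) unfolding low_start_def by blast
  define \<eta> where "\<eta> = 1 / (2 * real (Suc n))"
  have \<eta>: "0 < \<eta>" "1 / Suc n = 2 * \<eta>" by (auto simp: \<eta>_def field_simps)
  have "x \<in> {0..1}" "t \<in> {0..1}" using x t ab by auto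
  obtain d where d: "0 < d" "\<And>r. r \<in> {0..1} \<Longrightarrow> \<bar>r - x\<bar> < d \<Longrightarrow> \<bar>f r - f x\<bar> < \<eta>"
    using continuous_on_unit_near[OF f \<open>x \<in> {0..1}\<close> \<eta>(1)] by blast
  obtain d' where d': "0 < d'" "\<And>r. r \<in> {0..1} \<Longrightarrow> \<bar>r - t\<bar> < d' \<Longrightarrow> \<bar>f r - f t\<bar> < \<eta>"
    using continuous_on_unit_near[OF f \<open>t \<in> {0..1}\<close> \<eta>(1)] by blast
  obtain r where r: "r \<in> \<rat> \<inter> {0..a}" "\<bar>r - x\<bar> < d" using Rats_dense_Icc[OF x ab(1) d(1)] by blast
  obtain s where s: "s \<in> \<rat> \<inter> {c..b}" "\<bar>s - t\<bar> < d'" using Rats_dense_Icc[OF t ab(4) d'(1)] by blast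
  have "\<bar>f r - f x\<bar> < \<eta>" "\<bar>f s - f t\<bar> < \<eta>" using d(2)[of r] d'(2)[of s] r s ab by auto
  with n[OF r(1) s(1)] \<eta> show ?thesis by linarith
qed

text \<open>On the compact interval \<open>[c, b]\<close> the path has a positive minimum, while
  near 0 it falls below half of that minimum.\<close>

lemma ex_low_start:
  assumes f: "continuous_on {0..1} f" "f 0 = 0" and cb: "0 \<le> c" "c < b" "b \<le> 1"
    and pos: "\<And>t. t \<in> {c..b} \<Longrightarrow> 0 < f t"
  shows "\<exists>k::nat. low_start f (1 / Suc k) c b"
proof -
  have "continuous_on {c..b} f" using cb by (intro continuous_on_subset[OF f(1)]) auto
  then obtain t0 where t0: "t0 \<in> {c..b}" "\<And>t. t \<in> {c..b} \<Longrightarrow> f t0 \<le> f t"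
    using continuous_attains_inf[of "{c..b}" f] cb by auto
  have \<eta>: "0 < f t0 / 2" using pos[OF t0(1)] by simp
  obtain d where d: "0 < d" "\<And>r. r \<in> {0..1} \<Longrightarrow> \<bar>r - 0\<bar> < d \<Longrightarrow> \<bar>f r - f 0\<bar> < f t0 / 2"
    using continuous_on_unit_near[OF f(1) _ \<eta>, of 0] by auto
  obtain k :: nat where k: "1 / Suc k < d" using nat_approx_posE[OF d(1)] by blast
  obtain n :: nat where n: "1 / Suc n < f t0 / 2" using nat_approx_posE[OF \<eta>] by blast
  have "f x + 1 / Suc n \<le> f t" if "x \<in> {0..1 / Suc k}" "t \<in> {c..b}" for x t
  proof -
    have x: "0 \<le> x" "x \<le> 1 / real (Suc k)" using that(1) by auto
    have "1 / real (Suc k) \<le> 1" by simp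
    with x(2) have "x \<le> 1" by (rule order_trans)
    moreover have "x < d" using x(2) k by (rule le_less_trans)
    ultimately have "f x < f t0 / 2" using d(2)[of x] x(1) f(2) by auto
    with t0(2)[OF that(2)] n show ?thesis by linarith
  qed
  then show ?thesis unfolding low_start_def by (intro exI[of _ k] exI[of _ n]) auto
qed

section \<open>The Brownian order\<close>

lemma ball_Rats_iff: "(\<forall>t\<in>\<rat> \<inter> A. P t) \<longleftrightarrow> (\<forall>q::rat. real_of_rat q \<in> A \<longrightarrow> P (real_of_rat q))"
  by (auto elim!: Rats_cases)

lemma bex_Rats_iff: "(\<exists>t\<in>\<rat> \<inter> A. P t) \<longleftrightarrow> (\<exists>q::rat. real_of_rat q \<in> A \<and> P (real_of_rat q))"
  by (auto elim!: Rats_cases)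

locale brownian_order = prob_space M for M :: "'a measure" +
  fixes p :: real and X :: "'a \<Rightarrow> (real \<times> real) measure" and e :: "real \<Rightarrow> 'a \<Rightarrow> real"
    and S :: "real \<Rightarrow> 'a \<Rightarrow> bool" and N :: "nat \<Rightarrow> 'a \<Rightarrow> real"
  assumes p_bounds: "0 \<le> p" "p \<le> 1"
    and X_measurable: "X \<in> M \<rightarrow>\<^sub>M permuton_space"
    and e_continuous: "\<And>\<omega>. \<omega> \<in> space M \<Longrightarrow> continuous_on {0..1} (\<lambda>t. e t \<omega>)"
    and e_0: "\<And>\<omega>. \<omega> \<in> space M \<Longrightarrow> e 0 \<omega> = 0"
    and e_nonneg: "\<And>\<omega> t. \<omega> \<in> space M \<Longrightarrow> t \<in> {0..1} \<Longrightarrow> 0 \<le> e t \<omega>"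
    and N_measurable: "\<And>k. N k \<in> borel_measurable (path_algebra M e)"
    and N_bij: "AE \<omega> in M. bij_betw (\<lambda>k. N k \<omega>) UNIV (local_minima (\<lambda>t. e t \<omega>))"
    and S_iid: "iid_signs M p (\<lambda>k \<omega>. S (N k \<omega>) \<omega>)"
    and eS: "independent_vars M (PiM {0..1} (\<lambda>_. borel)) (unit_path e)
        (PiM UNIV (\<lambda>_. count_space UNIV)) (\<lambda>\<omega> k. S (N k \<omega>) \<omega>)"
    and X_br: "AE \<omega> in M. X \<omega> = order_measure (br_prec (\<lambda>t. e t \<omega>) (\<lambda>m. S m \<omega>))"
begin

lemma unit_path_measurable: "unit_path e \<in> M \<rightarrow>\<^sub>M PiM {0..1} (\<lambda>_. borel)"
  using eS by (simp add: independent_vars_def)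

lemma unit_path_eq: "t \<in> {0..1} \<Longrightarrow> unit_path e \<omega> t = e t \<omega>"
  by (simp add: unit_path_def)

lemma unit_path_continuous: "\<omega> \<in> space M \<Longrightarrow> continuous_on {0..1} (unit_path e \<omega>)"
  using e_continuous by (rule continuous_on_cong[THEN iffD1, rotated 2]) (auto simp: unit_path_eq)

lemma path_value_measurable_path: "(\<lambda>\<omega>. unit_path e \<omega> t) \<in> borel_measurable (path_algebra M e)"
proof (cases "t \<in> {0..1}")
  case True
  have "unit_path e \<in> path_algebra M e \<rightarrow>\<^sub>M PiM {0..1} (\<lambda>_. borel)"
    unfolding path_algebra_def
    by (rule measurable_vimage_algebra1) (use measurable_space[OF unit_path_measurable] in auto)
  from measurable_compose[OF this measurable_component_singleton[OF True]] show ?thesis by simp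
next
  case False
  \<comment> \<open>Outside the unit interval the restricted path has the default value
    \<open>undefined\<close>, which does not depend on \<open>\<omega>\<close>.\<close>
  then have "(\<lambda>\<omega>. unit_path e \<omega> t) = (\<lambda>_. undefined)" unfolding unit_path_def by (simp only: restrict_def if_False)
  then show ?thesis by simp
qed

lemma subalgebra_path: "subalgebra M (path_algebra M e)"
  unfolding path_algebra_def by (rule subalgebra_vimage_algebra[OF unit_path_measurable])

lemma path_value_measurable [measurable]: "(\<lambda>\<omega>. unit_path e \<omega> t) \<in> borel_measurable M"
  by (rule measurable_from_subalg[OF subalgebra_path path_value_measurable_path])

text \<open>\<open>rational_min\<close> admits ties, but the strict minimum at \<open>m\<close>
  excludes every other position.\<close>

lemma branch_unique:
  assumes \<omega>: "\<omega> \<in> space M" and bij: "bij_betw (\<lambda>k. N k \<omega>) UNIV (local_minima (\<lambda>t. e t \<omega>))"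
    and xy: "x \<in> {0..1}" "y \<in> {0..1}" "x < y"
    and min: "m \<in> local_minima (\<lambda>t. e t \<omega>)" "min_position (\<lambda>t. e t \<omega>) x y m"
  shows "rational_min (unit_path e \<omega>) x y (N k \<omega>) \<longleftrightarrow> N k \<omega> = m"
proof -
  have "rational_min (unit_path e \<omega>) x y (N k \<omega>) \<longleftrightarrow>
      N k \<omega> \<in> {x..y} \<and> (\<forall>t\<in>{x..y}. unit_path e \<omega> (N k \<omega>) \<le> unit_path e \<omega> t)"
    using xy by (intro rational_min_iff unit_path_continuous \<omega>) auto
  also have "\<dots> \<longleftrightarrow> N k \<omega> \<in> {x..y} \<and> (\<forall>t\<in>{x..y}. e (N k \<omega>) \<omega> \<le> e t \<omega>)"
    using xy by (intro conj_cong refl ball_cong) (simp_all add: unit_path_eq)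
  also have "\<dots> \<longleftrightarrow> N k \<omega> = m"
    using min(2) unfolding min_position_def by (metis less_imp_le linorder_not_le order_refl)
  finally show ?thesis .
qed

text \<open>The branch points are numbered by \<open>N\<close>, a function of the path, so the signs
  \<open>S (N k \<omega>) \<omega>\<close> are i.i.d. and independent of the environment. For a
  comparable pair, the candidates are exactly the numbers of its unique minimum.\<close>

sublocale random_signed_order M p "path_algebra M e" "\<lambda>k \<omega>. S (N k \<omega>) \<omega>" X
  "\<lambda>\<omega>. br_prec (\<lambda>t. e t \<omega>) (\<lambda>m. S m \<omega>)" "\<lambda>k \<omega> x y. rational_min (unit_path e \<omega>) x y (N k \<omega>)" N
proof
  show "0 \<le> p" "p \<le> 1" "iid_signs M p (\<lambda>k \<omega>. S (N k \<omega>) \<omega>)" "X \<in> M \<rightarrow>\<^sub>M permuton_space"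
    "subalgebra M (path_algebra M e)"
    by (rule p_bounds S_iid X_measurable subalgebra_path)+
  show "indep_set (sets (path_algebra M e))
      (sets (vimage_algebra (space M) (\<lambda>\<omega> k. S (N k \<omega>) \<omega>) (PiM UNIV (\<lambda>_. count_space UNIV))))"
    using eS by (simp add: independent_vars_def path_algebra_def)
  show "AE \<omega> in M. X \<omega> = order_measure (br_prec (\<lambda>t. e t \<omega>) (\<lambda>m. S m \<omega>)) \<and>
      measurable_order (br_prec (\<lambda>t. e t \<omega>) (\<lambda>m. S m \<omega>))"
    using X_br N_bij
  proof eventually_elim
    case (elim \<omega>)
    then have "local_minima (\<lambda>t. e t \<omega>) = range (\<lambda>k. N k \<omega>)" by (simp add: bij_betw_def)
    then have "countable (local_minima (\<lambda>t. e t \<omega>))" by simp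
    with elim measurable_order_br_prec show ?case by blast
  qed
  show "AE \<omega> in M. \<forall>x\<in>{0..1}. \<forall>y\<in>{0..1}. x < y \<longrightarrow>
      br_prec (\<lambda>t. e t \<omega>) (\<lambda>m. S m \<omega>) x y \<or> br_prec (\<lambda>t. e t \<omega>) (\<lambda>m. S m \<omega>) y x \<longrightarrow>
      (\<exists>k. rational_min (unit_path e \<omega>) x y (N k \<omega>)) \<and>
      (br_prec (\<lambda>t. e t \<omega>) (\<lambda>m. S m \<omega>) x y \<longleftrightarrow>
        S (N (LEAST k. rational_min (unit_path e \<omega>) x y (N k \<omega>)) \<omega>) \<omega>)"
    using N_bij AE_space
  proof eventually_elim
    case (elim \<omega>)
    show ?case
    proof (intro ballI impI)
      fix x y :: real assume xy: "x \<in> {0..1}" "y \<in> {0..1}" "x < y"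
        and "br_prec (\<lambda>t. e t \<omega>) (\<lambda>m. S m \<omega>) x y \<or> br_prec (\<lambda>t. e t \<omega>) (\<lambda>m. S m \<omega>) y x"
      then obtain m where m: "m \<in> local_minima (\<lambda>t. e t \<omega>)" "min_position (\<lambda>t. e t \<omega>) x y m"
        by (auto simp: br_prec_def)
      have prec: "br_prec (\<lambda>t. e t \<omega>) (\<lambda>m. S m \<omega>) x y \<longleftrightarrow> S m \<omega>"
        using m xy(3) min_position_unique[OF m(2)] unfolding br_prec_def by (metis less_asym)
      note iff = branch_unique[OF elim(2,1) xy m]
      have "m \<in> range (\<lambda>k. N k \<omega>)" using m(1) elim(1) by (simp add: bij_betw_def)
      then have ex: "\<exists>k. N k \<omega> = m" by blast
      from LeastI_ex[OF ex] show "(\<exists>k. rational_min (unit_path e \<omega>) x y (N k \<omega>)) \<and>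
        (br_prec (\<lambda>t. e t \<omega>) (\<lambda>m. S m \<omega>) x y \<longleftrightarrow>
          S (N (LEAST k. rational_min (unit_path e \<omega>) x y (N k \<omega>)) \<omega>) \<omega>)"
        unfolding iff prec using ex by simp
    qed
  qed
  show "N k \<omega> \<in> {x..y}" if "rational_min (unit_path e \<omega>) x y (N k \<omega>)" for k \<omega> x y
    using that by (simp add: rational_min_def)
  show "Measurable.pred (path_algebra M e \<Otimes>\<^sub>M (borel \<Otimes>\<^sub>M borel))
      (\<lambda>v. rational_min (unit_path e (fst v)) (fst (snd v)) (snd (snd v)) (N k (fst v)))" for k
  proof -
    have [measurable]: "(\<lambda>v. unit_path e (fst v) t) \<in> borel_measurable (path_algebra M e \<Otimes>\<^sub>M (borel \<Otimes>\<^sub>M borel))"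
      "(\<lambda>v. N k (fst v)) \<in> borel_measurable (path_algebra M e \<Otimes>\<^sub>M (borel \<Otimes>\<^sub>M borel))" for t
      by (rule measurable_compose[OF measurable_fst path_value_measurable_path],
          rule measurable_compose[OF measurable_fst N_measurable])
    show ?thesis
      unfolding rational_min_def ball_Rats_iff bex_Rats_iff atLeastAtMost_iff[of "N k _"]
      by measurable
  qed
qed

lemma low_start_measurable [measurable]: "Measurable.pred M (\<lambda>\<omega>. low_start (unit_path e \<omega>) a c b)"
  unfolding low_start_def ball_Rats_iff by measurable

text \<open>\<open>X\<close> takes permutons as values, which makes almost all pairs comparable;
  \<open>at_most_one_zero\<close> then applies path by path.\<close>

lemma AE_at_most_one_zero:
  "AE \<omega> in M. \<forall>z z'. 0 < z \<longrightarrow> z < z' \<longrightarrow> z' < 1 \<longrightarrow> e z \<omega> = 0 \<longrightarrow> e z' \<omega> \<noteq> 0"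
  using X_eq AE_space
proof eventually_elim
  case (elim \<omega>)
  then interpret measurable_order "br_prec (\<lambda>t. e t \<omega>) (\<lambda>m. S m \<omega>)" by simp
  have "permuton (order_measure (br_prec (\<lambda>t. e t \<omega>) (\<lambda>m. S m \<omega>)))"
    using measurable_space[OF X_measurable, of \<omega>] elim by (simp add: space_permuton_space)
  from AE_comparable[OF this]
  have "AE w in Leb \<Otimes>\<^sub>M Leb. fst w < snd w \<longrightarrow> (\<exists>m. min_position (\<lambda>t. e t \<omega>) (fst w) (snd w) m)"
    by eventually_elim (auto simp: br_prec_def)
  from at_most_one_zero[OF e_nonneg[OF elim(2)] this] show ?case by blast
qed

text \<open>Positivity on \<open>[c, b]\<close> (see \<open>no_zero_iff\<close>), written as a
  countable union of \<open>low_start\<close> events: this is measurable, and it is the limit needed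
  when \<open>a\<close> is chosen.\<close>

definition no_zero :: "real \<Rightarrow> real \<Rightarrow> 'a \<Rightarrow> bool" where
  "no_zero c b \<omega> \<longleftrightarrow> (\<exists>k::nat. low_start (unit_path e \<omega>) (1 / Suc k) c b)"

lemma no_zero_measurable [measurable]: "Measurable.pred M (no_zero c b)"
  unfolding no_zero_def by measurable

lemma no_zero_iff:
  assumes \<omega>: "\<omega> \<in> space M" and "0 \<le> c" "c < b" "b \<le> 1"
  shows "no_zero c b \<omega> \<longleftrightarrow> (\<forall>t\<in>{c..b}. 0 < e t \<omega>)"
proof
  assume "no_zero c b \<omega>"
  then obtain k :: nat where k: "low_start (unit_path e \<omega>) (1 / Suc k) c b" by (auto simp: no_zero_def)
  show "\<forall>t\<in>{c..b}. 0 < e t \<omega>"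
  proof
    fix t assume t: "t \<in> {c..b}"
    have "unit_path e \<omega> 0 < unit_path e \<omega> t"
      using t assms by (intro low_startD[OF unit_path_continuous[OF \<omega>] k]) auto
    then show "0 < e t \<omega>" using t assms by (simp add: unit_path_eq e_0)
  qed
next
  assume "\<forall>t\<in>{c..b}. 0 < e t \<omega>"
  then show "no_zero c b \<omega>"
    unfolding no_zero_def using assms
    by (intro ex_low_start unit_path_continuous) (auto simp: unit_path_eq e_0)
qed

text \<open>Zeros in every interval \<open>(0, 1 / (i + 2)]\<close> would give two zeros in
  \<open>(0, 1)\<close>, which has probability 0. Continuity from above along \<open>E\<close>
  provides one \<open>b\<close> that serves all \<open>c\<close> at once.\<close>

lemma ex_no_zero_near_0:
  assumes "0 < \<epsilon>"
  shows "\<exists>b>0. b \<le> 1 \<and> (\<forall>c. 0 < c \<longrightarrow> c < b \<longrightarrow> prob {\<omega> \<in> space M. \<not> no_zero c b \<omega>} \<le> \<epsilon>)"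
proof -
  \<comment> \<open>The shift by 2 keeps the zeros in \<open>(0, 1/2]\<close>, away from the zero at
    time 1. Letting \<open>j\<close> grow moves the left end to 0 through countably many
    events.\<close>
  define E where "E i = {\<omega> \<in> space M. \<exists>j>i. \<not> no_zero (1 / (real j + 2)) (1 / (real i + 2)) \<omega>}" for i :: nat
  have E [measurable]: "E i \<in> events" for i unfolding E_def by measurable
  have E_iff: "\<omega> \<in> E i \<longleftrightarrow> (\<exists>t. 0 < t \<and> t \<le> 1 / (real i + 2) \<and> e t \<omega> = 0)" if \<omega>: "\<omega> \<in> space M" for \<omega> i
  proof
    assume "\<omega> \<in> E i"
    then obtain j where j: "j > i" "\<not> no_zero (1 / (real j + 2)) (1 / (real i + 2)) \<omega>" by (auto simp: E_def)
    then obtain t where t: "1 / (real j + 2) \<le> t" "t \<le> 1 / (real i + 2)" "\<not> 0 < e t \<omega>"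
      using \<omega> by (subst (asm) no_zero_iff) (auto simp: field_simps)
    moreover have "0 < t" using t(1) by (rule less_le_trans[rotated]) simp
    moreover have "t \<le> 1" using t(2) by (rule order_trans) (simp add: field_simps)
    ultimately show "\<exists>t. 0 < t \<and> t \<le> 1 / (real i + 2) \<and> e t \<omega> = 0"
      using e_nonneg[OF \<omega>, of t] by (intro exI[of _ t]) auto
  next
    assume "\<exists>t. 0 < t \<and> t \<le> 1 / (real i + 2) \<and> e t \<omega> = 0"
    then obtain t where t: "0 < t" "t \<le> 1 / (real i + 2)" "e t \<omega> = 0" by blast
    obtain n :: nat where n: "1 / Suc n < t" using nat_approx_posE[OF t(1)] by blast
    define j where "j = max n (Suc i)"
    have "1 / (real j + 2) \<le> 1 / Suc n" unfolding j_def by (intro divide_left_mono) auto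
    then have "1 / (real j + 2) \<le> t" using n by linarith
    moreover have "j > i" by (simp add: j_def)
    moreover have "1 / (real i + 2) \<le> 1" by (simp add: field_simps)
    moreover have "1 / (real j + 2) < 1 / (real i + 2)"
      using \<open>j > i\<close> by (intro divide_strict_left_mono) auto
    ultimately have "\<not> no_zero (1 / (real j + 2)) (1 / (real i + 2)) \<omega>"
      using t by (subst no_zero_iff[OF \<omega>]) (auto intro!: bexI[of _ t])
    with \<open>j > i\<close> show "\<omega> \<in> E i" using \<omega> by (auto simp: E_def)
  qed
  have "decseq E"
  proof (rule decseq_SucI, rule subsetI)
    fix i \<omega> assume \<omega>: "\<omega> \<in> E (Suc i)"
    then have sp: "\<omega> \<in> space M" by (simp add: E_def)
    have "1 / (real (Suc i) + 2) \<le> 1 / (real i + 2)" by (intro divide_left_mono) auto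
    then show "\<omega> \<in> E i" using \<omega> unfolding E_iff[OF sp] by (meson order_trans)
  qed
  then have lim: "(\<lambda>i. prob (E i)) \<longlonglongrightarrow> prob (\<Inter>i. E i)"
    by (intro finite_Lim_measure_decseq) auto
  have "AE \<omega> in M. \<omega> \<notin> (\<Inter>i. E i)"
    using AE_at_most_one_zero AE_space
  proof eventually_elim
    case (elim \<omega>)
    show ?case
    proof
      assume all: "\<omega> \<in> (\<Inter>i. E i)"
      obtain z where z: "0 < z" "z \<le> 1 / (real 0 + 2)" "e z \<omega> = 0" using all E_iff[OF elim(2), of 0] by auto
      obtain n :: nat where n: "1 / Suc n < z" using nat_approx_posE[OF z(1)] by blast
      obtain y where y: "0 < y" "y \<le> 1 / (real n + 2)" "e y \<omega> = 0" using all E_iff[OF elim(2), of n] by auto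
      have "1 / (real n + 2) \<le> 1 / Suc n" by (intro divide_left_mono) auto
      then have "y < z" using y n by linarith
      moreover have "z < 1" using z(2) by simp
      ultimately show False using elim(1) y z by blast
    qed
  qed
  then have "prob (\<Inter>i. E i) = 0" by (subst prob_eq_0) auto
  with lim assms have "eventually (\<lambda>i. prob (E i) < \<epsilon>) sequentially" by (intro order_tendstoD(2)) auto
  then obtain i where i: "prob (E i) < \<epsilon>" by (auto simp: eventually_sequentially)
  show ?thesis
  proof (intro exI[of _ "1 / (real i + 2)"] conjI allI impI)
    fix c assume c: "0 < c" "c < 1 / (real i + 2)"
    have "prob {\<omega> \<in> space M. \<not> no_zero c (1 / (real i + 2)) \<omega>} \<le> prob (E i)"
    proof (rule finite_measure_mono[OF subsetI E])
      fix \<omega> assume "\<omega> \<in> {\<omega> \<in> space M. \<not> no_zero c (1 / (real i + 2)) \<omega>}"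
      then have \<omega>: "\<omega> \<in> space M" "\<not> no_zero c (1 / (real i + 2)) \<omega>" by auto
      have "1 / (real i + 2) \<le> 1" by (simp add: field_simps)
      with \<omega> c obtain t where "c \<le> t" "t \<le> 1 / (real i + 2)" "\<not> 0 < e t \<omega>"
        by (subst (asm) no_zero_iff) auto
      then show "\<omega> \<in> E i"
        using e_nonneg[OF \<omega>(1), of t] c \<open>1 / (real i + 2) \<le> 1\<close> unfolding E_iff[OF \<omega>(1)]
        by (intro exI[of _ t]) auto
    qed
    with i show "prob {\<omega> \<in> space M. \<not> no_zero c (1 / (real i + 2)) \<omega>} \<le> \<epsilon>" by simp
  qed (auto simp: field_simps)
qed

text \<open>As \<open>a = 1 / Suc k\<close> shrinks, the complements of the \<open>low_start\<close>
  events decrease to the complement of \<open>no_zero c b\<close>; the factor 2 leaves room for the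
  limit.\<close>

lemma ex_low_start_prob:
  assumes "0 < \<epsilon>" and no_zero: "prob {\<omega> \<in> space M. \<not> no_zero c b \<omega>} \<le> \<epsilon>"
  shows "\<exists>a0>0. \<forall>a\<le>a0. prob {\<omega> \<in> space M. \<not> low_start (unit_path e \<omega>) a c b} \<le> 2 * \<epsilon>"
proof -
  define L where "L k = {\<omega> \<in> space M. \<not> low_start (unit_path e \<omega>) (1 / Suc k) c b}" for k :: nat
  have L [measurable]: "L k \<in> events" for k unfolding L_def by measurable
  have "decseq L"
    unfolding L_def
    by (rule decseq_SucI) (auto intro: low_start_mono simp: field_simps)
  then have "(\<lambda>k. prob (L k)) \<longlonglongrightarrow> prob (\<Inter>k. L k)" by (intro finite_Lim_measure_decseq) auto
  moreover have "(\<Inter>k. L k) = {\<omega> \<in> space M. \<not> no_zero c b \<omega>}" by (auto simp: L_def no_zero_def)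
  ultimately have "eventually (\<lambda>k. prob (L k) < 2 * \<epsilon>) sequentially"
    using assms by (intro order_tendstoD(2)) auto
  then obtain k where k: "prob (L k) < 2 * \<epsilon>" by (auto simp: eventually_sequentially)
  have "prob {\<omega> \<in> space M. \<not> low_start (unit_path e \<omega>) a c b} \<le> prob (L k)" if "a \<le> 1 / Suc k" for a
    using that by (intro finite_measure_mono L) (auto simp: L_def intro: low_start_mono)
  with k show ?thesis by (intro exI[of _ "1 / Suc k"]) force
qed

end

section \<open>Mutual singularity\<close>

lemma singular_distrI:
  assumes "prob_space M\<^sub>1" "prob_space M\<^sub>2"
    and X [measurable]: "X\<^sub>1 \<in> M\<^sub>1 \<rightarrow>\<^sub>M K" "X\<^sub>2 \<in> M\<^sub>2 \<rightarrow>\<^sub>M K"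
    and approx: "\<And>\<tau>. 0 < \<tau> \<Longrightarrow> \<exists>P. Measurable.pred K P \<and>
      measure M\<^sub>1 {\<omega> \<in> space M\<^sub>1. \<not> P (X\<^sub>1 \<omega>)} \<le> \<tau> \<and> measure M\<^sub>2 {\<omega> \<in> space M\<^sub>2. P (X\<^sub>2 \<omega>)} \<le> \<tau>"
  shows "singular (distr M\<^sub>1 K X\<^sub>1) (distr M\<^sub>2 K X\<^sub>2)"
proof (rule singularI_approx)
  show "prob_space (distr M\<^sub>1 K X\<^sub>1)" "prob_space (distr M\<^sub>2 K X\<^sub>2)"
    using assms by (auto intro: prob_space.prob_space_distr)
  fix \<tau> :: real assume "0 < \<tau>"
  then obtain P where P [measurable]: "Measurable.pred K P"
    and le: "measure M\<^sub>1 {\<omega> \<in> space M\<^sub>1. \<not> P (X\<^sub>1 \<omega>)} \<le> \<tau>" "measure M\<^sub>2 {\<omega> \<in> space M\<^sub>2. P (X\<^sub>2 \<omega>)} \<le> \<tau>"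
    using approx by blast
  have "measure (distr M\<^sub>1 K X\<^sub>1) (space (distr M\<^sub>1 K X\<^sub>1) - {x \<in> space K. P x}) =
      measure M\<^sub>1 {\<omega> \<in> space M\<^sub>1. \<not> P (X\<^sub>1 \<omega>)}"
    by (subst measure_distr)
      (auto intro!: arg_cong[where f="measure M\<^sub>1"] dest: measurable_space[OF X(1)])
  moreover have "measure (distr M\<^sub>2 K X\<^sub>2) {x \<in> space K. P x} = measure M\<^sub>2 {\<omega> \<in> space M\<^sub>2. P (X\<^sub>2 \<omega>)}"
    by (subst measure_distr)
      (auto intro!: arg_cong[where f="measure M\<^sub>2"] dest: measurable_space[OF X(2)])
  ultimately show "\<exists>A\<in>sets (distr M\<^sub>1 K X\<^sub>1). measure (distr M\<^sub>1 K X\<^sub>1) (space (distr M\<^sub>1 K X\<^sub>1) - A) \<le> \<tau> \<and>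
      measure (distr M\<^sub>2 K X\<^sub>2) A \<le> \<tau>"
    using le by (intro bexI[of _ "{x \<in> space K. P x}"]) auto
qed simp

text \<open>Any concrete scales serve when the parameters differ, since the mean is then exact at
  each of them. \<open>b_Suc\<close> reads 1/64 < 1/32 after scaling.\<close>

interpretation geometric: scales "\<lambda>n. (1/64)^n / 16" "\<lambda>n. (1/64)^n" "\<lambda>n. (1/64)^n / 8"
  by unfold_locales auto

text \<open>\<open>G a b = a\<close> has probability exactly the parameter at every branch point of
  either model, so the defect \<open>\<delta>\<close> is 0 and only the term \<open>1 / K\<close>
  remains.\<close>

lemma singular_if_parameters_differ:
  assumes "random_signed_order M\<^sub>1 p F\<^sub>1 T\<^sub>1 X\<^sub>1 prec\<^sub>1 Q\<^sub>1 N\<^sub>1"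
    and "random_signed_order M\<^sub>2 q F\<^sub>2 T\<^sub>2 X\<^sub>2 prec\<^sub>2 Q\<^sub>2 N\<^sub>2"
    and "p \<noteq> q"
  shows "singular (distr M\<^sub>1 permuton_space X\<^sub>1) (distr M\<^sub>2 permuton_space X\<^sub>2)"
proof -
  interpret R1: random_signed_order M\<^sub>1 p F\<^sub>1 T\<^sub>1 X\<^sub>1 prec\<^sub>1 Q\<^sub>1 N\<^sub>1 by fact
  interpret R2: random_signed_order M\<^sub>2 q F\<^sub>2 T\<^sub>2 X\<^sub>2 prec\<^sub>2 Q\<^sub>2 N\<^sub>2 by fact
  interpret S1: random_signed_order_scales M\<^sub>1 p F\<^sub>1 T\<^sub>1 X\<^sub>1 prec\<^sub>1 Q\<^sub>1 N\<^sub>1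
    "\<lambda>n. (1/64)^n / 16" "\<lambda>n. (1/64)^n" "\<lambda>n. (1/64)^n / 8" ..
  interpret S2: random_signed_order_scales M\<^sub>2 q F\<^sub>2 T\<^sub>2 X\<^sub>2 prec\<^sub>2 Q\<^sub>2 N\<^sub>2
    "\<lambda>n. (1/64)^n / 16" "\<lambda>n. (1/64)^n" "\<lambda>n. (1/64)^n / 8" ..
  \<comment> \<open>Half the distance of the parameters: the open intervals of radius
    \<open>r\<close> around \<open>p\<close> and \<open>q\<close> are disjoint.\<close>
  define r where "r = \<bar>p - q\<bar> / 2"
  have r: "0 < r" using \<open>p \<noteq> q\<close> by (simp add: r_def)
  have far: "r \<le> \<bar>v - q\<bar>" if "\<bar>v - p\<bar> < r" for v
    using that abs_triangle_ineq[of "p - v" "v - q"] abs_minus_commute[of p v] by (simp add: r_def)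
  let ?avg = "\<lambda>K \<mu>. (\<Sum>n<K. geometric.stat (\<lambda>a b. a) n \<mu>) / real K"
  show ?thesis
  proof (rule singular_distrI)
    fix \<tau> :: real assume \<tau>: "0 < \<tau>"
    obtain K :: nat where K: "0 < K" "1 / real K < \<tau> * r\<^sup>2"
      using nat_approx_posE[of "\<tau> * r\<^sup>2"] \<tau> r by (metis mult_pos_pos zero_less_Suc zero_less_power)
    then have bound: "(1 / real K + 2 * d * 0) / r\<^sup>2 \<le> \<tau>" for d
      using r by (simp add: field_simps)
    have mean1: "p \<le> R1.prob {\<omega> \<in> space M\<^sub>1. R1.pattern (\<lambda>a b. a) \<omega> z}" for z
      using S1.pattern_prob_lower[of UNIV p "\<lambda>a b. a" "fst z" "fst (snd z)" "snd (snd z)"] R1.p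
      by (simp add: R1.pattern_prob_fst R1.prob_space)
    have mean2: "q \<le> R2.prob {\<omega> \<in> space M\<^sub>2. R2.pattern (\<lambda>a b. a) \<omega> z}" for z
      using S2.pattern_prob_lower[of UNIV q "\<lambda>a b. a" "fst z" "fst (snd z)" "snd (snd z)"] R2.p
      by (simp add: R2.pattern_prob_fst R2.prob_space)
    have dev1: "R1.prob {\<omega> \<in> space M\<^sub>1. r \<le> \<bar>?avg K (X\<^sub>1 \<omega>) - p\<bar>} \<le> \<tau>"
      using S1.stat_deviation[of "\<lambda>a b. a" p 0 K r] K r mean1 bound[of p]
      by (auto simp: R1.pattern_prob_fst)
    have dev2: "R2.prob {\<omega> \<in> space M\<^sub>2. r \<le> \<bar>?avg K (X\<^sub>2 \<omega>) - q\<bar>} \<le> \<tau>"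
      using S2.stat_deviation[of "\<lambda>a b. a" q 0 K r] K r mean2 bound[of q]
      by (auto simp: R2.pattern_prob_fst)
    have [measurable]: "(\<lambda>\<omega>. geometric.stat (\<lambda>a b. a) n (X\<^sub>2 \<omega>)) \<in> borel_measurable M\<^sub>2" for n
      by (rule measurable_compose[OF R2.X geometric.measurable_stat])
    have "R2.prob {\<omega> \<in> space M\<^sub>2. \<bar>?avg K (X\<^sub>2 \<omega>) - p\<bar> < r} \<le>
        R2.prob {\<omega> \<in> space M\<^sub>2. r \<le> \<bar>?avg K (X\<^sub>2 \<omega>) - q\<bar>}"
      by (rule R2.finite_measure_mono) (auto intro: far)
    with dev1 dev2 show "\<exists>P. Measurable.pred permuton_space P \<and>
        R1.prob {\<omega> \<in> space M\<^sub>1. \<not> P (X\<^sub>1 \<omega>)} \<le> \<tau> \<and> R2.prob {\<omega> \<in> space M\<^sub>2. P (X\<^sub>2 \<omega>)} \<le> \<tau>"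
      by (intro exI[of _ "\<lambda>\<mu>. \<bar>?avg K \<mu> - p\<bar> < r"]) (auto simp: not_less)
  qed (fact R1.prob_space_axioms R2.prob_space_axioms R1.X R2.X)+
qed

text \<open>Built downwards: \<open>b n\<close> fixes \<open>c n = \<delta> * b n / 8\<close>; then
  \<open>a n\<close> is so small that with high probability the path up to \<open>a n\<close> stays
  below its values on \<open>[c n, b n]\<close>; then \<open>b (Suc n)\<close> is a quarter of
  \<open>a n\<close>. One \<open>b0\<close> serves all scales, as positivity on
  \<open>[c, b0]\<close> implies positivity on \<open>[c, \<beta>]\<close> for smaller
  \<open>\<beta>\<close>.\<close>

lemma (in brownian_order) ex_scales:
  assumes "0 < \<epsilon>" "0 < \<delta>" "\<delta> \<le> 1"
  shows "\<exists>a b c. scales a b c \<and> (\<forall>n. 4 * c n \<le> \<delta> * b n) \<and>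
    (\<forall>n. prob {\<omega> \<in> space M. \<not> low_start (unit_path e \<omega>) (a n) (c n) (b n)} \<le> 2 * \<epsilon>)"
proof -
  obtain b0 where b0: "0 < b0" "b0 \<le> 1"
    and nz: "\<And>c. 0 < c \<Longrightarrow> c < b0 \<Longrightarrow> prob {\<omega> \<in> space M. \<not> no_zero c b0 \<omega>} \<le> \<epsilon>"
    using ex_no_zero_near_0[OF assms(1)] by blast
  have \<delta>_mult: "0 < \<delta> * \<beta>" "\<delta> * \<beta> \<le> \<beta>" if "0 < \<beta>" for \<beta>
    using that assms mult_right_mono[of \<delta> 1 \<beta>] by auto
  have "\<exists>a0. 0 < a0 \<and> (\<forall>a\<le>a0. prob {\<omega> \<in> space M. \<not> low_start (unit_path e \<omega>) a (\<delta> * \<beta> / 8) \<beta>} \<le> 2 * \<epsilon>)"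
    if \<beta>: "0 < \<beta>" "\<beta> \<le> b0" for \<beta>
  proof -
    have c: "0 < \<delta> * \<beta> / 8" "\<delta> * \<beta> / 8 < \<beta>"
      using \<beta> \<delta>_mult[of \<beta>] by linarith+
    have "prob {\<omega> \<in> space M. \<not> no_zero (\<delta> * \<beta> / 8) \<beta> \<omega>} \<le> prob {\<omega> \<in> space M. \<not> no_zero (\<delta> * \<beta> / 8) b0 \<omega>}"
      using \<beta> c b0 by (intro finite_measure_mono) (auto simp: no_zero_iff)
    also have "\<dots> \<le> \<epsilon>" using \<beta> c by (intro nz) auto
    finally show ?thesis using ex_low_start_prob[OF assms(1)] by blast
  qed
  then have "\<forall>\<beta>. \<exists>a0. 0 < \<beta> \<and> \<beta> \<le> b0 \<longrightarrow> 0 < a0 \<and>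
      (\<forall>a\<le>a0. prob {\<omega> \<in> space M. \<not> low_start (unit_path e \<omega>) a (\<delta> * \<beta> / 8) \<beta>} \<le> 2 * \<epsilon>)"
    by blast
  from choice[OF this] obtain a0 where "\<And>\<beta>. 0 < \<beta> \<and> \<beta> \<le> b0 \<longrightarrow> 0 < a0 \<beta> \<and>
      (\<forall>a\<le>a0 \<beta>. prob {\<omega> \<in> space M. \<not> low_start (unit_path e \<omega>) a (\<delta> * \<beta> / 8) \<beta>} \<le> 2 * \<epsilon>)"
    by blast
  then have a0: "\<And>\<beta>. 0 < \<beta> \<Longrightarrow> \<beta> \<le> b0 \<Longrightarrow> 0 < a0 \<beta>"
    "\<And>\<beta> a. 0 < \<beta> \<Longrightarrow> \<beta> \<le> b0 \<Longrightarrow> a \<le> a0 \<beta> \<Longrightarrow>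
      prob {\<omega> \<in> space M. \<not> low_start (unit_path e \<omega>) a (\<delta> * \<beta> / 8) \<beta>} \<le> 2 * \<epsilon>"
    by simp_all
  \<comment> \<open>The second term keeps \<open>a n\<close> below \<open>c n\<close>, the first
    secures the low start.\<close>
  define \<alpha> where "\<alpha> \<beta> = min (a0 \<beta>) (\<delta> * \<beta> / 16)" for \<beta>
  define b where "b = rec_nat b0 (\<lambda>_ \<beta>. \<alpha> \<beta> / 4)"
  have b_simps: "b 0 = b0" "b (Suc n) = \<alpha> (b n) / 4" for n by (simp_all add: b_def)
  have \<alpha>: "0 < \<alpha> \<beta>" "\<alpha> \<beta> < \<delta> * \<beta> / 8" "\<alpha> \<beta> < \<beta>" if "0 < \<beta>" "\<beta> \<le> b0" for \<beta>
    using that a0(1)[of \<beta>] \<delta>_mult[of \<beta>] unfolding \<alpha>_def by linarith+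
  have b: "0 < b n \<and> b n \<le> b0" for n
  proof (induction n)
    case (Suc n)
    then show ?case using \<alpha>[of "b n"] by (auto simp: b_simps)
  qed (simp add: b_simps b0)
  show ?thesis
  proof (intro exI conjI allI)
    show "scales (\<lambda>n. \<alpha> (b n)) b (\<lambda>n. \<delta> * b n / 8)"
    proof
      fix n
      show "0 < \<alpha> (b n)" "\<alpha> (b n) < \<delta> * b n / 8" "b (Suc n) < \<alpha> (b n) / 2"
        using \<alpha>[of "b n"] b[of n] by (auto simp: b_simps)
      show "2 * (\<delta> * b n / 8) < b n / 2"
        using \<delta>_mult[of "b n"] b[of n] by linarith
      show "b 0 \<le> 1" by (simp add: b_simps b0)
    qed
    show "4 * (\<delta> * b n / 8) \<le> \<delta> * b n" for n using \<delta>_mult[of "b n"] b[of n] by linarith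
    show "prob {\<omega> \<in> space M. \<not> low_start (unit_path e \<omega>) (\<alpha> (b n)) (\<delta> * b n / 8) (b n)} \<le> 2 * \<epsilon>" for n
      using b[of n] by (intro a0(2)) (auto simp: \<alpha>_def)
  qed
qed

text \<open>In the Brownian model the deviation bound applies to \<open>(=)\<close>, whose mean is
  close to its maximum 1. This lemma carries it over to \<open>(\<noteq>)\<close>, the test common
  to both models.\<close>

lemma (in random_signed_order_scales) AE_stat_compl:
  "AE \<omega> in M. stat (=) n (X \<omega>) = 1 - stat (\<noteq>) n (X \<omega>)"
  using AE_stat[of "(=)" n] AE_stat[of "(\<noteq>)" n] AE_space
proof eventually_elim
  case (elim \<omega>)
  interpret box: prob_space "box n" by (rule prob_space_box)
  have [measurable]: "\<omega> \<in> space M" by fact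
  have "{z \<in> space Leb3. pattern (=) \<omega> z} = space (box n) - {z \<in> space Leb3. pattern (\<noteq>) \<omega> z}"
    by (auto simp: pattern_def)
  moreover have "{z \<in> space Leb3. pattern (\<noteq>) \<omega> z} \<in> sets (box n)" by measurable
  ultimately have "W (=) n \<omega> = 1 - W (\<noteq>) n \<omega>"
    unfolding W_def by (simp only: box.prob_compl)
  with elim show ?case by simp
qed

text \<open>The averaged \<open>(\<noteq>)\<close> statistic is close to
  \<open>d = 2 * p * (1 - p)\<close> in the recursive model and close to 0 in the Brownian one; the
  threshold \<open>d / 2\<close> separates them.\<close>

lemma singular_recursive_brownian:
  assumes "recursive_order M\<^sub>1 p X\<^sub>1 U S\<^sub>1" and "brownian_order M\<^sub>2 p X\<^sub>2 e S\<^sub>2 N" and p: "p \<in> {0<..<1}"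
  shows "singular (distr M\<^sub>1 permuton_space X\<^sub>1) (distr M\<^sub>2 permuton_space X\<^sub>2)"
proof -
  interpret R: recursive_order M\<^sub>1 p X\<^sub>1 U S\<^sub>1 by fact
  interpret B: brownian_order M\<^sub>2 p X\<^sub>2 e S\<^sub>2 N by fact
  define d where "d = 2 * p * (1 - p)"
  have d: "0 < d" "d \<le> 1"
    using p sum_squares_bound[of p "1 - p"] by (auto simp: d_def power2_eq_square algebra_simps)
  show ?thesis
  proof (rule singular_distrI)
    fix \<tau> :: real assume \<tau>: "0 < \<tau>"
    define r where "r = d / 2"
    \<comment> \<open>The 8 comes from the Brownian side: the defect \<open>2 * \<delta>\<close>
      with maximal probability 1 contributes \<open>4 * \<delta>\<close>, at most
      \<open>\<tau> * r\<^sup>2 / 2\<close>. The other half is left for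
      \<open>1 / K\<close>.\<close>
    define \<delta> where "\<delta> = min 1 (\<tau> * r\<^sup>2 / 8)"
    have r: "0 < r" using d by (simp add: r_def)
    have \<delta>: "0 < \<delta>" "\<delta> \<le> 1" "\<delta> \<le> \<tau> * r\<^sup>2 / 8" using \<tau> r by (auto simp: \<delta>_def)
    obtain K :: nat where K: "0 < K" "1 / real K < \<tau> * r\<^sup>2 / 2"
      using nat_approx_posE[of "\<tau> * r\<^sup>2 / 2"] \<tau> r by (metis mult_pos_pos zero_less_Suc zero_less_power half_gt_zero)
    obtain a b c where sc: "scales a b c" and cb: "\<And>n. 4 * c n \<le> \<delta> * b n"
      and low: "\<And>n. B.prob {\<omega> \<in> space M\<^sub>2. \<not> low_start (unit_path e \<omega>) (a n) (c n) (b n)} \<le> 2 * \<delta>"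
      using B.ex_scales[OF \<delta>(1) \<delta>(1,2)] by blast
    interpret scales a b c by fact
    interpret RS: random_signed_order_scales M\<^sub>1 p "vimage_algebra (space M\<^sub>1) (\<lambda>\<omega> j. U j \<omega>) (PiM UNIV (\<lambda>_. borel))"
      S\<^sub>1 X\<^sub>1 "\<lambda>\<omega>. rec_prec (\<lambda>j. U j \<omega>) (\<lambda>j. S\<^sub>1 j \<omega>)" "\<lambda>k \<omega> x y. U k \<omega> \<in> {x<..y}" U a b c ..
    interpret BS: random_signed_order_scales M\<^sub>2 p "path_algebra M\<^sub>2 e" "\<lambda>k \<omega>. S\<^sub>2 (N k \<omega>) \<omega>" X\<^sub>2
      "\<lambda>\<omega>. br_prec (\<lambda>t. e t \<omega>) (\<lambda>m. S\<^sub>2 m \<omega>)" "\<lambda>k \<omega> x y. rational_min (unit_path e \<omega>) x y (N k \<omega>)" N a b c ..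
    let ?avg = "\<lambda>G \<mu>. (\<Sum>n<K. stat G n \<mu>) / real K"
    have rec_mean: "AE z in box n. d - d * \<delta> \<le> R.prob {\<omega> \<in> space M\<^sub>1. R.pattern (\<noteq>) \<omega> z}" for n
      using AE_boxI[OF AE_Leb3I[OF R.AE_branch]]
    proof eventually_elim
      case (elim z)
      obtain x y w where z: "z = (x, y, w)" by (metis prod.collapse)
      note bounds = box_bounds[OF conjunct2[OF elim], unfolded z fst_conv snd_conv]
      have y: "y \<le> 2 * c n" and w: "b n / 2 \<le> w" using elim by (auto simp: z mid_def far_def)
      \<comment> \<open>Here the ratio of \<open>c n\<close> to \<open>b n\<close> enters:
        \<open>y\<close> is at most \<open>2 * c n\<close>, hence at most
        \<open>\<delta> * b n / 2\<close>, hence at most \<open>\<delta> * w\<close>.\<close>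
      have "(y - x) / (w - x) \<le> \<delta>"
      proof -
        have "y \<le> \<delta> * w"
          using y w cb[of n] mult_left_mono[OF w, of \<delta>] \<delta>(1) by linarith
        moreover have "\<delta> * x \<le> x" using bounds \<delta> mult_right_mono[of \<delta> 1 x] by simp
        ultimately have "y - x \<le> \<delta> * (w - x)" unfolding right_diff_distrib by linarith
        then show ?thesis using bounds by (simp add: divide_le_eq)
      qed
      then have "R.prob {\<omega> \<in> space M\<^sub>1. R.branch \<omega> x y = R.branch \<omega> x w} \<le> \<delta>"
        using R.prob_same_branch[of x y w] bounds elim b_le_1[of n] by (auto simp: z)
      moreover have "R.prob {\<omega> \<in> space M\<^sub>1. R.branch \<omega> x y \<noteq> R.branch \<omega> x w} =
          1 - R.prob {\<omega> \<in> space M\<^sub>1. R.branch \<omega> x y = R.branch \<omega> x w}"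
      proof (rule R.prob_neg)
        have "(\<lambda>\<omega>. (R.branch \<omega> x y, R.branch \<omega> x w)) \<in> M\<^sub>1 \<rightarrow>\<^sub>M count_space UNIV"
          using R.measurable_F[OF R.branch_measurable_F] by measurable
        from measurable_compose[OF this, of "\<lambda>ij. fst ij = snd ij" "count_space UNIV"]
        show "{\<omega> \<in> space M\<^sub>1. R.branch \<omega> x y = R.branch \<omega> x w} \<in> R.events" by (simp add: pred_def)
      qed
      ultimately have "d * (1 - \<delta>) \<le> d * R.prob {\<omega> \<in> space M\<^sub>1. R.branch \<omega> x y \<noteq> R.branch \<omega> x w}"
        using d by (intro mult_left_mono) auto
      also have "\<dots> \<le> R.prob {\<omega> \<in> space M\<^sub>1. R.pattern (\<noteq>) \<omega> z}"
      proof -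
        have "d * R.prob {\<omega> \<in> space M\<^sub>1. (R.branch \<omega> x y, R.branch \<omega> x w) \<in> {(i, j). i \<noteq> j}} \<le>
            R.prob {\<omega> \<in> space M\<^sub>1. R.pattern (\<noteq>) \<omega> (x, y, w)}"
        proof (rule RS.pattern_prob_lower)
          show "d \<le> R.pattern_prob (\<noteq>) i j" if "(i, j) \<in> {(i, j). i \<noteq> j}" for i j
            using that R.pattern_prob_neq[of i j] unfolding d_def by simp
        qed (use d in simp)
        then show ?thesis by (simp only: z mem_Collect_eq prod.case)
      qed
      finally show ?case by (simp add: algebra_simps)
    qed
    have "R.pattern_prob (\<noteq>) i j \<le> d" for i j
      using d(1) R.pattern_prob_neq_refl[of i] R.pattern_prob_neq[of i j] unfolding d_def[symmetric]
      by (cases "i = j") auto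
    from RS.stat_deviation[OF this rec_mean K(1) r]
    have "R.prob {\<omega> \<in> space M\<^sub>1. r \<le> \<bar>?avg (\<noteq>) (X\<^sub>1 \<omega>) - d\<bar>} \<le> (1 / real K + 2 * d * (d * \<delta>)) / r\<^sup>2" .
    also have "\<dots> \<le> \<tau>"
    proof -
      have "d * (d * \<delta>) \<le> 1 * (1 * \<delta>)" using d \<delta> by (intro mult_mono) auto
      then have "1 / real K + 2 * d * (d * \<delta>) \<le> \<tau> * r\<^sup>2"
        unfolding mult.assoc[of 2] using K(2) \<delta>(1,3) by linarith
      then show ?thesis using r by (simp add: divide_le_eq)
    qed
    finally have rec: "R.prob {\<omega> \<in> space M\<^sub>1. r \<le> \<bar>?avg (\<noteq>) (X\<^sub>1 \<omega>) - d\<bar>} \<le> \<tau>" .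
    \<comment> \<open>On the event \<open>low_start\<close> both branch numbers coincide, so
      \<open>(=)\<close> holds whatever the signs are.\<close>
    have br_mean: "AE z in box n. 1 - 2 * \<delta> \<le> B.prob {\<omega> \<in> space M\<^sub>2. B.pattern (=) \<omega> z}" for n
      using AE_boxI[of "\<lambda>_. True", simplified]
    proof eventually_elim
      case (elim z)
      obtain x y w where z: "z = (x, y, w)" by (metis prod.collapse)
      have xyw: "x \<in> {0..a n}" "x < c n" "y \<in> {c n..b n}" "w \<in> {c n..b n}"
        using elim a_pos[of n] a_c[of n] c_b[of n] by (auto simp: z near_def mid_def far_def)
      have "1 - 2 * \<delta> \<le> 1 - B.prob {\<omega> \<in> space M\<^sub>2. \<not> low_start (unit_path e \<omega>) (a n) (c n) (b n)}"
        using low[of n] by simp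
      also have "\<dots> = B.prob {\<omega> \<in> space M\<^sub>2. low_start (unit_path e \<omega>) (a n) (c n) (b n)}"
        by (subst B.prob_neg) measurable
      also have "\<dots> \<le> B.prob {\<omega> \<in> space M\<^sub>2. B.pattern (=) \<omega> z}"
      proof (rule B.finite_measure_mono)
        have "z \<in> space Leb3" using xyw a_b[of n] b_le_1[of n] a_pos[of n] a_c[of n]
          by (auto simp: z space_pair_measure)
        then show "{\<omega> \<in> space M\<^sub>2. B.pattern (=) \<omega> z} \<in> B.events" by measurable
        show "{\<omega> \<in> space M\<^sub>2. low_start (unit_path e \<omega>) (a n) (c n) (b n)} \<subseteq> {\<omega> \<in> space M\<^sub>2. B.pattern (=) \<omega> z}"
        proof safe
          fix \<omega> assume \<omega>: "\<omega> \<in> space M\<^sub>2" and ls: "low_start (unit_path e \<omega>) (a n) (c n) (b n)"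
          have bnds: "0 < a n" "a n \<le> 1" "0 \<le> c n" "c n < b n" "b n \<le> 1"
            using a_pos[of n] a_c[of n] c_b[of n] a_b[of n] b_le_1[of n] by auto
          have "unit_path e \<omega> x < unit_path e \<omega> t" if "t \<in> {c n..b n}" for t
            using low_startD[OF B.unit_path_continuous[OF \<omega>] ls bnds xyw(1) that] .
          then have "rational_min (unit_path e \<omega>) x y m \<longleftrightarrow> rational_min (unit_path e \<omega>) x w m" for m
            using xyw bnds by (intro rational_min_independent B.unit_path_continuous[OF \<omega>]) auto
          then have "B.branch \<omega> x y = B.branch \<omega> x w" by (simp add: B.branch_def)
          then show "B.pattern (=) \<omega> z" by (simp add: B.pattern_def z)
        qed
      qed
      finally show ?case .
    qed
    have "B.pattern_prob (=) i j \<le> 1" for i j by (simp add: B.pattern_prob_def)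
    from BS.stat_deviation[OF this br_mean K(1) r]
    have br: "B.prob {\<omega> \<in> space M\<^sub>2. r \<le> \<bar>?avg (=) (X\<^sub>2 \<omega>) - 1\<bar>} \<le> (1 / real K + 2 * 1 * (2 * \<delta>)) / r\<^sup>2" .
    have [measurable]: "(\<lambda>\<omega>. stat G n (X\<^sub>2 \<omega>)) \<in> borel_measurable M\<^sub>2" for G n
      by (rule measurable_compose[OF B.X measurable_stat])
    \<comment> \<open>An average of \<open>(\<noteq>)\<close> within \<open>d / 2\<close> of
      \<open>d\<close> exceeds \<open>r = d / 2\<close>, which keeps the average of
      \<open>(=)\<close> at distance at least \<open>r\<close> from 1.\<close>
    have "B.prob {\<omega> \<in> space M\<^sub>2. \<bar>?avg (\<noteq>) (X\<^sub>2 \<omega>) - d\<bar> < r} \<le> B.prob {\<omega> \<in> space M\<^sub>2. r \<le> \<bar>?avg (=) (X\<^sub>2 \<omega>) - 1\<bar>}"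
    proof (rule B.finite_measure_mono_AE)
      have "AE \<omega> in M\<^sub>2. \<forall>n. stat (=) n (X\<^sub>2 \<omega>) = 1 - stat (\<noteq>) n (X\<^sub>2 \<omega>)"
        by (simp only: AE_all_countable) (intro allI BS.AE_stat_compl)
      then show "AE \<omega> in M\<^sub>2. \<omega> \<in> {\<omega> \<in> space M\<^sub>2. \<bar>?avg (\<noteq>) (X\<^sub>2 \<omega>) - d\<bar> < r} \<longrightarrow>
          \<omega> \<in> {\<omega> \<in> space M\<^sub>2. r \<le> \<bar>?avg (=) (X\<^sub>2 \<omega>) - 1\<bar>}"
      proof eventually_elim
        case (elim \<omega>)
        have "?avg (=) (X\<^sub>2 \<omega>) = 1 - ?avg (\<noteq>) (X\<^sub>2 \<omega>)"
          using K(1) by (simp add: elim sum_subtractf diff_divide_distrib)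
        then have "r \<le> \<bar>?avg (=) (X\<^sub>2 \<omega>) - 1\<bar>" if "\<bar>?avg (\<noteq>) (X\<^sub>2 \<omega>) - d\<bar> < r"
          using that unfolding r_def by linarith
        then show ?case by blast
      qed
    qed measurable
    also note br
    also have "(1 / real K + 2 * 1 * (2 * \<delta>)) / r\<^sup>2 \<le> \<tau>"
    proof -
      have "1 / real K + 2 * 1 * (2 * \<delta>) \<le> \<tau> * r\<^sup>2" using K(2) \<delta>(3) by linarith
      then show ?thesis using r by (simp add: divide_le_eq)
    qed
    finally show "\<exists>P. Measurable.pred permuton_space P \<and>
        R.prob {\<omega> \<in> space M\<^sub>1. \<not> P (X\<^sub>1 \<omega>)} \<le> \<tau> \<and> B.prob {\<omega> \<in> space M\<^sub>2. P (X\<^sub>2 \<omega>)} \<le> \<tau>"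
      using rec by (intro exI[of _ "\<lambda>\<mu>. \<bar>?avg (\<noteq>) \<mu> - d\<bar> < r"]) (auto simp: not_less)
  qed (fact R.prob_space_axioms B.prob_space_axioms R.X B.X)+
qed

lemma recursive_separable_permutonE:
  assumes "recursive_separable_permuton M p X" "p \<in> {0<..<1}"
  obtains U S where "recursive_order M p X U S"
  using assms by (auto simp: recursive_separable_permuton_def recursive_order_def recursive_order_axioms_def)

lemma brownian_separable_permutonE:
  assumes "brownian_separable_permuton M p X" "p \<in> {0<..<1}"
  obtains e S N where "brownian_order M p X e S N"
proof -
  from assms(1) obtain e S where *: "prob_space M" "X \<in> M \<rightarrow>\<^sub>M permuton_space" "brownian_excursion M e"
      "iid_signs_at_local_minima M p e S"
      "AE \<omega> in M. X \<omega> = order_measure (br_prec (\<lambda>t. e t \<omega>) (\<lambda>m. S m \<omega>))"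
    by (auto simp: brownian_separable_permuton_def)
  from *(4) obtain N where "\<And>k. N k \<in> borel_measurable (path_algebra M e)"
      "AE \<omega> in M. bij_betw (\<lambda>k. N k \<omega>) UNIV (local_minima (\<lambda>t. e t \<omega>))"
      "iid_signs M p (\<lambda>k \<omega>. S (N k \<omega>) \<omega>)"
      "independent_vars M (PiM {0..1} (\<lambda>_. borel)) (unit_path e)
        (PiM UNIV (\<lambda>_. count_space UNIV)) (\<lambda>\<omega> k. S (N k \<omega>) \<omega>)"
    by (auto simp: iid_signs_at_local_minima_def)
  with * assms(2) have "brownian_order M p X e S N"
    by (simp add: brownian_order_def brownian_order_axioms_def brownian_excursion_def)
  then show thesis by (rule that)
qed

theorem proposition1p3:
  fixes p q :: real
    and M\<^sub>1 :: "'a measure" and M\<^sub>2 :: "'b measure" and M\<^sub>3 :: "'c measure" and M\<^sub>4 :: "'d measure"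
    and R\<^sub>p :: "'a \<Rightarrow> (real \<times> real) measure" and R\<^sub>q :: "'b \<Rightarrow> (real \<times> real) measure"
    and B\<^sub>p :: "'c \<Rightarrow> (real \<times> real) measure" and B\<^sub>q :: "'d \<Rightarrow> (real \<times> real) measure"
  assumes "p \<in> {0<..<1}" and "q \<in> {0<..<1}" and "p \<noteq> q"
    and "recursive_separable_permuton M\<^sub>1 p R\<^sub>p"
    and "recursive_separable_permuton M\<^sub>2 q R\<^sub>q"
    and "brownian_separable_permuton M\<^sub>3 p B\<^sub>p"
    and "brownian_separable_permuton M\<^sub>4 q B\<^sub>q"
  shows "singular (distr M\<^sub>1 permuton_space R\<^sub>p) (distr M\<^sub>2 permuton_space R\<^sub>q) \<and>
    singular (distr M\<^sub>1 permuton_space R\<^sub>p) (distr M\<^sub>3 permuton_space B\<^sub>p) \<and>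
    singular (distr M\<^sub>1 permuton_space R\<^sub>p) (distr M\<^sub>4 permuton_space B\<^sub>q) \<and>
    singular (distr M\<^sub>2 permuton_space R\<^sub>q) (distr M\<^sub>3 permuton_space B\<^sub>p) \<and>
    singular (distr M\<^sub>2 permuton_space R\<^sub>q) (distr M\<^sub>4 permuton_space B\<^sub>q) \<and>
    singular (distr M\<^sub>3 permuton_space B\<^sub>p) (distr M\<^sub>4 permuton_space B\<^sub>q)"
proof -
  obtain U\<^sub>1 S\<^sub>1 where r1: "recursive_order M\<^sub>1 p R\<^sub>p U\<^sub>1 S\<^sub>1"
    using recursive_separable_permutonE assms(1,4) by blast
  obtain U\<^sub>2 S\<^sub>2 where r2: "recursive_order M\<^sub>2 q R\<^sub>q U\<^sub>2 S\<^sub>2"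
    using recursive_separable_permutonE assms(2,5) by blast
  obtain e\<^sub>3 S\<^sub>3 N\<^sub>3 where b3: "brownian_order M\<^sub>3 p B\<^sub>p e\<^sub>3 S\<^sub>3 N\<^sub>3"
    using brownian_separable_permutonE assms(1,6) by blast
  obtain e\<^sub>4 S\<^sub>4 N\<^sub>4 where b4: "brownian_order M\<^sub>4 q B\<^sub>q e\<^sub>4 S\<^sub>4 N\<^sub>4"
    using brownian_separable_permutonE assms(2,7) by blast
  interpret R1: recursive_order M\<^sub>1 p R\<^sub>p U\<^sub>1 S\<^sub>1 by (rule r1)
  interpret R2: recursive_order M\<^sub>2 q R\<^sub>q U\<^sub>2 S\<^sub>2 by (rule r2)
  interpret B3: brownian_order M\<^sub>3 p B\<^sub>p e\<^sub>3 S\<^sub>3 N\<^sub>3 by (rule b3)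
  interpret B4: brownian_order M\<^sub>4 q B\<^sub>q e\<^sub>4 S\<^sub>4 N\<^sub>4 by (rule b4)
  note orders = R1.random_signed_order_axioms R2.random_signed_order_axioms
    B3.random_signed_order_axioms B4.random_signed_order_axioms
  show ?thesis
    \<comment> \<open>Only the two pairs with equal parameter require the comparison of the two
      models.\<close>
    using singular_if_parameters_differ[OF orders(1,2) assms(3)]
      singular_recursive_brownian[OF r1 b3 assms(1)]
      singular_if_parameters_differ[OF orders(1,4) assms(3)]
      singular_if_parameters_differ[OF orders(2,3) assms(3)[symmetric]]
      singular_recursive_brownian[OF r2 b4 assms(2)]
      singular_if_parameters_differ[OF orders(3,4) assms(3)]
    by blast
qed

end
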